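(* Let $R$ be a commutative ring with identity and let $A$ be an associative $R$-algebra that is free as an $R$-module. Let $I$ be a (two-sided) ideal of $A$ such that $A$ and $A/I$ are projective as right $R$-modules and $\operatorname{Tor}^{(A,R)}_k(A/I,A/I)\cong 0$ for all $k\ge 1$. Let $M$ be a left $A/I$-module that is free as an $R$-module. Then the functor $A/I\otimes_A -\colon A\text{-Mod}\to A/I\text{-Mod}$ sends every projective resolution of $M$ in $A\text{-Mod}$ to a projective resolution of $M$ in $A/I\text{-Mod}$ (under the identification $A/I\otimes_A M\cong M$). If the initial resolution of $M$ in $A\text{-Mod}$ is minimal, then the resulting resolution in $A/I\text{-Mod}$ is also a minimal projective resolution of $M$.
   Context: $A/I$-modules are regarded as $A$-modules via $A\to A/I$. An $A$-module $P$ is $(A,R)$-projective if for every epimorphism $f\colon X\to Y$ of $A$-modules that is split as an epimorphism of $R$-modules, $\operatorname{Hom}_A(P,f)$ is surjective. An $(A,R)$-projective resolution of an $A$-module $M$ is an exact complex $P_\bullet\twoheadrightarrow M$ of $A$-modules with all $P_k$ $(A,R)$-projective, which is split as a complex of $R$-modules. Every $A$-module $M$ has such a resolution, e.g. the (unnormalized) bar resolution with terms $\beta_k(A,R,M)=A^{\otimes_R(k+1)}\otimes_R M$, $k\ge 0$, and the usual differentials. For a right $A$-module $N$ and a left $A$-module $M$, the relative torsion groups are $\operatorname{Tor}^{(A,R)}_k(N,M)=H_k(N\otimes_A P_\bullet)$, $k\ge 0$, where $P_\bullet$ is any $(A,R)$-projective resolution of $M$ (the result is independent of the choice). A submodule $N$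 of a module $M$ is superfluous if for every submodule $T$ of $M$, $N+T=M$ implies $T=M$. A projective resolution of $M$ is an exact complex $\cdots\to P_1\to P_0\to P_{-1}=M\to 0$ with differentials $d_k\colon P_{k+1}\to P_k$ ($k\ge -1$) and $P_k$ projective for $k\ge 0$; it is minimal if $\ker(d_k)$ is superfluous in $P_{k+1}$ for all $k\ge -1$. *)

theory Defs
  imports "HOL-Algebra.Module" "HOL-Algebra.QuotRing" "HOL-Algebra.Free_Abelian_Groups"
begin

section \<open>Modules over a not necessarily commutative ring\<close>

text \<open>The library's \<^locale>\<open>module\<close> requires a commutative ring; the axioms below are the same,
  and so is the record type. The ring fields \<^const>\<open>mult\<close> and \<^const>\<open>one\<close> that a module record
  inherits are never used for modules.\<close>

locale left_module = A?: ring A + M?: abelian_group M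
  for A :: "('a, 'x) ring_scheme" (structure) and M :: "('a, 'm, 'z) module_scheme" (structure) +
  assumes smult_closed [simp, intro]:
      "\<lbrakk>a \<in> carrier A; x \<in> carrier M\<rbrakk> \<Longrightarrow> a \<odot>\<^bsub>M\<^esub> x \<in> carrier M"
    and smult_l_distr:
      "\<lbrakk>a \<in> carrier A; b \<in> carrier A; x \<in> carrier M\<rbrakk> \<Longrightarrow>
       (a \<oplus> b) \<odot>\<^bsub>M\<^esub> x = a \<odot>\<^bsub>M\<^esub> x \<oplus>\<^bsub>M\<^esub> b \<odot>\<^bsub>M\<^esub> x"
    and smult_r_distr:
      "\<lbrakk>a \<in> carrier A; x \<in> carrier M; y \<in> carrier M\<rbrakk> \<Longrightarrow>
       a \<odot>\<^bsub>M\<^esub> (x \<oplus>\<^bsub>M\<^esub> y) = a \<odot>\<^bsub>M\<^esub> x \<oplus>\<^bsub>M\<^esub> a \<odot>\<^bsub>M\<^esub> y"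
    and smult_assoc1:
      "\<lbrakk>a \<in> carrier A; b \<in> carrier A; x \<in> carrier M\<rbrakk> \<Longrightarrow>
       (a \<otimes> b) \<odot>\<^bsub>M\<^esub> x = a \<odot>\<^bsub>M\<^esub> (b \<odot>\<^bsub>M\<^esub> x)"
    and smult_one [simp]: "x \<in> carrier M \<Longrightarrow> \<one> \<odot>\<^bsub>M\<^esub> x = x"

text \<open>A right \<open>A\<close>-module is a left module over the opposite ring; there \<open>a \<odot>\<^bsub>N\<^esub> n\<close> is to be read
  as \<open>n \<cdot> a\<close>.\<close>

definition opp_ring :: "('a, 'x) ring_scheme \<Rightarrow> ('a, 'x) ring_scheme" where
  "opp_ring A = A\<lparr>monoid.mult := \<lambda>x y. y \<otimes>\<^bsub>A\<^esub> x\<rparr>"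

definition lin_hom ::
    "('a, 'w) ring_scheme \<Rightarrow> ('a, 'm, 'y) module_scheme \<Rightarrow> ('a, 'n, 'z) module_scheme \<Rightarrow> ('m \<Rightarrow> 'n) set"
  where "lin_hom A U V = {f \<in> carrier U \<rightarrow> carrier V.
    (\<forall>x\<in>carrier U. \<forall>y\<in>carrier U. f (x \<oplus>\<^bsub>U\<^esub> y) = f x \<oplus>\<^bsub>V\<^esub> f y) \<and>
    (\<forall>a\<in>carrier A. \<forall>x\<in>carrier U. f (a \<odot>\<^bsub>U\<^esub> x) = a \<odot>\<^bsub>V\<^esub> f x)}"

definition mod_ker ::
    "('m, 'y) ring_scheme \<Rightarrow> ('n, 'z) ring_scheme \<Rightarrow> ('m \<Rightarrow> 'n) \<Rightarrow> 'm set"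
  where "mod_ker U V f = {x \<in> carrier U. f x = \<zero>\<^bsub>V\<^esub>}"

definition restrict_scalars ::
    "('s \<Rightarrow> 'a) \<Rightarrow> ('a, 'm, 'z) module_scheme \<Rightarrow> ('s, 'm) module"
  where "restrict_scalars h M =
    \<lparr>carrier = carrier M, monoid.mult = monoid.mult M, one = one M, ring.zero = ring.zero M, add = add M,
     smult = (\<lambda>s x. h s \<odot>\<^bsub>M\<^esub> x)\<rparr>"

definition left_regular :: "('a, 'x) ring_scheme \<Rightarrow> ('a, 'a) module" where
  "left_regular B = \<lparr>carrier = carrier B, monoid.mult = monoid.mult B, one = one B,
     ring.zero = ring.zero B, add = add B,
     smult = (\<lambda>b x. b \<otimes>\<^bsub>B\<^esub> x)\<rparr>"

definition right_regular :: "('a, 'x) ring_scheme \<Rightarrow> ('a, 'a) module" where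
  "right_regular B = \<lparr>carrier = carrier B, monoid.mult = monoid.mult B, one = one B,
     ring.zero = ring.zero B, add = add B,
     smult = (\<lambda>b x. x \<otimes>\<^bsub>B\<^esub> b)\<rparr>"

definition free_module :: "('a, 'x) ring_scheme \<Rightarrow> ('a, 'm, 'z) module_scheme \<Rightarrow> bool" where
  "free_module A M \<longleftrightarrow> left_module A M \<and> (\<exists>B \<subseteq> carrier M. \<forall>x\<in>carrier M.
     \<exists>!c :: 'm \<Rightarrow> 'a. (\<forall>b. c b \<in> carrier A) \<and> (\<forall>b. b \<notin> B \<longrightarrow> c b = \<zero>\<^bsub>A\<^esub>) \<and>
       finite {b. c b \<noteq> \<zero>\<^bsub>A\<^esub>} \<and> x = (\<Oplus>\<^bsub>M\<^esub> b\<in>{b. c b \<noteq> \<zero>\<^bsub>A\<^esub>}. c b \<odot>\<^bsub>M\<^esub> b))"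

definition superfluous ::
    "('a, 'x) ring_scheme \<Rightarrow> 'm set \<Rightarrow> ('a, 'm, 'z) module_scheme \<Rightarrow> bool"
  where "superfluous A N M \<longleftrightarrow> submodule N A M \<and>
    (\<forall>T. submodule T A M \<and> N <+>\<^bsub>M\<^esub> T = carrier M \<longrightarrow> T = carrier M)"


section \<open>Algebras\<close>

text \<open>The library's \<^locale>\<open>algebra\<close> has a commutative ring as its underlying ring.\<close>

locale assoc_algebra = module R A + ring A
  for R (structure) and A (structure) +
  assumes smult_mult_left:
      "\<lbrakk>r \<in> carrier R; x \<in> carrier A; y \<in> carrier A\<rbrakk> \<Longrightarrow>
       r \<odot>\<^bsub>A\<^esub> (x \<otimes>\<^bsub>A\<^esub> y) = (r \<odot>\<^bsub>A\<^esub> x) \<otimes>\<^bsub>A\<^esub> y"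
    and smult_mult_right:
      "\<lbrakk>r \<in> carrier R; x \<in> carrier A; y \<in> carrier A\<rbrakk> \<Longrightarrow>
       r \<odot>\<^bsub>A\<^esub> (x \<otimes>\<^bsub>A\<^esub> y) = x \<otimes>\<^bsub>A\<^esub> (r \<odot>\<^bsub>A\<^esub> y)"

text \<open>The \<open>R\<close>-module underlying a (left or right) module over an \<open>R\<close>-algebra \<open>A\<close>.\<close>

definition scalars :: "('r, 'a, 'x) module_scheme \<Rightarrow> ('a, 'm, 'z) module_scheme \<Rightarrow> ('r, 'm) module"
  where "scalars A U = restrict_scalars (\<lambda>r. r \<odot>\<^bsub>A\<^esub> \<one>\<^bsub>A\<^esub>) U"

text \<open>Modules over \<open>A/I\<close> as modules over \<open>A\<close>.\<close>

definition inflate ::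
    "('a, 'x) ring_scheme \<Rightarrow> 'a set \<Rightarrow> ('a set, 'm, 'z) module_scheme \<Rightarrow> ('a, 'm) module"
  where "inflate A I M = restrict_scalars (\<lambda>a. I +>\<^bsub>A\<^esub> a) M"


section \<open>Projective and relatively projective modules\<close>

text \<open>A definition cannot quantify over modules of all types. The test modules \<open>U\<close> and \<open>V\<close> below
  have elements of type \<^typ>\<open>('a \<times> 'p) list\<close>, which is large enough: \<open>projective_lift\<close> and
  \<open>rel_projective_lift\<close> prove the lifting property against modules of arbitrary types.\<close>

definition projective :: "('a, 'x) ring_scheme \<Rightarrow> ('a, 'p, 'z) module_scheme \<Rightarrow> bool" where
  "projective A P \<longleftrightarrow> left_module A P \<and>
    (\<forall>(U :: ('a, ('a \<times> 'p) list) module) (V :: ('a, ('a \<times> 'p) list) module).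
       left_module A U \<longrightarrow> left_module A V \<longrightarrow>
       (\<forall>f \<in> lin_hom A U V. f ` carrier U = carrier V \<longrightarrow>
         (\<forall>g \<in> lin_hom A P V. \<exists>h \<in> lin_hom A P U. \<forall>p\<in>carrier P. f (h p) = g p)))"

definition right_projective :: "('a, 'x) ring_scheme \<Rightarrow> ('a, 'p, 'z) module_scheme \<Rightarrow> bool" where
  "right_projective A P \<longleftrightarrow> projective (opp_ring A) P"

definition rel_projective ::
    "('r, 'w) ring_scheme \<Rightarrow> ('r, 'a, 'x) module_scheme \<Rightarrow> ('a, 'p, 'z) module_scheme \<Rightarrow> bool"
  where "rel_projective R A P \<longleftrightarrow> left_module A P \<and>
    (\<forall>(U :: ('a, ('a \<times> 'p) list) module) (V :: ('a, ('a \<times> 'p) list) module).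
       left_module A U \<longrightarrow> left_module A V \<longrightarrow>
       (\<forall>f \<in> lin_hom A U V. f ` carrier U = carrier V \<longrightarrow>
         (\<exists>s \<in> lin_hom R (scalars A V) (scalars A U). \<forall>y\<in>carrier V. f (s y) = y) \<longrightarrow>
         (\<forall>g \<in> lin_hom A P V. \<exists>h \<in> lin_hom A P U. \<forall>p\<in>carrier P. f (h p) = g p)))"


subsection \<open>Lifting against modules of arbitrary types\<close>

lemma lin_homD:
  assumes "f \<in> lin_hom A U V"
  shows "x \<in> carrier U \<Longrightarrow> f x \<in> carrier V"
    and "\<lbrakk>x \<in> carrier U; y \<in> carrier U\<rbrakk> \<Longrightarrow> f (x \<oplus>\<^bsub>U\<^esub> y) = f x \<oplus>\<^bsub>V\<^esub> f y"
    and "\<lbrakk>a \<in> carrier A; x \<in> carrier U\<rbrakk> \<Longrightarrow> f (a \<odot>\<^bsub>U\<^esub> x) = a \<odot>\<^bsub>V\<^esub> f x"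
  using assms by (auto simp: lin_hom_def)

lemma lin_homI:
  assumes "\<And>x. x \<in> carrier U \<Longrightarrow> f x \<in> carrier V"
    and "\<And>x y. \<lbrakk>x \<in> carrier U; y \<in> carrier U\<rbrakk> \<Longrightarrow> f (x \<oplus>\<^bsub>U\<^esub> y) = f x \<oplus>\<^bsub>V\<^esub> f y"
    and "\<And>a x. \<lbrakk>a \<in> carrier A; x \<in> carrier U\<rbrakk> \<Longrightarrow> f (a \<odot>\<^bsub>U\<^esub> x) = a \<odot>\<^bsub>V\<^esub> f x"
  shows "f \<in> lin_hom A U V"
  using assms by (auto simp: lin_hom_def)

lemma lin_hom_comp:
  "\<lbrakk>f \<in> lin_hom A U V; g \<in> lin_hom A V W\<rbrakk> \<Longrightarrow> g \<circ> f \<in> lin_hom A U W"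
  by (auto simp: lin_hom_def Pi_iff)

lemma scalars_simps [simp]:
  "carrier (scalars A U) = carrier U" "add (scalars A U) = add U"
  "ring.zero (scalars A U) = ring.zero U"
  "smult (scalars A U) r x = (r \<odot>\<^bsub>A\<^esub> \<one>\<^bsub>A\<^esub>) \<odot>\<^bsub>U\<^esub> x"
  by (simp_all add: scalars_def restrict_scalars_def)

lemma left_moduleI:
  fixes A :: "('a, 'x) ring_scheme" and M :: "('a, 'm, 'z) module_scheme"
  assumes "ring A"
    and zero: "\<zero>\<^bsub>M\<^esub> \<in> carrier M"
    and add: "\<And>x y. \<lbrakk>x \<in> carrier M; y \<in> carrier M\<rbrakk> \<Longrightarrow> x \<oplus>\<^bsub>M\<^esub> y \<in> carrier M"
    and assoc: "\<And>x y z. \<lbrakk>x \<in> carrier M; y \<in> carrier M; z \<in> carrier M\<rbrakk> \<Longrightarrow>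
       x \<oplus>\<^bsub>M\<^esub> y \<oplus>\<^bsub>M\<^esub> z = x \<oplus>\<^bsub>M\<^esub> (y \<oplus>\<^bsub>M\<^esub> z)"
    and comm: "\<And>x y. \<lbrakk>x \<in> carrier M; y \<in> carrier M\<rbrakk> \<Longrightarrow> x \<oplus>\<^bsub>M\<^esub> y = y \<oplus>\<^bsub>M\<^esub> x"
    and l_zero: "\<And>x. x \<in> carrier M \<Longrightarrow> \<zero>\<^bsub>M\<^esub> \<oplus>\<^bsub>M\<^esub> x = x"
    and inv: "\<And>x. x \<in> carrier M \<Longrightarrow> \<exists>y\<in>carrier M. y \<oplus>\<^bsub>M\<^esub> x = \<zero>\<^bsub>M\<^esub>"
    and closed: "\<And>a x. \<lbrakk>a \<in> carrier A; x \<in> carrier M\<rbrakk> \<Longrightarrow> a \<odot>\<^bsub>M\<^esub> x \<in> carrier M"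
    and ld: "\<And>a b x. \<lbrakk>a \<in> carrier A; b \<in> carrier A; x \<in> carrier M\<rbrakk> \<Longrightarrow>
       (a \<oplus>\<^bsub>A\<^esub> b) \<odot>\<^bsub>M\<^esub> x = a \<odot>\<^bsub>M\<^esub> x \<oplus>\<^bsub>M\<^esub> b \<odot>\<^bsub>M\<^esub> x"
    and rd: "\<And>a x y. \<lbrakk>a \<in> carrier A; x \<in> carrier M; y \<in> carrier M\<rbrakk> \<Longrightarrow>
       a \<odot>\<^bsub>M\<^esub> (x \<oplus>\<^bsub>M\<^esub> y) = a \<odot>\<^bsub>M\<^esub> x \<oplus>\<^bsub>M\<^esub> a \<odot>\<^bsub>M\<^esub> y"
    and sa: "\<And>a b x. \<lbrakk>a \<in> carrier A; b \<in> carrier A; x \<in> carrier M\<rbrakk> \<Longrightarrow>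
       (a \<otimes>\<^bsub>A\<^esub> b) \<odot>\<^bsub>M\<^esub> x = a \<odot>\<^bsub>M\<^esub> (b \<odot>\<^bsub>M\<^esub> x)"
    and so: "\<And>x. x \<in> carrier M \<Longrightarrow> \<one>\<^bsub>A\<^esub> \<odot>\<^bsub>M\<^esub> x = x"
  shows "left_module A M"
proof -
  have "abelian_group M"
    by (rule abelian_groupI) (use assms in auto)
  then show ?thesis
    using assms by (simp add: left_module_def left_module_axioms_def)
qed

lemma (in left_module) smult_neg:
  assumes "x \<in> carrier M" shows "(\<ominus> \<one>) \<odot>\<^bsub>M\<^esub> x \<oplus>\<^bsub>M\<^esub> x = \<zero>\<^bsub>M\<^esub>"
proof -
  have z: "\<zero> \<odot>\<^bsub>M\<^esub> x = \<zero>\<^bsub>M\<^esub>"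
  proof -
    have "\<zero> \<odot>\<^bsub>M\<^esub> x \<oplus>\<^bsub>M\<^esub> \<zero> \<odot>\<^bsub>M\<^esub> x = \<zero> \<odot>\<^bsub>M\<^esub> x"
      using smult_l_distr[of \<zero> \<zero> x] assms by simp
    then show ?thesis
      using assms M.add.l_cancel_one by blast
  qed
  have "(\<ominus> \<one> \<oplus> \<one>) \<odot>\<^bsub>M\<^esub> x = (\<ominus> \<one>) \<odot>\<^bsub>M\<^esub> x \<oplus>\<^bsub>M\<^esub> x"
    using smult_l_distr[of "\<ominus> \<one>" \<one> x] assms by simp
  then show ?thesis using z by (simp add: A.l_neg)
qed

lemma (in left_module) smult_zero:
  assumes "a \<in> carrier A" shows "a \<odot>\<^bsub>M\<^esub> \<zero>\<^bsub>M\<^esub> = \<zero>\<^bsub>M\<^esub>"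
proof -
  have "a \<odot>\<^bsub>M\<^esub> \<zero>\<^bsub>M\<^esub> \<oplus>\<^bsub>M\<^esub> a \<odot>\<^bsub>M\<^esub> \<zero>\<^bsub>M\<^esub> = a \<odot>\<^bsub>M\<^esub> \<zero>\<^bsub>M\<^esub>"
    using smult_r_distr[of a "\<zero>\<^bsub>M\<^esub>" "\<zero>\<^bsub>M\<^esub>"] assms by simp
  then show ?thesis using assms M.add.l_cancel_one by blast
qed

lemma left_module_transport:
  fixes U :: "('a, 'u, 'z) module_scheme" and r :: "'u \<Rightarrow> 't"
  assumes U: "left_module A U" and inj: "inj_on r (carrier U)"
  obtains V :: "('a, 't) module" where "left_module A V" "carrier V = r ` carrier U"
    "r \<in> lin_hom A U V" "inv_into (carrier U) r \<in> lin_hom A V U"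
proof -
  interpret U: left_module A U by (fact U)
  let ?i = "inv_into (carrier U) r"
  define V :: "('a, 't) module" where "V = \<lparr>carrier = r ` carrier U, monoid.mult = undefined,
    one = undefined, ring.zero = r \<zero>\<^bsub>U\<^esub>, add = (\<lambda>x y. r (?i x \<oplus>\<^bsub>U\<^esub> ?i y)),
    smult = (\<lambda>a x. r (a \<odot>\<^bsub>U\<^esub> ?i x))\<rparr>"
  have i [simp]: "?i (r x) = x" if "x \<in> carrier U" for x
    using inj that by simp
  have V: "left_module A V"
  proof (rule left_moduleI)
    show "ring A" by (rule U.A.ring_axioms)
  next
    fix x assume "x \<in> carrier V"
    then obtain u where u: "u \<in> carrier U" "x = r u" by (auto simp: V_def)
    show "\<exists>y\<in>carrier V. y \<oplus>\<^bsub>V\<^esub> x = \<zero>\<^bsub>V\<^esub>"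
      by (rule bexI[of _ "r (\<ominus>\<^bsub>U\<^esub> u)"]) (use u in \<open>auto simp: V_def U.M.l_neg\<close>)
  qed (auto simp: V_def U.M.a_ac U.smult_l_distr U.smult_r_distr U.smult_assoc1)
  moreover have "r \<in> lin_hom A U V" "?i \<in> lin_hom A V U"
    by (auto simp: lin_hom_def V_def)
  ultimately show ?thesis using that[of V] by (simp add: V_def)
qed

text \<open>The submodule of \<open>U \<times> P\<close> generated by the graph of \<open>s\<close>, up to isomorphism.\<close>

lemma small_pullback:
  fixes P :: "('a, 'p, 'y) module_scheme" and U :: "('a, 'u, 'z) module_scheme"
  assumes P: "left_module A P" and U: "left_module A U" and V: "left_module A V"
    and f: "f \<in> lin_hom A U V" and g: "g \<in> lin_hom A P V"
    and s: "\<And>p. p \<in> carrier P \<Longrightarrow> s p \<in> carrier U \<and> f (s p) = g p"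
  obtains E :: "('a, ('a \<times> 'p) list) module" and v w t
  where "left_module A E" "v \<in> lin_hom A E U" "w \<in> lin_hom A E P"
    "\<And>z. z \<in> carrier E \<Longrightarrow> f (v z) = g (w z)"
    "\<And>p. p \<in> carrier P \<Longrightarrow> t p \<in> carrier E \<and> w (t p) = p \<and> v (t p) = s p"
    "inj_on (\<lambda>z. (v z, w z)) (carrier E)"
proof -
  interpret P: left_module A P by (fact P)
  interpret U: left_module A U by (fact U)
  interpret V: left_module A V by (fact V)
  define L where "L = {l :: ('a \<times> 'p) list. set l \<subseteq> carrier A \<times> carrier P}"
  define eu where "eu l = foldr (\<lambda>(a, p) z. a \<odot>\<^bsub>U\<^esub> s p \<oplus>\<^bsub>U\<^esub> z) l \<zero>\<^bsub>U\<^esub>" for l :: "('a \<times> 'p) list"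
  define ep where "ep l = foldr (\<lambda>(a, p) z. a \<odot>\<^bsub>P\<^esub> p \<oplus>\<^bsub>P\<^esub> z) l \<zero>\<^bsub>P\<^esub>" for l :: "('a \<times> 'p) list"
  define D where "D = (\<lambda>l. (eu l, ep l)) ` L"
  have [simp]: "eu [] = \<zero>\<^bsub>U\<^esub>" "ep [] = \<zero>\<^bsub>P\<^esub>"
      "eu ((a, p) # l) = a \<odot>\<^bsub>U\<^esub> s p \<oplus>\<^bsub>U\<^esub> eu l" "ep ((a, p) # l) = a \<odot>\<^bsub>P\<^esub> p \<oplus>\<^bsub>P\<^esub> ep l" for a p l
    by (auto simp: eu_def ep_def)
  have LCons: "(a, p) # l \<in> L \<longleftrightarrow> a \<in> carrier A \<and> p \<in> carrier P \<and> l \<in> L" for a p l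
    by (auto simp: L_def)
  have closed: "l \<in> L \<Longrightarrow> eu l \<in> carrier U \<and> ep l \<in> carrier P" for l
    by (induction l) (auto simp: LCons s)
  have app: "\<lbrakk>l \<in> L; l' \<in> L\<rbrakk> \<Longrightarrow> l @ l' \<in> L \<and> eu (l @ l') = eu l \<oplus>\<^bsub>U\<^esub> eu l' \<and> ep (l @ l') = ep l \<oplus>\<^bsub>P\<^esub> ep l'"
    for l l'
    by (induction l) (auto simp: LCons s closed U.M.a_assoc P.M.a_assoc)
  have sm: "\<lbrakk>a \<in> carrier A; l \<in> L\<rbrakk> \<Longrightarrow> map (\<lambda>(b, p). (a \<otimes>\<^bsub>A\<^esub> b, p)) l \<in> L \<and>
      eu (map (\<lambda>(b, p). (a \<otimes>\<^bsub>A\<^esub> b, p)) l) = a \<odot>\<^bsub>U\<^esub> eu l \<and>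
      ep (map (\<lambda>(b, p). (a \<otimes>\<^bsub>A\<^esub> b, p)) l) = a \<odot>\<^bsub>P\<^esub> ep l" for a l
  proof (induction l)
    case Nil then show ?case by (simp add: U.smult_zero P.smult_zero)
  next
    case (Cons x l) then show ?case
      by (cases x) (auto simp: LCons s closed U.smult_r_distr P.smult_r_distr
          U.smult_assoc1 P.smult_assoc1)
  qed
  define W :: "('a, 'u \<times> 'p) module" where "W = \<lparr>carrier = D, monoid.mult = undefined,
    one = undefined, ring.zero = (\<zero>\<^bsub>U\<^esub>, \<zero>\<^bsub>P\<^esub>),
    add = (\<lambda>x y. (fst x \<oplus>\<^bsub>U\<^esub> fst y, snd x \<oplus>\<^bsub>P\<^esub> snd y)),
    smult = (\<lambda>a x. (a \<odot>\<^bsub>U\<^esub> fst x, a \<odot>\<^bsub>P\<^esub> snd x))\<rparr>"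
  have Dc: "x \<in> D \<Longrightarrow> fst x \<in> carrier U \<and> snd x \<in> carrier P" for x
    using closed by (auto simp: D_def)
  have Dz: "(\<zero>\<^bsub>U\<^esub>, \<zero>\<^bsub>P\<^esub>) \<in> D"
    by (auto simp: D_def L_def intro!: image_eqI[of _ _ "[]"])
  have Da: "(fst x \<oplus>\<^bsub>U\<^esub> fst y, snd x \<oplus>\<^bsub>P\<^esub> snd y) \<in> D" if "x \<in> D" "y \<in> D" for x y
  proof -
    obtain l l' where l: "l \<in> L" "l' \<in> L" "x = (eu l, ep l)" "y = (eu l', ep l')"
      using \<open>x \<in> D\<close> \<open>y \<in> D\<close> by (auto simp: D_def)
    show ?thesis unfolding D_def
      by (rule image_eqI[of _ _ "l @ l'"]) (use l app in auto)
  qed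
  have Ds: "(a \<odot>\<^bsub>U\<^esub> fst x, a \<odot>\<^bsub>P\<^esub> snd x) \<in> D" if "a \<in> carrier A" "x \<in> D" for a x
  proof -
    obtain l where l: "l \<in> L" "x = (eu l, ep l)"
      using \<open>x \<in> D\<close> by (auto simp: D_def)
    show ?thesis unfolding D_def
      by (rule image_eqI[of _ _ "map (\<lambda>(b, p). (a \<otimes>\<^bsub>A\<^esub> b, p)) l"]) (use l sm that in auto)
  qed
  have W: "left_module A W"
  proof (rule left_moduleI)
    show "ring A" by (rule P.A.ring_axioms)
  next
    fix x assume "x \<in> carrier W"
    then have x: "x \<in> D" by (simp add: W_def)
    show "\<exists>y\<in>carrier W. y \<oplus>\<^bsub>W\<^esub> x = \<zero>\<^bsub>W\<^esub>"
      by (rule bexI[of _ "((\<ominus>\<^bsub>A\<^esub> \<one>\<^bsub>A\<^esub>) \<odot>\<^bsub>U\<^esub> fst x, (\<ominus>\<^bsub>A\<^esub> \<one>\<^bsub>A\<^esub>) \<odot>\<^bsub>P\<^esub> snd x)"])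
        (use x Dc Ds in \<open>auto simp: W_def U.smult_neg P.smult_neg\<close>)
  qed (auto simp: W_def Dz Da Ds dest!: Dc
      intro: U.M.a_assoc P.M.a_assoc U.M.a_comm P.M.a_comm U.smult_l_distr P.smult_l_distr
        U.smult_r_distr P.smult_r_distr U.smult_assoc1 P.smult_assoc1)
  define r where "r z = (SOME l. l \<in> L \<and> (eu l, ep l) = z)" for z
  have r: "(eu (r z), ep (r z)) = z" if "z \<in> D" for z
  proof -
    have "r z \<in> L \<and> (eu (r z), ep (r z)) = z"
      unfolding r_def by (rule someI_ex) (use that in \<open>auto simp: D_def\<close>)
    then show ?thesis by blast
  qed
  have inj: "inj_on r (carrier W)"
    by (rule inj_on_inverseI[of _ "\<lambda>l. (eu l, ep l)"]) (use r in \<open>auto simp: W_def\<close>)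
  obtain E :: "('a, ('a \<times> 'p) list) module" where E: "left_module A E" "carrier E = r ` carrier W"
      "r \<in> lin_hom A W E" "inv_into (carrier W) r \<in> lin_hom A E W"
    using left_module_transport[OF W inj] by blast
  let ?i = "inv_into (carrier W) r"
  have fst: "fst \<in> lin_hom A W U" and snd: "snd \<in> lin_hom A W P"
    using Dc by (auto simp: lin_hom_def W_def)
  have fz: "f \<zero>\<^bsub>U\<^esub> = \<zero>\<^bsub>V\<^esub>"
    using lin_homD(1)[OF f, of "\<zero>\<^bsub>U\<^esub>"] lin_homD(2)[OF f, of "\<zero>\<^bsub>U\<^esub>" "\<zero>\<^bsub>U\<^esub>"] V.M.add.l_cancel_one
    by simp
  have gz: "g \<zero>\<^bsub>P\<^esub> = \<zero>\<^bsub>V\<^esub>"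
    using lin_homD(1)[OF g, of "\<zero>\<^bsub>P\<^esub>"] lin_homD(2)[OF g, of "\<zero>\<^bsub>P\<^esub>" "\<zero>\<^bsub>P\<^esub>"] V.M.add.l_cancel_one
    by simp
  have comm: "f (eu l) = g (ep l)" if "l \<in> L" for l
    using that
    by (induction l) (auto simp: LCons s closed fz gz lin_homD[OF f] lin_homD[OF g])
  have tD: "(s p, p) \<in> D" if "p \<in> carrier P" for p
    unfolding D_def by (rule image_eqI[of _ _ "[(\<one>\<^bsub>A\<^esub>, p)]"]) (use that s in \<open>auto simp: L_def\<close>)
  show ?thesis
  proof (rule that[of E "fst \<circ> ?i" "snd \<circ> ?i" "\<lambda>p. r (s p, p)"])
    show "left_module A E" by (fact E(1))
    show "fst \<circ> ?i \<in> lin_hom A E U" "snd \<circ> ?i \<in> lin_hom A E P"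
      using lin_hom_comp E(4) fst snd by blast+
    show "f ((fst \<circ> ?i) z) = g ((snd \<circ> ?i) z)" if z: "z \<in> carrier E" for z
    proof -
      have "?i z \<in> D" using lin_homD(1)[OF E(4) z] by (simp add: W_def)
      then show ?thesis using comm by (auto simp: D_def)
    qed
    show "r (s p, p) \<in> carrier E \<and> (snd \<circ> ?i) (r (s p, p)) = p \<and> (fst \<circ> ?i) (r (s p, p)) = s p"
      if "p \<in> carrier P" for p
      using tD[OF that] inj E(2) by (auto simp: W_def)
    show "inj_on (\<lambda>z. ((fst \<circ> ?i) z, (snd \<circ> ?i) z)) (carrier E)"
      using inj_on_inv_into[of "carrier E" r "carrier W"] E(2) by (auto simp: inj_on_def)
  qed
qed

lemma lifting_aux:
  fixes P :: "('a, 'p, 'y) module_scheme" and U :: "('a, 'u, 'z) module_scheme"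
  assumes P: "left_module A P" and U: "left_module A U" and V: "left_module A V"
    and f: "f \<in> lin_hom A U V" and g: "g \<in> lin_hom A P V"
    and s: "\<And>p. p \<in> carrier P \<Longrightarrow> s p \<in> carrier U \<and> f (s p) = g p"
    and lift: "\<And>(E :: ('a, ('a \<times> 'p) list) module) (P' :: ('a, ('a \<times> 'p) list) module) v w t i j.
      \<lbrakk>left_module A E; left_module A P'; v \<in> lin_hom A E U; w \<in> lin_hom A E P;
       i \<in> lin_hom A P P'; j \<in> lin_hom A P' P; \<And>p. p \<in> carrier P \<Longrightarrow> j (i p) = p;
       \<And>q. q \<in> carrier P' \<Longrightarrow> i (j q) = q;
       \<And>p. p \<in> carrier P \<Longrightarrow> t p \<in> carrier E \<and> w (t p) = p \<and> v (t p) = s p;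
       inj_on (\<lambda>z. (v z, w z)) (carrier E); i \<circ> w \<in> lin_hom A E P';
       (i \<circ> w) ` carrier E = carrier P'\<rbrakk>
      \<Longrightarrow> \<exists>h \<in> lin_hom A P E. \<forall>p\<in>carrier P. (i \<circ> w) (h p) = i p"
  shows "\<exists>h \<in> lin_hom A P U. \<forall>p\<in>carrier P. f (h p) = g p"
proof -
  interpret P: left_module A P by (fact P)
  obtain E :: "('a, ('a \<times> 'p) list) module" and v w t
  where E: "left_module A E" "v \<in> lin_hom A E U" "w \<in> lin_hom A E P"
    "\<And>z. z \<in> carrier E \<Longrightarrow> f (v z) = g (w z)"
    "\<And>p. p \<in> carrier P \<Longrightarrow> t p \<in> carrier E \<and> w (t p) = p \<and> v (t p) = s p"
    "inj_on (\<lambda>z. (v z, w z)) (carrier E)"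
    using small_pullback[OF P U V f g s] by blast
  define i where "i = (\<lambda>p :: 'p. [(\<zero>\<^bsub>A\<^esub>, p)])"
  have inj: "inj_on i (carrier P)" by (auto simp: i_def inj_on_def)
  obtain P' :: "('a, ('a \<times> 'p) list) module" where P': "left_module A P'"
      "carrier P' = i ` carrier P" "i \<in> lin_hom A P P'" "inv_into (carrier P) i \<in> lin_hom A P' P"
    using left_module_transport[OF P inj] by blast
  have iw: "i \<circ> w \<in> lin_hom A E P'"
    using E(3) P'(3) by (rule lin_hom_comp)
  have im: "(i \<circ> w) ` carrier E = carrier P'"
  proof
    show "(i \<circ> w) ` carrier E \<subseteq> carrier P'" using lin_homD(1)[OF iw] by auto
    show "carrier P' \<subseteq> (i \<circ> w) ` carrier E"
    proof
      fix q assume "q \<in> carrier P'"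
      then obtain p where "p \<in> carrier P" "q = i p" using P'(2) by auto
      then show "q \<in> (i \<circ> w) ` carrier E" using E(5)[of p] by force
    qed
  qed
  have "\<exists>h \<in> lin_hom A P E. \<forall>p\<in>carrier P. (i \<circ> w) (h p) = i p"
  proof (rule lift[OF E(1) P'(1) E(2,3) P'(3,4) _ _ E(5,6) iw im])
  qed (use inj P'(2) in auto)
  then obtain h where h: "h \<in> lin_hom A P E" "\<And>p. p \<in> carrier P \<Longrightarrow> i (w (h p)) = i p"
    by auto
  have "f ((v \<circ> h) p) = g p" if p: "p \<in> carrier P" for p
    using h(2)[OF p] E(4)[OF lin_homD(1)[OF h(1) p]] by (simp add: i_def)
  then show ?thesis using lin_hom_comp[OF h(1) E(2)] by blast
qed

theorem projective_lift:
  assumes P: "projective A P" and U: "left_module A U" and V: "left_module A V"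
    and f: "f \<in> lin_hom A U V" and surj: "f ` carrier U = carrier V"
    and g: "g \<in> lin_hom A P V"
  shows "\<exists>h \<in> lin_hom A P U. \<forall>p\<in>carrier P. f (h p) = g p"
proof -
  have "\<exists>u. u \<in> carrier U \<and> f u = g p" if "p \<in> carrier P" for p
    using lin_homD(1)[OF g that] unfolding surj[symmetric] by auto
  then obtain s where s: "\<And>p. p \<in> carrier P \<Longrightarrow> s p \<in> carrier U \<and> f (s p) = g p"
    by metis
  show ?thesis
    by (rule lifting_aux[OF _ U V f g s]) (use P in \<open>unfold projective_def, blast+\<close>)
qed

theorem rel_projective_lift:
  fixes A :: "('r, 'a, 'x) module_scheme" and P :: "('a, 'p, 'z) module_scheme"
  assumes R: "assoc_algebra R A" and P: "rel_projective R A P"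
    and U: "left_module A U" and V: "left_module A V"
    and f: "f \<in> lin_hom A U V" and surj: "f ` carrier U = carrier V"
    and split: "\<sigma> \<in> lin_hom R (scalars A V) (scalars A U)" "\<And>y. y \<in> carrier V \<Longrightarrow> f (\<sigma> y) = y"
    and g: "g \<in> lin_hom A P V"
  shows "\<exists>h \<in> lin_hom A P U. \<forall>p\<in>carrier P. f (h p) = g p"
proof (rule lifting_aux[OF _ U V f g])
  interpret R: assoc_algebra R A by (fact R)
  show PA: "left_module A P" using P by (simp add: rel_projective_def)
  interpret P: left_module A P by (fact PA)
  show "(\<sigma> \<circ> g) p \<in> carrier U \<and> f ((\<sigma> \<circ> g) p) = g p" if "p \<in> carrier P" for p
    using lin_homD(1)[OF g that] split(2) lin_homD(1)[OF split(1)] by simp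
  fix E P' :: "('a, ('a \<times> 'p) list) module" and v w t i j
  assume E: "left_module A E" "left_module A P'" "v \<in> lin_hom A E U" "w \<in> lin_hom A E P"
       "i \<in> lin_hom A P P'" "j \<in> lin_hom A P' P" "\<And>p. p \<in> carrier P \<Longrightarrow> j (i p) = p"
       "\<And>q. q \<in> carrier P' \<Longrightarrow> i (j q) = q"
       "\<And>p. p \<in> carrier P \<Longrightarrow> t p \<in> carrier E \<and> w (t p) = p \<and> v (t p) = (\<sigma> \<circ> g) p"
       "inj_on (\<lambda>z. (v z, w z)) (carrier E)" "i \<circ> w \<in> lin_hom A E P'"
       "(i \<circ> w) ` carrier E = carrier P'"
  interpret E: left_module A E by (fact E(1))
  have one: "r \<odot>\<^bsub>A\<^esub> \<one>\<^bsub>A\<^esub> \<in> carrier A" if "r \<in> carrier R" for r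
    using that R.smult_closed by simp
  have eq: "x = y" if "x \<in> carrier E" "y \<in> carrier E" "v x = v y" "w x = w y" for x y
    using inj_onD[OF E(10), of x y] that by auto
  have sg: "\<sigma> (g p) \<in> carrier U" if "p \<in> carrier P" for p
    using lin_homD(1)[OF g that] lin_homD(1)[OF split(1)] by simp
  have t: "t \<in> lin_hom R (scalars A P) (scalars A E)"
  proof (rule lin_homI; simp)
    show "t p \<in> carrier E" if "p \<in> carrier P" for p using E(9) that by blast
    show "t (p \<oplus>\<^bsub>P\<^esub> p') = t p \<oplus>\<^bsub>E\<^esub> t p'" if p: "p \<in> carrier P" "p' \<in> carrier P" for p p'
    proof (rule eq)
      show "v (t (p \<oplus>\<^bsub>P\<^esub> p')) = v (t p \<oplus>\<^bsub>E\<^esub> t p')"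
        using p E(9) lin_homD(2)[OF split(1)] lin_homD(1)[OF g]
        by (simp add: lin_homD(2)[OF E(3)] lin_homD(2)[OF g])
      show "w (t (p \<oplus>\<^bsub>P\<^esub> p')) = w (t p \<oplus>\<^bsub>E\<^esub> t p')"
        using p E(9) by (simp add: lin_homD(2)[OF E(4)])
    qed (use p E(9) in auto)
    show "t ((r \<odot>\<^bsub>A\<^esub> \<one>\<^bsub>A\<^esub>) \<odot>\<^bsub>P\<^esub> p) = (r \<odot>\<^bsub>A\<^esub> \<one>\<^bsub>A\<^esub>) \<odot>\<^bsub>E\<^esub> t p"
      if p: "r \<in> carrier R" "p \<in> carrier P" for r p
    proof (rule eq)
      show "v (t ((r \<odot>\<^bsub>A\<^esub> \<one>\<^bsub>A\<^esub>) \<odot>\<^bsub>P\<^esub> p)) = v ((r \<odot>\<^bsub>A\<^esub> \<one>\<^bsub>A\<^esub>) \<odot>\<^bsub>E\<^esub> t p)"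
        using p E(9) one lin_homD(3)[OF split(1)] lin_homD(1)[OF g]
        by (simp add: lin_homD(3)[OF E(3)] lin_homD(3)[OF g])
      show "w (t ((r \<odot>\<^bsub>A\<^esub> \<one>\<^bsub>A\<^esub>) \<odot>\<^bsub>P\<^esub> p)) = w ((r \<odot>\<^bsub>A\<^esub> \<one>\<^bsub>A\<^esub>) \<odot>\<^bsub>E\<^esub> t p)"
        using p E(9) one by (simp add: lin_homD(3)[OF E(4)])
    qed (use p one E(9) in auto)
  qed
  have j: "j \<in> lin_hom R (scalars A P') (scalars A P)"
    using E(6) one by (auto simp: lin_hom_def)
  have "(i \<circ> w) ((t \<circ> j) q) = q" if "q \<in> carrier P'" for q
    using that E(8,9) lin_homD(1)[OF E(6)] by simp
  with lin_hom_comp[OF j t] P E(1,2,5,11,12)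
  show "\<exists>h \<in> lin_hom A P E. \<forall>p\<in>carrier P. (i \<circ> w) (h p) = i p"
    unfolding rel_projective_def by blast
qed


section \<open>Resolutions\<close>

text \<open>\<open>d k\<close> maps \<open>P (k + 1)\<close> to \<open>P k\<close>, and \<open>e\<close> is the augmentation \<open>d\<^sub>-\<^sub>1\<close> from \<open>P 0\<close> to \<open>M\<close>.\<close>

definition resolution ::
    "('a, 'x) ring_scheme \<Rightarrow> ('a, 'm, 'y) module_scheme \<Rightarrow> (nat \<Rightarrow> ('a, 'p, 'z) module_scheme) \<Rightarrow>
     (nat \<Rightarrow> 'p \<Rightarrow> 'p) \<Rightarrow> ('p \<Rightarrow> 'm) \<Rightarrow> bool"
  where "resolution A M P d e \<longleftrightarrow>
    left_module A M \<and> (\<forall>k. left_module A (P k)) \<and>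
    e \<in> lin_hom A (P 0) M \<and> (\<forall>k. d k \<in> lin_hom A (P (Suc k)) (P k)) \<and>
    e ` carrier (P 0) = carrier M \<and>
    d 0 ` carrier (P 1) = mod_ker (P 0) M e \<and>
    (\<forall>k. d (Suc k) ` carrier (P (Suc (Suc k))) = mod_ker (P (Suc k)) (P k) (d k))"

definition projective_resolution ::
    "('a, 'x) ring_scheme \<Rightarrow> ('a, 'm, 'y) module_scheme \<Rightarrow> (nat \<Rightarrow> ('a, 'p, 'z) module_scheme) \<Rightarrow>
     (nat \<Rightarrow> 'p \<Rightarrow> 'p) \<Rightarrow> ('p \<Rightarrow> 'm) \<Rightarrow> bool"
  where "projective_resolution A M P d e \<longleftrightarrow> resolution A M P d e \<and> (\<forall>k. projective A (P k))"

definition minimal_projective_resolution ::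
    "('a, 'x) ring_scheme \<Rightarrow> ('a, 'm, 'y) module_scheme \<Rightarrow> (nat \<Rightarrow> ('a, 'p, 'z) module_scheme) \<Rightarrow>
     (nat \<Rightarrow> 'p \<Rightarrow> 'p) \<Rightarrow> ('p \<Rightarrow> 'm) \<Rightarrow> bool"
  where "minimal_projective_resolution A M P d e \<longleftrightarrow> projective_resolution A M P d e \<and>
    superfluous A (mod_ker (P 0) M e) (P 0) \<and>
    (\<forall>k. superfluous A (mod_ker (P (Suc k)) (P k) (d k)) (P (Suc k)))"

text \<open>A complex with differential \<open>d\<close> is split if \<open>d s d = d\<close> for some linear \<open>s\<close> of degree \<open>1\<close>; for
  an exact complex this means that every kernel is a direct summand, or equivalently that the
  complex is contractible.\<close>

definition rel_projective_resolution ::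
    "('r, 'w) ring_scheme \<Rightarrow> ('r, 'a, 'x) module_scheme \<Rightarrow> ('a, 'm, 'y) module_scheme \<Rightarrow>
     (nat \<Rightarrow> ('a, 'p, 'z) module_scheme) \<Rightarrow> (nat \<Rightarrow> 'p \<Rightarrow> 'p) \<Rightarrow> ('p \<Rightarrow> 'm) \<Rightarrow> bool"
  where "rel_projective_resolution R A M P d e \<longleftrightarrow>
    resolution A M P d e \<and> (\<forall>k. rel_projective R A (P k)) \<and>
    (\<exists>\<sigma> \<in> lin_hom R (scalars A M) (scalars A (P 0)). \<forall>x\<in>carrier (P 0). e (\<sigma> (e x)) = e x) \<and>
    (\<forall>k. \<exists>s \<in> lin_hom R (scalars A (P k)) (scalars A (P (Suc k))).
       \<forall>x\<in>carrier (P (Suc k)). d k (s (d k x)) = d k x)"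


section \<open>Tensor products\<close>

text \<open>\<open>N \<otimes>\<^sub>A U\<close> for a right module \<open>N\<close> and a left module \<open>U\<close> is the free abelian group on
  \<open>N \<times> U\<close> modulo the usual relations. Only the additive structure of the record is meaningful.\<close>

definition tensor_relations ::
    "('a, 'w) ring_scheme \<Rightarrow> ('a, 'n, 'y) module_scheme \<Rightarrow> ('a, 'm, 'z) module_scheme \<Rightarrow>
     (('n \<times> 'm) \<Rightarrow>\<^sub>0 int) set"
  where "tensor_relations A N U =
    {frag_of (n \<oplus>\<^bsub>N\<^esub> n', x) - frag_of (n, x) - frag_of (n', x) | n n' x.
       n \<in> carrier N \<and> n' \<in> carrier N \<and> x \<in> carrier U} \<union>
    {frag_of (n, x \<oplus>\<^bsub>U\<^esub> x') - frag_of (n, x) - frag_of (n, x') | n x x'.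
       n \<in> carrier N \<and> x \<in> carrier U \<and> x' \<in> carrier U} \<union>
    {frag_of (a \<odot>\<^bsub>N\<^esub> n, x) - frag_of (n, a \<odot>\<^bsub>U\<^esub> x) | a n x.
       a \<in> carrier A \<and> n \<in> carrier N \<and> x \<in> carrier U}"

definition tensor_null ::
    "('a, 'w) ring_scheme \<Rightarrow> ('a, 'n, 'y) module_scheme \<Rightarrow> ('a, 'm, 'z) module_scheme \<Rightarrow>
     (('n \<times> 'm) \<Rightarrow>\<^sub>0 int) set"
  where "tensor_null A N U =
    generate (free_Abelian_group (carrier N \<times> carrier U)) (tensor_relations A N U)"

definition tensor ::
    "('a, 'w) ring_scheme \<Rightarrow> ('a, 'n, 'y) module_scheme \<Rightarrow> ('a, 'm, 'z) module_scheme \<Rightarrow>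
     (('n \<times> 'm) \<Rightarrow>\<^sub>0 int) set ring"
  where "tensor A N U =
    (let T = free_Abelian_group (carrier N \<times> carrier U) Mod tensor_null A N U
     in \<lparr>carrier = carrier T, monoid.mult = undefined, one = undefined, ring.zero = one T, add = monoid.mult T\<rparr>)"

definition pure_tensor ::
    "('a, 'w) ring_scheme \<Rightarrow> ('a, 'n, 'y) module_scheme \<Rightarrow> ('a, 'm, 'z) module_scheme \<Rightarrow>
     'n \<Rightarrow> 'm \<Rightarrow> (('n \<times> 'm) \<Rightarrow>\<^sub>0 int) set"
  where "pure_tensor A N U n x =
    tensor_null A N U #>\<^bsub>free_Abelian_group (carrier N \<times> carrier U)\<^esub> frag_of (n, x)"

text \<open>The additive map out of a tensor product that sends \<open>n \<otimes> x\<close> to \<open>\<beta> n x\<close>, for a balanced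
  map \<open>\<beta>\<close> with values in \<open>G\<close>: its value on a coset is the common value on the representatives.\<close>

definition tensor_lift ::
    "('g, 'z) ring_scheme \<Rightarrow> ('n \<Rightarrow> 'm \<Rightarrow> 'g) \<Rightarrow> (('n \<times> 'm) \<Rightarrow>\<^sub>0 int) set \<Rightarrow> 'g"
  where "tensor_lift G \<beta> t = the_elem
    ((\<lambda>c. \<Oplus>\<^bsub>G\<^esub> p \<in> Poly_Mapping.keys c.
        [Poly_Mapping.lookup c p] \<cdot>\<^bsub>G\<^esub> \<beta> (fst p) (snd p)) ` t)"

definition tensor_map ::
    "('a, 'w) ring_scheme \<Rightarrow> ('a, 'n, 'y) module_scheme \<Rightarrow> ('a, 'q, 'z) module_scheme \<Rightarrow>
     ('p \<Rightarrow> 'q) \<Rightarrow> (('n \<times> 'p) \<Rightarrow>\<^sub>0 int) set \<Rightarrow> (('n \<times> 'q) \<Rightarrow>\<^sub>0 int) set"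
  where "tensor_map A N V f = tensor_lift (tensor A N V) (\<lambda>n x. pure_tensor A N V n (f x))"


section \<open>Relative torsion groups\<close>

definition homology ::
    "(nat \<Rightarrow> ('c, 'z) ring_scheme) \<Rightarrow> (nat \<Rightarrow> 'c \<Rightarrow> 'c) \<Rightarrow> nat \<Rightarrow> 'c set monoid"
  where "homology C d k = (case k of
      0 \<Rightarrow> add_monoid (C 0) Mod (d 0 ` carrier (C 1))
    | Suc j \<Rightarrow> (add_monoid (C k))\<lparr>carrier := mod_ker (C k) (C j) (d j)\<rparr>
                 Mod (d k ` carrier (C (Suc k))))"

text \<open>The relative torsion groups of the right module \<open>N\<close> and a left module \<open>M\<close>, computed from a
  relatively projective resolution \<open>P\<close> of \<open>M\<close> with differentials \<open>d\<close>. Up to isomorphism they do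
  not depend on the resolution, so it stays a parameter instead of being chosen.\<close>

definition rel_Tor ::
    "('a, 'w) ring_scheme \<Rightarrow> ('a, 'n, 'y) module_scheme \<Rightarrow> (nat \<Rightarrow> ('a, 'p, 'z) module_scheme) \<Rightarrow>
     (nat \<Rightarrow> 'p \<Rightarrow> 'p) \<Rightarrow> nat \<Rightarrow> (('n \<times> 'p) \<Rightarrow>\<^sub>0 int) set set monoid"
  where "rel_Tor A N P d =
    homology (\<lambda>k. tensor A N (P k)) (\<lambda>k. tensor_map A N (P k) (d k))"


section \<open>The functor given by tensoring with a quotient ring\<close>

definition quot_left :: "('a, 'x) ring_scheme \<Rightarrow> 'a set \<Rightarrow> ('a, 'a set) module" where
  "quot_left A I = inflate A I (left_regular (A Quot I))"

definition quot_right :: "('a, 'x) ring_scheme \<Rightarrow> 'a set \<Rightarrow> ('a, 'a set) module" where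
  "quot_right A I = inflate A I (right_regular (A Quot I))"

definition quot_tensor ::
    "('a, 'x) ring_scheme \<Rightarrow> 'a set \<Rightarrow> ('a, 'm, 'z) module_scheme \<Rightarrow>
     ('a set, (('a set \<times> 'm) \<Rightarrow>\<^sub>0 int) set) module"
  where "quot_tensor A I U =
    (let T = tensor A (quot_right A I) U
     in \<lparr>carrier = carrier T, monoid.mult = monoid.mult T, one = one T, ring.zero = ring.zero T, add = add T,
         smult = (\<lambda>b. tensor_lift T (\<lambda>n x. pure_tensor A (quot_right A I) U (b \<otimes>\<^bsub>A Quot I\<^esub> n) x))\<rparr>)"

definition quot_tensor_map ::
    "('a, 'x) ring_scheme \<Rightarrow> 'a set \<Rightarrow> ('a, 'q, 'z) module_scheme \<Rightarrow> ('p \<Rightarrow> 'q) \<Rightarrow>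
     (('a set \<times> 'p) \<Rightarrow>\<^sub>0 int) set \<Rightarrow> (('a set \<times> 'q) \<Rightarrow>\<^sub>0 int) set"
  where "quot_tensor_map A I V f = tensor_map A (quot_right A I) V f"

text \<open>The identification \<open>A/I \<otimes>\<^sub>A M \<cong> M\<close>, \<open>b \<otimes> x \<mapsto> b \<cdot> x\<close>, for an \<open>A/I\<close>-module \<open>M\<close>.\<close>

definition quot_tensor_ident ::
    "('a set, 'm, 'z) module_scheme \<Rightarrow> (('a set \<times> 'm) \<Rightarrow>\<^sub>0 int) set \<Rightarrow> 'm"
  where "quot_tensor_ident M = tensor_lift M (\<lambda>b x. b \<odot>\<^bsub>M\<^esub> x)"

end

theory Submission
  imports Defs
begin

text \<open>
  The map \<open>u \<mapsto> 1 \<otimes> u\<close> identifies \<open>A/I \<otimes>\<^sub>A U\<close> with \<open>U / I U\<close> (\<open>quot_proj_eq_zero_iff\<close>), so the theorem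
  is about the complex \<open>P / I P\<close>. Its terms are projective over \<open>A/I\<close>, since an \<open>A/I\<close>-linear lifting
  problem for \<open>P / I P\<close> is an \<open>A\<close>-linear one for \<open>P\<close> (\<open>projective_quot_tensor\<close>). Minimality is inherited,
  since a submodule of \<open>P / I P\<close> has a preimage in \<open>P\<close> that contains \<open>I P\<close>
  (\<open>superfluous_quot_tensor\<close>). What remains is exactness in positive degrees, that is,
  \<open>Tor\<^sub>k(A/I, M) = 0\<close> for \<open>k \<ge> 1\<close>. Equivalently, the complex \<open>I P\<close> is exact (\<open>ideal_acyclic\<close>,
  \<open>quotient_cycles\<close>).

  The hypothesis on relative torsion gives exactness of \<open>I Q\<close> for the resolution \<open>Q\<close> of \<open>A/I\<close>
  (\<open>rel_Tor_ideal_acyclic\<close>). Since \<open>A\<close> and \<open>M\<close> are projective over \<open>R\<close>, so are the terms of \<open>P\<close>, and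
  \<open>P\<close> splits over \<open>R\<close> (\<open>projective_resolution_split\<close>). Thus \<open>P\<close> is a relatively projective resolution,
  and maps from \<open>A/I\<close> to \<open>M\<close> lift to chain maps from \<open>Q\<close> to \<open>P\<close> (\<open>comparison_chain_map\<close>).

  The passage from \<open>A/I\<close> to an arbitrary \<open>A/I\<close>-module \<open>N\<close> that is projective over \<open>R\<close>
  (\<open>ideal_acyclic_all\<close>) is an induction on the degree for all such \<open>N\<close> and all relatively projective
  resolutions \<open>C\<close> of \<open>N\<close> at once. In degree \<open>0\<close>, an element \<open>i c\<close> of \<open>I C\<^sub>0\<close> is, up to \<open>i\<close> times a
  boundary, the image of \<open>i u\<close> under a chain map from \<open>Q\<close>, where \<open>u \<in> Q\<^sub>0\<close> lies over the unit of
  \<open>A/I\<close>; and \<open>i u\<close> is a boundary from \<open>I Q\<^sub>1\<close> (\<open>ideal_acyclic_zero\<close>). For the step, a direct sum \<open>L\<close> of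
  copies of \<open>A/I\<close> maps onto \<open>N\<close>, with a kernel \<open>K\<close> that is again an \<open>A/I\<close>-module and projective over
  \<open>R\<close>. The direct sum \<open>D\<close> of copies of \<open>Q\<close> resolves \<open>L\<close>, and the mapping cone of a chain map
  \<open>D \<rightarrow> C\<close> over \<open>L \<rightarrow> N\<close> becomes, after its bottom term has been split off, a relatively
  projective resolution of \<open>K\<close> (\<open>cone_split_resolution\<close>). Acyclicity of the cone in degree \<open>n\<close> and
  of \<open>D\<close> in degree \<open>n + 1\<close> give acyclicity of \<open>C\<close> in degree \<open>n + 1\<close> (\<open>cone_ideal_acyclic\<close>). The
  elements of the cone and of \<open>K\<close> have more complicated types than those of \<open>C\<close> and \<open>N\<close>; to keep the
  induction in fixed types, both are encoded in recursive datatypes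
  (\<open>split_resolution_transport\<close>, \<open>ideal_acyclic_coded\<close>).
\<close>


section \<open>Linear maps\<close>

lemma left_moduleD:
  assumes "left_module A U"
  shows "ring A" "abelian_group U" "abelian_monoid U"
  using assms by (simp_all add: left_module_def abelian_group.axioms)

lemma (in left_module) smult_r_minus:
  assumes "a \<in> carrier A" "x \<in> carrier M"
  shows "a \<odot>\<^bsub>M\<^esub> (\<ominus>\<^bsub>M\<^esub> x) = \<ominus>\<^bsub>M\<^esub> (a \<odot>\<^bsub>M\<^esub> x)"
proof -
  have "a \<odot>\<^bsub>M\<^esub> (\<ominus>\<^bsub>M\<^esub> x) \<oplus>\<^bsub>M\<^esub> a \<odot>\<^bsub>M\<^esub> x = \<zero>\<^bsub>M\<^esub>"
    using smult_r_distr[of a "\<ominus>\<^bsub>M\<^esub> x" x] assms by (simp add: M.l_neg smult_zero)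
  then show ?thesis using assms by (intro M.minus_equality[symmetric]) auto
qed

lemma (in left_module) smult_l_zero:
  assumes "x \<in> carrier M" shows "\<zero> \<odot>\<^bsub>M\<^esub> x = \<zero>\<^bsub>M\<^esub>"
proof -
  have "\<zero> \<odot>\<^bsub>M\<^esub> x \<oplus>\<^bsub>M\<^esub> \<zero> \<odot>\<^bsub>M\<^esub> x = \<zero> \<odot>\<^bsub>M\<^esub> x"
    using smult_l_distr[of \<zero> \<zero> x] assms by simp
  then show ?thesis using assms M.add.l_cancel_one by blast
qed

lemma (in left_module) smult_minus_one:
  assumes "x \<in> carrier M" shows "(\<ominus> \<one>) \<odot>\<^bsub>M\<^esub> x = \<ominus>\<^bsub>M\<^esub> x"
  using smult_neg[OF assms] assms by (intro M.minus_equality[symmetric]) auto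

lemma lin_hom_zero:
  assumes "left_module A U" "left_module A V" "f \<in> lin_hom A U V"
  shows "f \<zero>\<^bsub>U\<^esub> = \<zero>\<^bsub>V\<^esub>"
proof -
  interpret U: left_module A U by fact
  interpret V: left_module A V by fact
  have "f \<zero>\<^bsub>U\<^esub> \<oplus>\<^bsub>V\<^esub> f \<zero>\<^bsub>U\<^esub> = f \<zero>\<^bsub>U\<^esub>"
    using lin_homD(2)[OF assms(3), of "\<zero>\<^bsub>U\<^esub>" "\<zero>\<^bsub>U\<^esub>"] by simp
  then show ?thesis using lin_homD(1)[OF assms(3), of "\<zero>\<^bsub>U\<^esub>"] V.M.add.l_cancel_one by blast
qed

lemma lin_hom_uminus:
  assumes "left_module A U" "left_module A V" "f \<in> lin_hom A U V" "x \<in> carrier U"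
  shows "f (\<ominus>\<^bsub>U\<^esub> x) = \<ominus>\<^bsub>V\<^esub> f x"
proof -
  interpret U: left_module A U by fact
  interpret V: left_module A V by fact
  have "f (\<ominus>\<^bsub>U\<^esub> x) \<oplus>\<^bsub>V\<^esub> f x = \<zero>\<^bsub>V\<^esub>"
    using lin_homD(2)[OF assms(3), of "\<ominus>\<^bsub>U\<^esub> x" x] assms(4) lin_hom_zero[OF assms(1-3)]
    by (simp add: U.M.l_neg)
  then show ?thesis
    using assms(4) lin_homD(1)[OF assms(3)] by (intro V.M.minus_equality[symmetric]) auto
qed

lemma lin_hom_diff:
  assumes "left_module A U" "left_module A V" "f \<in> lin_hom A U V" "x \<in> carrier U" "y \<in> carrier U"
  shows "f (x \<ominus>\<^bsub>U\<^esub> y) = f x \<ominus>\<^bsub>V\<^esub> f y"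
proof -
  interpret U: left_module A U by fact
  interpret V: left_module A V by fact
  show ?thesis
    using assms lin_homD(2)[OF assms(3), of x "\<ominus>\<^bsub>U\<^esub> y"]
    by (simp add: a_minus_def lin_hom_uminus[OF assms(1-3)])
qed

lemma lin_hom_comp':
  "\<lbrakk>f \<in> lin_hom A U V; g \<in> lin_hom A V W\<rbrakk> \<Longrightarrow> (\<lambda>x. g (f x)) \<in> lin_hom A U W"
  using lin_hom_comp[of f A U V g W] by (simp add: comp_def)

lemma lin_hom_id: "(\<lambda>x. x) \<in> lin_hom A U U"
  by (rule lin_homI) auto

lemma lin_hom_const_zero:
  assumes "left_module A V" shows "(\<lambda>x. \<zero>\<^bsub>V\<^esub>) \<in> lin_hom A U V"
proof -
  interpret V: left_module A V by fact
  show ?thesis by (rule lin_homI) (auto simp: V.smult_zero)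
qed

lemma lin_hom_add:
  assumes "left_module A V" "f \<in> lin_hom A U V" "g \<in> lin_hom A U V"
  shows "(\<lambda>x. f x \<oplus>\<^bsub>V\<^esub> g x) \<in> lin_hom A U V"
proof -
  interpret V: left_module A V by fact
  note D = lin_homD[OF assms(2)] lin_homD[OF assms(3)]
  show ?thesis by (rule lin_homI) (auto simp: D V.M.a_ac V.smult_r_distr)
qed

lemma lin_hom_neg:
  assumes "left_module A V" "f \<in> lin_hom A U V"
  shows "(\<lambda>x. \<ominus>\<^bsub>V\<^esub> f x) \<in> lin_hom A U V"
proof -
  interpret V: left_module A V by fact
  note D = lin_homD[OF assms(2)]
  show ?thesis by (rule lin_homI) (auto simp: D V.M.minus_add V.smult_r_minus V.M.a_comm)
qed

lemma lin_hom_sub: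
  assumes "left_module A V" "f \<in> lin_hom A U V" "g \<in> lin_hom A U V"
  shows "(\<lambda>x. f x \<ominus>\<^bsub>V\<^esub> g x) \<in> lin_hom A U V"
  using lin_hom_add[OF assms(1,2) lin_hom_neg[OF assms(1,3)]] by (simp add: a_minus_def)

lemma left_module_restrict_carrier:
  assumes "left_module A U" "H \<subseteq> carrier U" "\<zero>\<^bsub>U\<^esub> \<in> H"
    and "\<And>x y. \<lbrakk>x \<in> H; y \<in> H\<rbrakk> \<Longrightarrow> x \<oplus>\<^bsub>U\<^esub> y \<in> H"
    and "\<And>a x. \<lbrakk>a \<in> carrier A; x \<in> H\<rbrakk> \<Longrightarrow> a \<odot>\<^bsub>U\<^esub> x \<in> H"
  shows "left_module A (U\<lparr>carrier := H\<rparr>)"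
proof -
  interpret U: left_module A U by fact
  have H: "x \<in> carrier U" if "x \<in> H" for x using that assms(2) by auto
  show ?thesis
  proof (rule left_moduleI)
    fix x assume x: "x \<in> carrier (U\<lparr>carrier := H\<rparr>)"
    show "\<exists>y\<in>carrier (U\<lparr>carrier := H\<rparr>). y \<oplus>\<^bsub>U\<lparr>carrier := H\<rparr>\<^esub> x = \<zero>\<^bsub>U\<lparr>carrier := H\<rparr>\<^esub>"
      by (rule bexI[of _ "(\<ominus>\<^bsub>A\<^esub> \<one>\<^bsub>A\<^esub>) \<odot>\<^bsub>U\<^esub> x"]) (use x H assms(5) U.smult_neg in auto)
  qed (use assms(3-5) H U.A.ring_axioms in
      \<open>auto simp: U.M.a_assoc U.smult_l_distr U.smult_r_distr U.smult_assoc1 intro: U.M.a_comm\<close>)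
qed

abbreviation ker_module ::
    "('a, 'm, 'y) module_scheme \<Rightarrow> ('n, 'z) ring_scheme \<Rightarrow> ('m \<Rightarrow> 'n) \<Rightarrow> ('a, 'm, 'y) module_scheme"
  where "ker_module U V f \<equiv> U\<lparr>carrier := mod_ker U V f\<rparr>"

lemma ker_module:
  assumes "left_module A U" "left_module A V" "f \<in> lin_hom A U V"
  shows "left_module A (ker_module U V f)"
proof -
  interpret U: left_module A U by fact
  interpret V: left_module A V by fact
  show ?thesis
    by (rule left_module_restrict_carrier[OF assms(1)])
      (auto simp: mod_ker_def lin_homD[OF assms(3)] lin_hom_zero[OF assms] V.smult_zero)
qed

subsection \<open>Restriction of scalars along \<open>R \<rightarrow> A\<close>\<close>

lemma (in assoc_algebra) scalar_one_mult:
  assumes "r \<in> carrier R" "x \<in> carrier A"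
  shows "(r \<odot>\<^bsub>A\<^esub> \<one>\<^bsub>A\<^esub>) \<otimes>\<^bsub>A\<^esub> x = x \<otimes>\<^bsub>A\<^esub> (r \<odot>\<^bsub>A\<^esub> \<one>\<^bsub>A\<^esub>)"
    and "(r \<odot>\<^bsub>A\<^esub> \<one>\<^bsub>A\<^esub>) \<otimes>\<^bsub>A\<^esub> x = r \<odot>\<^bsub>A\<^esub> x"
proof -
  show 1: "(r \<odot>\<^bsub>A\<^esub> \<one>\<^bsub>A\<^esub>) \<otimes>\<^bsub>A\<^esub> x = r \<odot>\<^bsub>A\<^esub> x"
    using smult_mult_left[of r "\<one>\<^bsub>A\<^esub>" x] assms by simp
  show "(r \<odot>\<^bsub>A\<^esub> \<one>\<^bsub>A\<^esub>) \<otimes>\<^bsub>A\<^esub> x = x \<otimes>\<^bsub>A\<^esub> (r \<odot>\<^bsub>A\<^esub> \<one>\<^bsub>A\<^esub>)"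
    using smult_mult_right[of r x "\<one>\<^bsub>A\<^esub>"] assms 1 by simp
qed

lemma scalars_left_module:
  assumes "assoc_algebra R A" "left_module A U"
  shows "left_module R (scalars A U)"
proof -
  interpret R: assoc_algebra R A by fact
  interpret U: left_module A U by fact
  have mult: "((r \<otimes>\<^bsub>R\<^esub> s) \<odot>\<^bsub>A\<^esub> \<one>\<^bsub>A\<^esub>) = (r \<odot>\<^bsub>A\<^esub> \<one>\<^bsub>A\<^esub>) \<otimes>\<^bsub>A\<^esub> (s \<odot>\<^bsub>A\<^esub> \<one>\<^bsub>A\<^esub>)"
    if "r \<in> carrier R" "s \<in> carrier R" for r s
    using that by (simp add: R.scalar_one_mult(2) R.smult_assoc1)
  show ?thesis
  proof (rule left_moduleI)
    fix x assume "x \<in> carrier (scalars A U)"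
    then show "\<exists>y\<in>carrier (scalars A U). y \<oplus>\<^bsub>scalars A U\<^esub> x = \<zero>\<^bsub>scalars A U\<^esub>"
      by (intro bexI[of _ "\<ominus>\<^bsub>U\<^esub> x"]) (auto simp: U.M.l_neg)
  qed (auto simp: U.M.a_ac R.smult_l_distr U.smult_l_distr U.smult_r_distr U.smult_assoc1 mult
      intro: R.R.ring_axioms)
qed

lemma scalars_a_inv [simp]: "\<ominus>\<^bsub>scalars A U\<^esub> x = \<ominus>\<^bsub>U\<^esub> x"
  by (simp add: a_inv_def m_inv_def)

lemma scalars_a_minus [simp]: "x \<ominus>\<^bsub>scalars A U\<^esub> y = x \<ominus>\<^bsub>U\<^esub> y"
  by (simp add: a_minus_def)

lemma lin_hom_scalars:
  assumes "assoc_algebra R A" "f \<in> lin_hom A U V"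
  shows "f \<in> lin_hom R (scalars A U) (scalars A V)"
proof -
  interpret R: assoc_algebra R A by fact
  show ?thesis using assms(2) by (auto simp: lin_hom_def)
qed

section \<open>Copowers and products of modules\<close>

text \<open>The copower is the direct sum of copies of \<open>Q\<close>, one for each element of the type
  \<^typ>\<open>'x\<close>; indexing by a whole type avoids a side condition on the index in every map out of it.\<close>

definition copower :: "('a, 'q, 'z) module_scheme \<Rightarrow> ('a, 'x \<Rightarrow> 'q) module" where
  "copower Q = \<lparr>carrier = {g. (\<forall>x. g x \<in> carrier Q) \<and> finite {x. g x \<noteq> \<zero>\<^bsub>Q\<^esub>}},
     monoid.mult = undefined, one = undefined, ring.zero = (\<lambda>x. \<zero>\<^bsub>Q\<^esub>),
     add = (\<lambda>g h x. g x \<oplus>\<^bsub>Q\<^esub> h x), smult = (\<lambda>a g x. a \<odot>\<^bsub>Q\<^esub> g x)\<rparr>"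

definition copower_single :: "('a, 'q, 'z) module_scheme \<Rightarrow> 'x \<Rightarrow> 'q \<Rightarrow> 'x \<Rightarrow> 'q" where
  "copower_single Q x q = (\<lambda>y. if y = x then q else \<zero>\<^bsub>Q\<^esub>)"

text \<open>The sum runs over the nonzero values instead of the support of \<open>g\<close>, so that the module \<open>Q\<close>,
  which is not determined by \<open>\<phi>\<close> and \<open>g\<close>, need not be a parameter.\<close>

definition copower_lift :: "('v, 'z) ring_scheme \<Rightarrow> ('x \<Rightarrow> 'q \<Rightarrow> 'v) \<Rightarrow> ('x \<Rightarrow> 'q) \<Rightarrow> 'v" where
  "copower_lift V \<phi> g = (\<Oplus>\<^bsub>V\<^esub> x \<in> {x. \<phi> x (g x) \<noteq> \<zero>\<^bsub>V\<^esub>}. \<phi> x (g x))"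

definition module_prod ::
    "('a, 'u, 'y) module_scheme \<Rightarrow> ('a, 'v, 'z) module_scheme \<Rightarrow> ('a, 'u \<times> 'v) module" where
  "module_prod U V = \<lparr>carrier = carrier U \<times> carrier V, monoid.mult = undefined, one = undefined,
     ring.zero = (\<zero>\<^bsub>U\<^esub>, \<zero>\<^bsub>V\<^esub>), add = (\<lambda>x y. (fst x \<oplus>\<^bsub>U\<^esub> fst y, snd x \<oplus>\<^bsub>V\<^esub> snd y)),
     smult = (\<lambda>a x. (a \<odot>\<^bsub>U\<^esub> fst x, a \<odot>\<^bsub>V\<^esub> snd x))\<rparr>"

lemma copower_simps [simp]:
  "g \<in> carrier (copower Q) \<longleftrightarrow> (\<forall>x. g x \<in> carrier Q) \<and> finite {x. g x \<noteq> \<zero>\<^bsub>Q\<^esub>}"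
  "\<zero>\<^bsub>copower Q\<^esub> = (\<lambda>x. \<zero>\<^bsub>Q\<^esub>)" "g \<oplus>\<^bsub>copower Q\<^esub> h = (\<lambda>x. g x \<oplus>\<^bsub>Q\<^esub> h x)"
  "a \<odot>\<^bsub>copower Q\<^esub> g = (\<lambda>x. a \<odot>\<^bsub>Q\<^esub> g x)"
  by (auto simp: copower_def)

lemma module_prod_simps [simp]:
  "carrier (module_prod U V) = carrier U \<times> carrier V" "\<zero>\<^bsub>module_prod U V\<^esub> = (\<zero>\<^bsub>U\<^esub>, \<zero>\<^bsub>V\<^esub>)"
  "x \<oplus>\<^bsub>module_prod U V\<^esub> y = (fst x \<oplus>\<^bsub>U\<^esub> fst y, snd x \<oplus>\<^bsub>V\<^esub> snd y)"
  "a \<odot>\<^bsub>module_prod U V\<^esub> x = (a \<odot>\<^bsub>U\<^esub> fst x, a \<odot>\<^bsub>V\<^esub> snd x)"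
  by (auto simp: module_prod_def)

lemma scalars_copower: "scalars A (copower Q) = copower (scalars A Q)"
  by (simp add: copower_def scalars_def restrict_scalars_def)

lemma scalars_module_prod: "scalars A (module_prod U V) = module_prod (scalars A U) (scalars A V)"
  by (simp add: module_prod_def scalars_def restrict_scalars_def)

lemma module_prod_left_module:
  assumes "left_module A U" "left_module A V"
  shows "left_module A (module_prod U V)"
proof -
  interpret U: left_module A U by fact
  interpret V: left_module A V by fact
  show ?thesis
  proof (rule left_moduleI)
    fix x assume x: "x \<in> carrier (module_prod U V)"
    show "\<exists>y\<in>carrier (module_prod U V). y \<oplus>\<^bsub>module_prod U V\<^esub> x = \<zero>\<^bsub>module_prod U V\<^esub>"
      by (rule bexI[of _ "(\<ominus>\<^bsub>U\<^esub> fst x, \<ominus>\<^bsub>V\<^esub> snd x)"]) (use x in \<open>auto simp: U.M.l_neg V.M.l_neg\<close>)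
  qed (auto simp: U.M.a_assoc V.M.a_assoc U.smult_l_distr U.smult_r_distr U.smult_assoc1
      V.smult_l_distr V.smult_r_distr V.smult_assoc1
      intro: U.A.ring_axioms U.M.a_comm V.M.a_comm)
qed

lemma lin_hom_Pair:
  "\<lbrakk>f \<in> lin_hom A W U; g \<in> lin_hom A W V\<rbrakk> \<Longrightarrow> (\<lambda>x. (f x, g x)) \<in> lin_hom A W (module_prod U V)"
  by (auto simp: lin_hom_def)

lemma lin_hom_fst: "fst \<in> lin_hom A (module_prod U V) U"
  and lin_hom_snd: "snd \<in> lin_hom A (module_prod U V) V"
  by (auto simp: lin_hom_def)

lemma copower_left_module:
  fixes Q :: "('a, 'q, 'z) module_scheme"
  assumes "left_module A Q" shows "left_module A (copower Q :: ('a, 'x \<Rightarrow> 'q) module)"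
proof -
  interpret Q: left_module A Q by fact
  have add: "finite {x. g x \<oplus>\<^bsub>Q\<^esub> h x \<noteq> \<zero>\<^bsub>Q\<^esub>}"
    if "finite {x. g x \<noteq> \<zero>\<^bsub>Q\<^esub>}" "finite {x. h x \<noteq> \<zero>\<^bsub>Q\<^esub>}" for g h :: "'x \<Rightarrow> 'q"
    by (rule finite_subset[OF _ finite_UnI[OF that]]) auto
  have sm: "finite {x. a \<odot>\<^bsub>Q\<^esub> g x \<noteq> \<zero>\<^bsub>Q\<^esub>}"
    if "finite {x. g x \<noteq> \<zero>\<^bsub>Q\<^esub>}" "a \<in> carrier A" for g :: "'x \<Rightarrow> 'q" and a
    by (rule finite_subset[OF _ that(1)]) (use that(2) Q.smult_zero in auto)
  show ?thesis
  proof (rule left_moduleI)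
    fix g :: "'x \<Rightarrow> 'q" assume g: "g \<in> carrier (copower Q)"
    show "\<exists>h\<in>carrier (copower Q). h \<oplus>\<^bsub>copower Q\<^esub> g = \<zero>\<^bsub>copower Q\<^esub>"
      by (rule bexI[of _ "\<lambda>x. (\<ominus>\<^bsub>A\<^esub> \<one>\<^bsub>A\<^esub>) \<odot>\<^bsub>Q\<^esub> g x"])
        (use g sm in \<open>auto simp: Q.smult_neg\<close>)
  qed (auto simp: add sm Q.M.a_assoc Q.smult_l_distr Q.smult_r_distr Q.smult_assoc1
      intro: Q.A.ring_axioms Q.M.a_comm)
qed

lemma copower_single_closed:
  assumes "left_module A Q" "q \<in> carrier Q"
  shows "copower_single Q x q \<in> carrier (copower Q)"
proof -
  interpret Q: left_module A Q by fact
  show ?thesis using assms(2) by (auto simp: copower_single_def)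
qed

lemma copower_single_lin_hom:
  assumes "left_module A Q" shows "copower_single Q x \<in> lin_hom A Q (copower Q)"
proof -
  interpret Q: left_module A Q by fact
  show ?thesis
    by (rule lin_homI) (use copower_single_closed[OF assms] in
        \<open>auto simp: copower_single_def fun_eq_iff Q.smult_zero\<close>)
qed

text \<open>Every element is the finite sum of its components.\<close>

lemma copower_induct [consumes 2, case_names zero single add]:
  assumes Q: "left_module A Q" and g: "g \<in> carrier (copower Q)"
    and zero: "P \<zero>\<^bsub>copower Q\<^esub>"
    and single: "\<And>x. P (copower_single Q x (g x))"
    and add: "\<And>h k. \<lbrakk>h \<in> carrier (copower Q); k \<in> carrier (copower Q); P h; P k\<rbrakk>
      \<Longrightarrow> P (h \<oplus>\<^bsub>copower Q\<^esub> k)"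
  shows "P g"
proof -
  interpret Q: left_module A Q by fact
  define cut where "cut S = (\<lambda>x. if x \<in> S then g x else \<zero>\<^bsub>Q\<^esub>)" for S
  have cutc: "cut S \<in> carrier (copower Q)" for S
    using g by (auto simp: cut_def elim!: rev_finite_subset)
  have "P (cut S)" if "finite S" for S
    using that
  proof (induction S)
    case empty then show ?case using zero by (simp add: cut_def)
  next
    case (insert x S)
    have "cut (insert x S) = copower_single Q x (g x) \<oplus>\<^bsub>copower Q\<^esub> cut S"
      using g insert.hyps by (auto simp: cut_def copower_single_def fun_eq_iff)
    then show ?case
      using add[OF copower_single_closed[OF Q] cutc single insert.IH] g by simp
  qed
  moreover have "cut {x. g x \<noteq> \<zero>\<^bsub>Q\<^esub>} = g" by (auto simp: cut_def)
  ultimately show ?thesis using g by fastforce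
qed

lemma copower_hom_ext:
  assumes Q: "left_module A Q" and V: "left_module A V"
    and F: "F \<in> lin_hom A (copower Q) V" and G: "G \<in> lin_hom A (copower Q) V"
    and eq: "\<And>x q. q \<in> carrier Q \<Longrightarrow> F (copower_single Q x q) = G (copower_single Q x q)"
    and g: "g \<in> carrier (copower Q)"
  shows "F g = G g"
  using Q g
proof (induction rule: copower_induct)
  case zero then show ?case
    using lin_hom_zero[OF copower_left_module[OF Q] V F] lin_hom_zero[OF copower_left_module[OF Q] V G]
    by simp
next
  case (single x) then show ?case using eq g by simp
next
  case (add h k) then show ?case using lin_homD(2)[OF F] lin_homD(2)[OF G] by metis
qed

lemma copower_lift_eq:
  assumes "abelian_monoid V" "finite S" "{x. \<phi> x (g x) \<noteq> \<zero>\<^bsub>V\<^esub>} \<subseteq> S" "\<And>x. \<phi> x (g x) \<in> carrier V"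
  shows "copower_lift V \<phi> g = (\<Oplus>\<^bsub>V\<^esub> x \<in> S. \<phi> x (g x))"
proof -
  interpret V: abelian_monoid V by fact
  show ?thesis unfolding copower_lift_def
    by (rule V.add.finprod_mono_neutral_cong_left) (use assms in auto)
qed

lemma copower_lift_lin_hom:
  fixes Q :: "('a, 'q, 'z) module_scheme" and \<phi> :: "'x \<Rightarrow> 'q \<Rightarrow> 'v"
  assumes Q: "left_module A Q" and V: "left_module A V" and \<phi>: "\<And>x. \<phi> x \<in> lin_hom A Q V"
  shows "copower_lift V \<phi> \<in> lin_hom A (copower Q) V"
proof -
  interpret Q: left_module A Q by fact
  interpret V: left_module A V by fact
  note D = lin_homD[OF \<phi>] lin_hom_zero[OF Q V \<phi>]
  have eq: "copower_lift V \<phi> g = (\<Oplus>\<^bsub>V\<^esub> x \<in> S. \<phi> x (g x))"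
    if "finite S" "{x. g x \<noteq> \<zero>\<^bsub>Q\<^esub>} \<subseteq> S" "g \<in> carrier (copower Q)" for g S
    by (rule copower_lift_eq) (use that D in \<open>auto intro: V.M.abelian_monoid_axioms\<close>)
  show ?thesis
  proof (rule lin_homI)
    fix g :: "'x \<Rightarrow> 'q" assume g: "g \<in> carrier (copower Q)"
    then show "copower_lift V \<phi> g \<in> carrier V"
      using eq[OF _ order.refl g] D by (auto intro!: V.M.finsum_closed)
    fix a assume a: "a \<in> carrier A"
    define S where "S = {x. g x \<noteq> \<zero>\<^bsub>Q\<^esub>}"
    have "copower_lift V \<phi> (a \<odot>\<^bsub>copower Q\<^esub> g) = (\<Oplus>\<^bsub>V\<^esub> x \<in> S. a \<odot>\<^bsub>V\<^esub> \<phi> x (g x))"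
    proof -
      have "copower_lift V \<phi> (a \<odot>\<^bsub>copower Q\<^esub> g) = (\<Oplus>\<^bsub>V\<^esub> x \<in> S. \<phi> x ((a \<odot>\<^bsub>copower Q\<^esub> g) x))"
        using g a Q.smult_zero lin_homD(1)[OF copower_single_lin_hom[OF Q]]
          left_module.smult_closed[OF copower_left_module[OF Q] a g]
        by (intro eq) (auto simp: S_def)
      then show ?thesis using g a D by simp
    qed
    also have "\<dots> = a \<odot>\<^bsub>V\<^esub> (\<Oplus>\<^bsub>V\<^esub> x \<in> S. \<phi> x (g x))"
    proof -
      have "finite S" using g by (simp add: S_def)
      then show ?thesis
        by (induction S) (use a g D V.smult_zero in \<open>auto simp: V.smult_r_distr Pi_iff\<close>)
    qed
    finally show "copower_lift V \<phi> (a \<odot>\<^bsub>copower Q\<^esub> g) = a \<odot>\<^bsub>V\<^esub> copower_lift V \<phi> g"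
      using eq[OF _ order.refl g] g by (simp add: S_def)
  next
    fix g h :: "'x \<Rightarrow> 'q" assume g: "g \<in> carrier (copower Q)" and h: "h \<in> carrier (copower Q)"
    define S where "S = {x. g x \<noteq> \<zero>\<^bsub>Q\<^esub>} \<union> {x. h x \<noteq> \<zero>\<^bsub>Q\<^esub>}"
    have S: "finite S" using g h by (simp add: S_def)
    have gh: "g \<oplus>\<^bsub>copower Q\<^esub> h \<in> carrier (copower Q)"
      using abelian_monoid.a_closed[OF left_moduleD(3)[OF copower_left_module[OF Q]]] g h by blast
    have "copower_lift V \<phi> (g \<oplus>\<^bsub>copower Q\<^esub> h) = (\<Oplus>\<^bsub>V\<^esub> x \<in> S. \<phi> x ((g \<oplus>\<^bsub>copower Q\<^esub> h) x))"
      by (rule eq[OF S _ gh]) (auto simp: S_def)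
    also have "\<dots> = (\<Oplus>\<^bsub>V\<^esub> x \<in> S. \<phi> x (g x)) \<oplus>\<^bsub>V\<^esub> (\<Oplus>\<^bsub>V\<^esub> x \<in> S. \<phi> x (h x))"
      using g h D by (simp add: V.M.finsum_addf Pi_iff)
    also have "\<dots> = copower_lift V \<phi> g \<oplus>\<^bsub>V\<^esub> copower_lift V \<phi> h"
      using eq[OF S _ g] eq[OF S _ h] by (auto simp: S_def)
    finally show "copower_lift V \<phi> (g \<oplus>\<^bsub>copower Q\<^esub> h) = copower_lift V \<phi> g \<oplus>\<^bsub>V\<^esub> copower_lift V \<phi> h" .
  qed
qed

lemma copower_lift_single:
  assumes Q: "left_module A Q" and V: "left_module A V" and \<phi>: "\<And>x. \<phi> x \<in> lin_hom A Q V"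
    and q: "q \<in> carrier Q"
  shows "copower_lift V \<phi> (copower_single Q x q) = \<phi> x q"
proof -
  interpret Q: left_module A Q by fact
  interpret V: left_module A V by fact
  note D = lin_homD[OF \<phi>] lin_hom_zero[OF Q V \<phi>]
  have "copower_lift V \<phi> (copower_single Q x q) = (\<Oplus>\<^bsub>V\<^esub> y \<in> {x}. \<phi> y (copower_single Q x q y))"
    by (rule copower_lift_eq) (use q D in \<open>auto simp: copower_single_def intro: V.M.abelian_monoid_axioms\<close>)
  then show ?thesis using q D by (simp add: copower_single_def)
qed

lemma copower_eval_lin_hom: "(\<lambda>g. g x) \<in> lin_hom A (copower Q) Q"
  by (auto simp: lin_hom_def)

lemma copower_map_lin_hom:
  fixes U :: "('a, 'u, 'y) module_scheme"
  assumes U: "left_module A U" and V: "left_module A V" and f: "f \<in> lin_hom A U V"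
  shows "(\<lambda>g x. f (g x)) \<in> lin_hom A (copower U :: ('a, 'x \<Rightarrow> 'u) module) (copower V)"
proof (rule lin_homI)
  fix g :: "'x \<Rightarrow> 'u" assume g: "g \<in> carrier (copower U)"
  have "finite {x. f (g x) \<noteq> \<zero>\<^bsub>V\<^esub>}"
    by (rule finite_subset[of _ "{x. g x \<noteq> \<zero>\<^bsub>U\<^esub>}"]) (use g lin_hom_zero[OF U V f] in auto)
  then show "(\<lambda>x. f (g x)) \<in> carrier (copower V)" using g lin_homD(1)[OF f] by auto
qed (auto simp: lin_homD[OF f])

lemma copower_map_single:
  assumes "left_module A U" "left_module A V" "f \<in> lin_hom A U V"
  shows "(\<lambda>y. f (copower_single U x q y)) = copower_single V x (f q)"
  using lin_hom_zero[OF assms] by (auto simp: copower_single_def fun_eq_iff)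

section \<open>Closure properties of (relatively) projective modules\<close>

text \<open>The next three lemmas solve a lifting problem on a copower, a product or a retract from
  solutions on the pieces. They are stated for one problem at a time and therefore serve both for
  projective and for relatively projective modules.\<close>

lemma copower_lifting:
  fixes Q :: "('a, 'q, 'z) module_scheme" and g :: "('x \<Rightarrow> 'q) \<Rightarrow> 'v"
  assumes Q: "left_module A Q" and U: "left_module A U" and V: "left_module A V"
    and f: "f \<in> lin_hom A U V" and g: "g \<in> lin_hom A (copower Q) V"
    and lift: "\<And>k. k \<in> lin_hom A Q V \<Longrightarrow> \<exists>h \<in> lin_hom A Q U. \<forall>q\<in>carrier Q. f (h q) = k q"
  shows "\<exists>h \<in> lin_hom A (copower Q) U. \<forall>p\<in>carrier (copower Q). f (h p) = g p"
proof -
  have "\<forall>x :: 'x. \<exists>h. h \<in> lin_hom A Q U \<and> (\<forall>q\<in>carrier Q. f (h q) = g (copower_single Q x q))"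
    using lift[OF lin_hom_comp'[OF copower_single_lin_hom[OF Q] g]] by blast
  then obtain h where h: "\<And>x. h x \<in> lin_hom A Q U"
      "\<And>x q. q \<in> carrier Q \<Longrightarrow> f (h x q) = g (copower_single Q x q)"
    by metis
  have L: "copower_lift U h \<in> lin_hom A (copower Q) U"
    by (rule copower_lift_lin_hom[OF Q U h(1)])
  show ?thesis
  proof (rule bexI[OF _ L], rule ballI)
    fix p :: "'x \<Rightarrow> 'q" assume p: "p \<in> carrier (copower Q)"
    show "f (copower_lift U h p) = g p"
      by (rule copower_hom_ext[OF Q V lin_hom_comp'[OF L f] g _ p])
        (simp add: copower_lift_single[OF Q U h(1)] h(2))
  qed
qed

lemma module_prod_lifting:
  assumes P: "left_module A P" and Q: "left_module A Q" and U: "left_module A U" and V: "left_module A V"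
    and f: "f \<in> lin_hom A U V" and g: "g \<in> lin_hom A (module_prod P Q) V"
    and lift1: "\<And>k. k \<in> lin_hom A P V \<Longrightarrow> \<exists>h \<in> lin_hom A P U. \<forall>p\<in>carrier P. f (h p) = k p"
    and lift2: "\<And>k. k \<in> lin_hom A Q V \<Longrightarrow> \<exists>h \<in> lin_hom A Q U. \<forall>q\<in>carrier Q. f (h q) = k q"
  shows "\<exists>h \<in> lin_hom A (module_prod P Q) U. \<forall>p\<in>carrier (module_prod P Q). f (h p) = g p"
proof -
  interpret P: left_module A P by fact
  interpret Q: left_module A Q by fact
  have "(\<lambda>p. (p, \<zero>\<^bsub>Q\<^esub>)) \<in> lin_hom A P (module_prod P Q)"
    by (rule lin_hom_Pair[OF lin_hom_id lin_hom_const_zero[OF Q]])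
  from lift1[OF lin_hom_comp'[OF this g]]
  obtain h1 where h1: "h1 \<in> lin_hom A P U" "\<And>p. p \<in> carrier P \<Longrightarrow> f (h1 p) = g (p, \<zero>\<^bsub>Q\<^esub>)" by blast
  have "(\<lambda>q. (\<zero>\<^bsub>P\<^esub>, q)) \<in> lin_hom A Q (module_prod P Q)"
    by (rule lin_hom_Pair[OF lin_hom_const_zero[OF P] lin_hom_id])
  from lift2[OF lin_hom_comp'[OF this g]]
  obtain h2 where h2: "h2 \<in> lin_hom A Q U" "\<And>q. q \<in> carrier Q \<Longrightarrow> f (h2 q) = g (\<zero>\<^bsub>P\<^esub>, q)" by blast
  show ?thesis
  proof (rule bexI[of _ "\<lambda>z. h1 (fst z) \<oplus>\<^bsub>U\<^esub> h2 (snd z)"], rule ballI)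
    fix z assume "z \<in> carrier (module_prod P Q)"
    then have z: "fst z \<in> carrier P" "snd z \<in> carrier Q" by auto
    then have "g ((fst z, \<zero>\<^bsub>Q\<^esub>) \<oplus>\<^bsub>module_prod P Q\<^esub> (\<zero>\<^bsub>P\<^esub>, snd z)) = f (h1 (fst z)) \<oplus>\<^bsub>V\<^esub> f (h2 (snd z))"
      using lin_homD(2)[OF g, of "(fst z, \<zero>\<^bsub>Q\<^esub>)" "(\<zero>\<^bsub>P\<^esub>, snd z)"] h1(2) h2(2) by simp
    then show "f (h1 (fst z) \<oplus>\<^bsub>U\<^esub> h2 (snd z)) = g z"
      using z lin_homD(2)[OF f] lin_homD(1)[OF h1(1)] lin_homD(1)[OF h2(1)] by simp
  qed (intro lin_hom_add[OF U] lin_hom_comp'[OF lin_hom_fst h1(1)] lin_hom_comp'[OF lin_hom_snd h2(1)])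
qed

lemma retract_lifting:
  assumes i: "i \<in> lin_hom A P P'" and r: "r \<in> lin_hom A P' P" and ri: "\<And>p. p \<in> carrier P \<Longrightarrow> r (i p) = p"
    and g: "g \<in> lin_hom A P V"
    and lift: "\<And>k. k \<in> lin_hom A P' V \<Longrightarrow> \<exists>h \<in> lin_hom A P' U. \<forall>q\<in>carrier P'. f (h q) = k q"
  shows "\<exists>h \<in> lin_hom A P U. \<forall>p\<in>carrier P. f (h p) = g p"
proof -
  obtain h where h: "h \<in> lin_hom A P' U" "\<And>q. q \<in> carrier P' \<Longrightarrow> f (h q) = g (r q)"
    using lift[OF lin_hom_comp'[OF r g]] by blast
  show ?thesis
    by (rule bexI[OF _ lin_hom_comp'[OF i h(1)]]) (simp add: h(2) lin_homD(1)[OF i] ri)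
qed

lemma projective_copower:
  assumes P: "projective A P" shows "projective A (copower P :: ('a, 'x \<Rightarrow> 'p) module)"
  unfolding projective_def
proof (intro conjI allI impI ballI)
  have PA: "left_module A P" using P by (simp add: projective_def)
  then show "left_module A (copower P)" by (rule copower_left_module)
  fix U V :: "('a, ('a \<times> ('x \<Rightarrow> 'p)) list) module" and f g
  assume h: "left_module A U" "left_module A V" "f \<in> lin_hom A U V" "f ` carrier U = carrier V"
    "g \<in> lin_hom A (copower P) V"
  show "\<exists>h\<in>lin_hom A (copower P) U. \<forall>p\<in>carrier (copower P). f (h p) = g p"
    by (rule copower_lifting[OF PA h(1-3,5) projective_lift[OF P h(1-4)]])
qed

lemma projective_retract:
  fixes P :: "('a, 'p, 'y) module_scheme"
  assumes P': "projective A P'" and P: "left_module A P"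
    and i: "i \<in> lin_hom A P P'" and r: "r \<in> lin_hom A P' P" and ri: "\<And>p. p \<in> carrier P \<Longrightarrow> r (i p) = p"
  shows "projective A P"
  unfolding projective_def
proof (intro conjI allI impI ballI)
  fix U V :: "('a, ('a \<times> 'p) list) module" and f g
  assume h: "left_module A U" "left_module A V" "f \<in> lin_hom A U V" "f ` carrier U = carrier V"
    "g \<in> lin_hom A P V"
  show "\<exists>h\<in>lin_hom A P U. \<forall>p\<in>carrier P. f (h p) = g p"
    by (rule retract_lifting[OF i r ri h(5) projective_lift[OF P' h(1-4)]])
qed (rule P)

lemma rel_projective_left_module: "rel_projective R A P \<Longrightarrow> left_module A P"
  by (simp add: rel_projective_def)

lemma rel_projective_of_projective: "projective A P \<Longrightarrow> rel_projective R A P"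
  unfolding projective_def rel_projective_def by blast

lemma rel_projective_copower:
  fixes A :: "('r, 'a, 'w) module_scheme"
  assumes R: "assoc_algebra R A" and P: "rel_projective R A P"
  shows "rel_projective R A (copower P :: ('a, 'x \<Rightarrow> 'p) module)"
  unfolding rel_projective_def
proof (intro conjI allI impI ballI)
  have PA: "left_module A P" using P by (rule rel_projective_left_module)
  then show "left_module A (copower P)" by (rule copower_left_module)
  fix U V :: "('a, ('a \<times> ('x \<Rightarrow> 'p)) list) module" and f g
  assume h: "left_module A U" "left_module A V" "f \<in> lin_hom A U V" "f ` carrier U = carrier V"
    "\<exists>s\<in>lin_hom R (scalars A V) (scalars A U). \<forall>y\<in>carrier V. f (s y) = y"
    "g \<in> lin_hom A (copower P) V"
  show "\<exists>h\<in>lin_hom A (copower P) U. \<forall>p\<in>carrier (copower P). f (h p) = g p"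
    by (rule copower_lifting[OF PA h(1-3,6)])
      (use rel_projective_lift[OF R P h(1-4)] h(5) in blast)
qed

lemma rel_projective_prod:
  fixes A :: "('r, 'a, 'w) module_scheme" and P :: "('a, 'p, 'y) module_scheme"
    and Q :: "('a, 'q, 'z) module_scheme"
  assumes R: "assoc_algebra R A" and P: "rel_projective R A P" and Q: "rel_projective R A Q"
  shows "rel_projective R A (module_prod P Q)"
  unfolding rel_projective_def
proof (intro conjI allI impI ballI)
  have PA: "left_module A P" "left_module A Q" using P Q by (auto dest: rel_projective_left_module)
  then show "left_module A (module_prod P Q)" by (rule module_prod_left_module)
  fix U V :: "('a, ('a \<times> ('p \<times> 'q)) list) module" and f g
  assume h: "left_module A U" "left_module A V" "f \<in> lin_hom A U V" "f ` carrier U = carrier V"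
    "\<exists>s\<in>lin_hom R (scalars A V) (scalars A U). \<forall>y\<in>carrier V. f (s y) = y"
    "g \<in> lin_hom A (module_prod P Q) V"
  show "\<exists>h\<in>lin_hom A (module_prod P Q) U. \<forall>p\<in>carrier (module_prod P Q). f (h p) = g p"
    by (rule module_prod_lifting[OF PA h(1-3,6)])
      (use rel_projective_lift[OF R P h(1-4)] rel_projective_lift[OF R Q h(1-4)] h(5) in blast)+
qed

lemma rel_projective_retract:
  fixes A :: "('r, 'a, 'w) module_scheme" and P :: "('a, 'p, 'y) module_scheme"
  assumes R: "assoc_algebra R A" and P': "rel_projective R A P'" and P: "left_module A P"
    and i: "i \<in> lin_hom A P P'" and r: "r \<in> lin_hom A P' P" and ri: "\<And>p. p \<in> carrier P \<Longrightarrow> r (i p) = p"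
  shows "rel_projective R A P"
  unfolding rel_projective_def
proof (intro conjI allI impI ballI)
  fix U V :: "('a, ('a \<times> 'p) list) module" and f g
  assume h: "left_module A U" "left_module A V" "f \<in> lin_hom A U V" "f ` carrier U = carrier V"
    "\<exists>s\<in>lin_hom R (scalars A V) (scalars A U). \<forall>y\<in>carrier V. f (s y) = y"
    "g \<in> lin_hom A P V"
  show "\<exists>h\<in>lin_hom A P U. \<forall>p\<in>carrier P. f (h p) = g p"
    by (rule retract_lifting[OF i r ri h(6)])
      (use rel_projective_lift[OF R P' h(1-4)] h(5) in blast)+
qed (rule P)


section \<open>Projectivity over the base ring\<close>

lemma left_regular_simps [simp]:
  "carrier (left_regular A) = carrier A" "\<zero>\<^bsub>left_regular A\<^esub> = \<zero>\<^bsub>A\<^esub>"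
  "x \<oplus>\<^bsub>left_regular A\<^esub> y = x \<oplus>\<^bsub>A\<^esub> y" "a \<odot>\<^bsub>left_regular A\<^esub> x = a \<otimes>\<^bsub>A\<^esub> x"
  by (simp_all add: left_regular_def)

lemma right_regular_simps [simp]:
  "carrier (right_regular A) = carrier A" "\<zero>\<^bsub>right_regular A\<^esub> = \<zero>\<^bsub>A\<^esub>"
  "x \<oplus>\<^bsub>right_regular A\<^esub> y = x \<oplus>\<^bsub>A\<^esub> y" "a \<odot>\<^bsub>right_regular A\<^esub> x = x \<otimes>\<^bsub>A\<^esub> a"
  by (simp_all add: right_regular_def)

lemma left_regular_left_module:
  assumes "ring A" shows "left_module A (left_regular A)"
proof -
  interpret ring A by fact
  show ?thesis
  proof (rule left_moduleI)
    fix x assume "x \<in> carrier (left_regular A)"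
    then show "\<exists>y\<in>carrier (left_regular A). y \<oplus>\<^bsub>left_regular A\<^esub> x = \<zero>\<^bsub>left_regular A\<^esub>"
      by (intro bexI[of _ "\<ominus>\<^bsub>A\<^esub> x"]) (auto simp: l_neg)
  qed (auto simp: a_ac l_distr r_distr m_assoc assms)
qed

lemma smult_lin_hom:
  assumes "left_module A U" "u \<in> carrier U"
  shows "(\<lambda>a. a \<odot>\<^bsub>U\<^esub> u) \<in> lin_hom A (left_regular A) U"
proof -
  interpret U: left_module A U by fact
  show ?thesis using assms(2) by (auto simp: lin_hom_def U.smult_l_distr U.smult_assoc1)
qed

lemma projective_left_regular:
  assumes "ring A" shows "projective A (left_regular A)"
  unfolding projective_def
proof (intro conjI allI impI ballI)
  interpret ring A by fact
  fix U V :: "('a, ('a \<times> 'a) list) module" and f g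
  assume h: "left_module A U" "left_module A V" "f \<in> lin_hom A U V" "f ` carrier U = carrier V"
    "g \<in> lin_hom A (left_regular A) V"
  have "g \<one>\<^bsub>A\<^esub> \<in> f ` carrier U" using lin_homD(1)[OF h(5)] h(4) by simp
  then obtain u where u: "u \<in> carrier U" "f u = g \<one>\<^bsub>A\<^esub>" by auto
  show "\<exists>h\<in>lin_hom A (left_regular A) U. \<forall>p\<in>carrier (left_regular A). f (h p) = g p"
  proof (rule bexI[OF _ smult_lin_hom[OF h(1) u(1)]], rule ballI)
    fix p assume p: "p \<in> carrier (left_regular A)"
    then show "f (p \<odot>\<^bsub>U\<^esub> u) = g p"
      using lin_homD(3)[OF h(3) _ u(1), of p] lin_homD(3)[OF h(5), of p "\<one>\<^bsub>A\<^esub>"] u(2) by simp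
  qed
qed (rule left_regular_left_module[OF assms])

text \<open>The free module that covers \<open>U\<close> has one generator for each element of the type of \<open>U\<close>. A
  generator outside the carrier has to be sent somewhere, and \<open>in_carrier\<close> sends it to zero.\<close>

definition in_carrier :: "('n, 'z) ring_scheme \<Rightarrow> 'n \<Rightarrow> 'n" where
  "in_carrier U x = (if x \<in> carrier U then x else \<zero>\<^bsub>U\<^esub>)"

definition free_cover :: "('a, 'm, 'z) module_scheme \<Rightarrow> ('m \<Rightarrow> 'a) \<Rightarrow> 'm" where
  "free_cover U = copower_lift U (\<lambda>x a. a \<odot>\<^bsub>U\<^esub> in_carrier U x)"

lemma in_carrier_closed: "left_module A U \<Longrightarrow> in_carrier U x \<in> carrier U"
  by (simp add: in_carrier_def abelian_monoid.zero_closed[OF left_moduleD(3)])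

lemma free_cover_lin_hom:
  assumes "left_module A U" shows "free_cover U \<in> lin_hom A (copower (left_regular A)) U"
  unfolding free_cover_def
  by (rule copower_lift_lin_hom[OF left_regular_left_module[OF left_moduleD(1)[OF assms]] assms
        smult_lin_hom[OF assms in_carrier_closed[OF assms]]])

lemma free_cover_single:
  assumes "left_module A U" "u \<in> carrier U"
  shows "free_cover U (copower_single (left_regular A) u \<one>\<^bsub>A\<^esub>) = u"
proof -
  interpret U: left_module A U by fact
  have "free_cover U (copower_single (left_regular A) u \<one>\<^bsub>A\<^esub>) = \<one>\<^bsub>A\<^esub> \<odot>\<^bsub>U\<^esub> in_carrier U u"
    unfolding free_cover_def
    by (rule copower_lift_single[OF left_regular_left_module[OF left_moduleD(1)[OF assms(1)]] assms(1)
        smult_lin_hom[OF assms(1) in_carrier_closed[OF assms(1)]]]) simp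
  then show ?thesis using assms(2) by (simp add: in_carrier_def)
qed

lemma free_cover_surj:
  fixes U :: "('a, 'u, 'z) module_scheme"
  assumes U: "left_module A U"
  shows "free_cover U ` carrier (copower (left_regular A) :: ('a, 'u \<Rightarrow> 'a) module) = carrier U"
proof -
  interpret U: left_module A U by fact
  have "u \<in> free_cover U ` carrier (copower (left_regular A) :: ('a, 'u \<Rightarrow> 'a) module)"
    if u: "u \<in> carrier U" for u
    by (rule image_eqI, rule free_cover_single[OF U u, symmetric],
        rule copower_single_closed[OF left_regular_left_module[OF U.A.ring_axioms]], simp)
  then show ?thesis using lin_homD(1)[OF free_cover_lin_hom[OF U]] by blast
qed

text \<open>Taking coordinates with respect to a basis is a section of the canonical cover, and uniqueness
  of coordinates makes it linear.\<close>

lemma free_module_projective: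
  fixes U :: "('a, 'u, 'z) module_scheme"
  assumes "free_module A U" shows "projective A U"
proof -
  have U: "left_module A U" using assms by (simp add: free_module_def)
  interpret U: left_module A U by fact
  let ?F = "copower (left_regular A) :: ('a, 'u \<Rightarrow> 'a) module"
  have F: "left_module A ?F" by (intro copower_left_module left_regular_left_module U.A.ring_axioms)
  interpret F: left_module A ?F by fact
  obtain B where B: "B \<subseteq> carrier U" and ex1: "\<And>x. x \<in> carrier U \<Longrightarrow>
     \<exists>!c. (\<forall>b. c b \<in> carrier A) \<and> (\<forall>b. b \<notin> B \<longrightarrow> c b = \<zero>\<^bsub>A\<^esub>) \<and> finite {b. c b \<noteq> \<zero>\<^bsub>A\<^esub>} \<and>
       x = (\<Oplus>\<^bsub>U\<^esub> b\<in>{b. c b \<noteq> \<zero>\<^bsub>A\<^esub>}. c b \<odot>\<^bsub>U\<^esub> b)"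
    using assms by (auto simp: free_module_def)
  define D where "D = {c \<in> carrier ?F. \<forall>b. b \<notin> B \<longrightarrow> c b = \<zero>\<^bsub>A\<^esub>}"
  have cov: "free_cover U c = (\<Oplus>\<^bsub>U\<^esub> b\<in>{b. c b \<noteq> \<zero>\<^bsub>A\<^esub>}. c b \<odot>\<^bsub>U\<^esub> b)" if c: "c \<in> D" for c
  proof -
    have "free_cover U c = (\<Oplus>\<^bsub>U\<^esub> b\<in>{b. c b \<noteq> \<zero>\<^bsub>A\<^esub>}. c b \<odot>\<^bsub>U\<^esub> in_carrier U b)"
      unfolding free_cover_def
      by (rule copower_lift_eq)
        (use c in_carrier_closed[OF U] in \<open>auto simp: D_def U.smult_l_zero U.M.abelian_monoid_axioms\<close>)
    also have "\<dots> = (\<Oplus>\<^bsub>U\<^esub> b\<in>{b. c b \<noteq> \<zero>\<^bsub>A\<^esub>}. c b \<odot>\<^bsub>U\<^esub> b)"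
      by (rule U.M.finsum_cong') (use c B in \<open>auto simp: D_def in_carrier_def\<close>)
    finally show ?thesis .
  qed
  have uniq: "\<exists>!c. c \<in> D \<and> free_cover U c = x" if x: "x \<in> carrier U" for x
  proof -
    have "(c \<in> D \<and> free_cover U c = x) \<longleftrightarrow> (\<forall>b. c b \<in> carrier A) \<and> (\<forall>b. b \<notin> B \<longrightarrow> c b = \<zero>\<^bsub>A\<^esub>) \<and>
        finite {b. c b \<noteq> \<zero>\<^bsub>A\<^esub>} \<and> x = (\<Oplus>\<^bsub>U\<^esub> b\<in>{b. c b \<noteq> \<zero>\<^bsub>A\<^esub>}. c b \<odot>\<^bsub>U\<^esub> b)" for c
      using cov[of c] by (auto simp: D_def)
    then show ?thesis using ex1[OF x] by presburger
  qed
  define s where "s x = (THE c. c \<in> D \<and> free_cover U c = x)" for x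
  have s: "s x \<in> D" "free_cover U (s x) = x" if "x \<in> carrier U" for x
    using theI'[OF uniq[OF that]] by (auto simp: s_def)
  have s_eq: "s x = c" if "c \<in> D" "free_cover U c = x" "x \<in> carrier U" for x c
    using uniq[OF that(3)] s[OF that(3)] that(1,2) by blast
  have DF: "c \<in> D \<Longrightarrow> c \<in> carrier ?F" for c by (simp add: D_def)
  have "s \<in> lin_hom A U ?F"
  proof (rule lin_homI)
    fix x y assume x: "x \<in> carrier U" and y: "y \<in> carrier U"
    note sx = s[OF x] DF[OF s(1)[OF x]] and sy = s[OF y] DF[OF s(1)[OF y]]
    have "s x \<oplus>\<^bsub>?F\<^esub> s y \<in> D"
      using F.M.a_closed[OF sx(3) sy(3)] sx(1) sy(1) by (auto simp: D_def)
    then show "s (x \<oplus>\<^bsub>U\<^esub> y) = s x \<oplus>\<^bsub>?F\<^esub> s y"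
      by (rule s_eq) (use x y lin_homD(2)[OF free_cover_lin_hom[OF U] sx(3) sy(3)] sx sy in auto)
  next
    fix a x assume a: "a \<in> carrier A" and x: "x \<in> carrier U"
    note sx = s[OF x] DF[OF s(1)[OF x]]
    have "a \<odot>\<^bsub>?F\<^esub> s x \<in> D"
      using F.smult_closed[OF a sx(3)] sx(1) a by (auto simp: D_def)
    then show "s (a \<odot>\<^bsub>U\<^esub> x) = a \<odot>\<^bsub>?F\<^esub> s x"
      by (rule s_eq) (use x a lin_homD(3)[OF free_cover_lin_hom[OF U] a sx(3)] sx in auto)
  qed (use s DF in blast)
  then show ?thesis
    by (rule projective_retract[where P' = ?F and r = "free_cover U", rotated 2])
      (use projective_copower[OF projective_left_regular[OF U.A.ring_axioms]] U
        free_cover_lin_hom[OF U] s(2) in auto)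
qed

lemma projective_cong:
  fixes P P' :: "('a, 'p) module"
  assumes "projective A P'" "left_module A P" "carrier P = carrier P'" "add P = add P'"
    and "\<And>a x. \<lbrakk>a \<in> carrier A; x \<in> carrier P'\<rbrakk> \<Longrightarrow> a \<odot>\<^bsub>P\<^esub> x = a \<odot>\<^bsub>P'\<^esub> x"
  shows "projective A P"
  by (rule projective_retract[OF assms(1,2), of "\<lambda>x. x" "\<lambda>x. x"])
    (use assms(3-5) in \<open>auto simp: lin_hom_def\<close>)

lemma projective_opp_ring:
  assumes "cring R" "projective (opp_ring R) X" shows "projective R X"
proof -
  interpret R: cring R by fact
  have lm: "left_module (opp_ring R) U \<longleftrightarrow> left_module R U" for U :: "('a, 'm, 'z) module_scheme"
  proof -
    have ax: "left_module_axioms (opp_ring R) U \<longleftrightarrow> left_module_axioms R U"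
      unfolding left_module_axioms_def opp_ring_def using R.m_comm by auto
    have "add_monoid (opp_ring R) = add_monoid R" by (simp add: opp_ring_def)
    then have "abelian_group (opp_ring R)"
      using R.abelian_group_axioms
      by (simp add: abelian_group_def abelian_monoid_def abelian_group_axioms_def)
    moreover have "monoid (opp_ring R)"
      by (rule monoidI) (simp_all add: opp_ring_def R.m_assoc)
    ultimately have "ring (opp_ring R)"
      by (rule ringI) (simp_all add: opp_ring_def R.l_distr R.r_distr)
    then show ?thesis using ax R.ring_axioms by (simp add: left_module_def)
  qed
  have lh: "lin_hom (opp_ring R) U V = lin_hom R U V" for U :: "('a, 'm, 'y) module_scheme"
    and V :: "('a, 'n, 'z) module_scheme"
    by (simp add: lin_hom_def opp_ring_def)
  show ?thesis using assms(2) unfolding projective_def lm lh .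
qed

text \<open>A projective \<open>A\<close>-module is a direct summand of a free one, and a free one is a direct sum of
  copies of \<open>A\<close>.\<close>

lemma projective_scalars:
  fixes A :: "('r, 'a, 'w) module_scheme" and P :: "('a, 'p, 'z) module_scheme"
  assumes R: "assoc_algebra R A" and A: "projective R (scalars A (left_regular A))" and P: "projective A P"
  shows "projective R (scalars A P)"
proof -
  interpret R: assoc_algebra R A by fact
  have PA: "left_module A P" using P by (simp add: projective_def)
  let ?F = "copower (left_regular A) :: ('a, 'p \<Rightarrow> 'a) module"
  have F: "left_module A ?F" by (intro copower_left_module left_regular_left_module R.ring_axioms)
  obtain h where h: "h \<in> lin_hom A P ?F" "\<And>p. p \<in> carrier P \<Longrightarrow> free_cover P (h p) = p"
    using projective_lift[OF P F PA free_cover_lin_hom[OF PA] free_cover_surj[OF PA] lin_hom_id] by blast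
  have "projective R (scalars A ?F)"
    unfolding scalars_copower by (rule projective_copower[OF A])
  from projective_retract[OF this scalars_left_module[OF R PA] lin_hom_scalars[OF R h(1)]
      lin_hom_scalars[OF R free_cover_lin_hom[OF PA]]]
  show ?thesis using h(2) by simp
qed

section \<open>Split resolutions\<close>

text \<open>With the augmentation as the differential in degree \<open>0\<close>, exactness and splittings have the
  same form in all degrees.\<close>

definition cycles ::
    "('n, 'y) ring_scheme \<Rightarrow> (nat \<Rightarrow> ('a, 'c, 'z) module_scheme) \<Rightarrow> (nat \<Rightarrow> 'c \<Rightarrow> 'c) \<Rightarrow> ('c \<Rightarrow> 'n) \<Rightarrow> nat \<Rightarrow> 'c set"
  where "cycles N C d e k = (case k of 0 \<Rightarrow> mod_ker (C 0) N e | Suc j \<Rightarrow> mod_ker (C (Suc j)) (C j) (d j))"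

lemma cycles_simps [simp]:
  "cycles N C d e 0 = mod_ker (C 0) N e" "cycles N C d e (Suc j) = mod_ker (C (Suc j)) (C j) (d j)"
  by (simp_all add: cycles_def)

lemma resolution_iff_cycles:
  "resolution A N C d e \<longleftrightarrow> left_module A N \<and> (\<forall>k. left_module A (C k)) \<and>
    e \<in> lin_hom A (C 0) N \<and> (\<forall>k. d k \<in> lin_hom A (C (Suc k)) (C k)) \<and>
    e ` carrier (C 0) = carrier N \<and> (\<forall>k. d k ` carrier (C (Suc k)) = cycles N C d e k)"
proof -
  have nat: "(\<forall>k. p k) \<longleftrightarrow> p 0 \<and> (\<forall>k. p (Suc k))" for p :: "nat \<Rightarrow> bool"
    using nat_induct[of p] by blast
  show ?thesis
    unfolding resolution_def nat[of "\<lambda>k. d k ` carrier (C (Suc k)) = cycles N C d e k"] by simp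
qed

text \<open>A relatively projective resolution together with a choice of \<open>R\<close>-linear splittings: \<open>\<sigma>\<close> is a
  section of the augmentation and \<open>s k\<close> chooses preimages of cycles.\<close>

locale split_resolution =
  fixes R :: "('r, 'v) ring_scheme" and A :: "('r, 'a, 'w) module_scheme"
    and N :: "('a, 'n, 'y) module_scheme" and C :: "nat \<Rightarrow> ('a, 'c, 'z) module_scheme"
    and d :: "nat \<Rightarrow> 'c \<Rightarrow> 'c" and e :: "'c \<Rightarrow> 'n" and \<sigma> :: "'n \<Rightarrow> 'c" and s :: "nat \<Rightarrow> 'c \<Rightarrow> 'c"
  assumes alg: "assoc_algebra R A"
    and N: "left_module A N" and rel_proj: "\<And>k. rel_projective R A (C k)"
    and e: "e \<in> lin_hom A (C 0) N" and d: "\<And>k. d k \<in> lin_hom A (C (Suc k)) (C k)"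
    and d_cycle: "\<And>k x. x \<in> carrier (C (Suc k)) \<Longrightarrow> d k x \<in> cycles N C d e k"
    and \<sigma>: "\<sigma> \<in> lin_hom R (scalars A N) (scalars A (C 0))"
    and s: "\<And>k. s k \<in> lin_hom R (scalars A (C k)) (scalars A (C (Suc k)))"
    and e_\<sigma>: "\<And>n. n \<in> carrier N \<Longrightarrow> e (\<sigma> n) = n"
    and d_s: "\<And>k z. z \<in> cycles N C d e k \<Longrightarrow> d k (s k z) = z"
begin

lemma C: "left_module A (C k)"
  using rel_proj by (rule rel_projective_left_module)

lemma e_surj: "e ` carrier (C 0) = carrier N"
  using lin_homD(1)[OF e] lin_homD(1)[OF \<sigma>] e_\<sigma> by (force simp: image_def)

lemma cycles_carrier: "z \<in> cycles N C d e k \<Longrightarrow> z \<in> carrier (C k)"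
  by (auto simp: cycles_def mod_ker_def split: nat.splits)

lemma d_image: "d k ` carrier (C (Suc k)) = cycles N C d e k"
proof -
  have "z \<in> d k ` carrier (C (Suc k))" if "z \<in> cycles N C d e k" for z
    using d_s[OF that] lin_homD(1)[OF s, of z k] cycles_carrier[OF that] by (simp add: image_iff) metis
  then show ?thesis using d_cycle by blast
qed

lemma d_d: "x \<in> carrier (C (Suc (Suc k))) \<Longrightarrow> d k (d (Suc k) x) = \<zero>\<^bsub>C k\<^esub>"
  using d_cycle[of x "Suc k"] by (simp add: mod_ker_def)

lemma e_d: "x \<in> carrier (C (Suc 0)) \<Longrightarrow> e (d 0 x) = \<zero>\<^bsub>N\<^esub>"
  using d_cycle[of x 0] by (simp add: mod_ker_def)

lemma cycle_module: "left_module A ((C k)\<lparr>carrier := cycles N C d e k\<rparr>)"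
  by (cases k) (simp_all add: ker_module[OF C N e] ker_module[OF C C d])

end

lemma rel_projective_resolution_split:
  assumes alg: "assoc_algebra R A" and res: "rel_projective_resolution R A N C d e"
  obtains \<sigma> s where "split_resolution R A N C d e \<sigma> s"
proof -
  from res obtain \<sigma> where \<sigma>: "\<sigma> \<in> lin_hom R (scalars A N) (scalars A (C 0))"
      "\<And>x. x \<in> carrier (C 0) \<Longrightarrow> e (\<sigma> (e x)) = e x"
    by (auto simp: rel_projective_resolution_def)
  have "\<forall>k. \<exists>t. t \<in> lin_hom R (scalars A (C k)) (scalars A (C (Suc k))) \<and>
       (\<forall>x\<in>carrier (C (Suc k)). d k (t (d k x)) = d k x)"
    using res by (auto simp: rel_projective_resolution_def)
  then obtain s where s: "\<And>k. s k \<in> lin_hom R (scalars A (C k)) (scalars A (C (Suc k)))"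
       "\<And>k x. x \<in> carrier (C (Suc k)) \<Longrightarrow> d k (s k (d k x)) = d k x"
    by metis
  have im: "e ` carrier (C 0) = carrier N" "\<And>k. d k ` carrier (C (Suc k)) = cycles N C d e k"
    using res by (simp_all add: rel_projective_resolution_def resolution_iff_cycles)
  have "split_resolution R A N C d e \<sigma> s"
  proof (rule split_resolution.intro)
    show "d k x \<in> cycles N C d e k" if "x \<in> carrier (C (Suc k))" for k x
      using im(2)[of k] that by blast
    show "e (\<sigma> n) = n" if "n \<in> carrier N" for n
      using that \<sigma>(2) unfolding im(1)[symmetric] by auto
    show "d k (s k z) = z" if "z \<in> cycles N C d e k" for k z
      using that s(2) unfolding im(2)[symmetric] by auto
  qed (use res alg \<sigma> s in \<open>simp_all add: rel_projective_resolution_def resolution_iff_cycles\<close>)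
  then show ?thesis by (rule that)
qed

text \<open>A section of a surjection makes its kernel a direct summand. This is used over \<open>A\<close> and over
  \<open>R\<close>.\<close>

lemma kernel_retraction:
  assumes U: "left_module A U" and V: "left_module A V"
    and f: "f \<in> lin_hom A U V" and t: "t \<in> lin_hom A V U"
    and ft: "\<And>y. y \<in> carrier V \<Longrightarrow> f (t y) = y"
  shows "(\<lambda>x. x \<ominus>\<^bsub>U\<^esub> t (f x)) \<in> lin_hom A U (ker_module U V f)"
    and "\<And>x. x \<in> mod_ker U V f \<Longrightarrow> x \<ominus>\<^bsub>U\<^esub> t (f x) = x"
proof -
  interpret U: left_module A U by fact
  interpret V: left_module A V by fact
  note tf = lin_hom_comp'[OF f t]
  have "(\<lambda>x. x \<ominus>\<^bsub>U\<^esub> t (f x)) \<in> lin_hom A U U" by (rule lin_hom_sub[OF U lin_hom_id tf])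
  moreover have "x \<ominus>\<^bsub>U\<^esub> t (f x) \<in> mod_ker U V f" if "x \<in> carrier U" for x
    using that lin_homD(1)[OF tf, of x] lin_homD(1)[OF f that] ft
    by (auto simp: mod_ker_def lin_hom_diff[OF U V f]) (simp add: a_minus_def V.M.r_neg)
  ultimately show "(\<lambda>x. x \<ominus>\<^bsub>U\<^esub> t (f x)) \<in> lin_hom A U (ker_module U V f)"
    by (auto simp: lin_hom_def)
  show "x \<ominus>\<^bsub>U\<^esub> t (f x) = x" if "x \<in> mod_ker U V f" for x
    using that lin_hom_zero[OF V U t] by (simp add: mod_ker_def a_minus_def)
qed

lemma scalars_ker_module:
  "scalars A (ker_module U V f) = ker_module (scalars A U) (scalars A V) f"
  by (simp add: scalars_def restrict_scalars_def mod_ker_def)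

lemma scalars_kernel_retraction:
  assumes R: "assoc_algebra R A" and U: "left_module A U" and V: "left_module A V"
    and f: "f \<in> lin_hom A U V" and t: "t \<in> lin_hom R (scalars A V) (scalars A U)"
    and ft: "\<And>y. y \<in> carrier V \<Longrightarrow> f (t y) = y"
  shows "(\<lambda>x. x \<ominus>\<^bsub>U\<^esub> t (f x)) \<in> lin_hom R (scalars A U) (scalars A (ker_module U V f))"
    and "\<And>x. x \<in> mod_ker U V f \<Longrightarrow> x \<ominus>\<^bsub>U\<^esub> t (f x) = x"
proof -
  note * = kernel_retraction[OF scalars_left_module[OF R U] scalars_left_module[OF R V]
      lin_hom_scalars[OF R f] t, simplified scalars_simps scalars_a_minus, OF ft]
  show "(\<lambda>x. x \<ominus>\<^bsub>U\<^esub> t (f x)) \<in> lin_hom R (scalars A U) (scalars A (ker_module U V f))"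
    using *(1) by (simp add: scalars_ker_module)
  show "\<And>x. x \<in> mod_ker U V f \<Longrightarrow> x \<ominus>\<^bsub>U\<^esub> t (f x) = x"
    using *(2) by (simp add: mod_ker_def)
qed

lemma kernel_inclusion: "(\<lambda>x. x) \<in> lin_hom A (ker_module U V f) U"
  by (auto simp: lin_hom_def mod_ker_def)

lemma projective_kernel:
  assumes R: "assoc_algebra R A" and U: "left_module A U" and V: "left_module A V"
    and f: "f \<in> lin_hom A U V" and t: "t \<in> lin_hom R (scalars A V) (scalars A U)"
    and ft: "\<And>y. y \<in> carrier V \<Longrightarrow> f (t y) = y" and P: "projective R (scalars A U)"
  shows "projective R (scalars A (ker_module U V f))"
  by (rule projective_retract[OF P scalars_left_module[OF R ker_module[OF U V f]]
        lin_hom_scalars[OF R kernel_inclusion] scalars_kernel_retraction(1)[OF R U V f t ft]])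
    (use scalars_kernel_retraction(2)[OF R U V f t ft] in auto)

lemma split_surjection:
  assumes R: "assoc_algebra R A" and U: "left_module A U" and V: "left_module A V"
    and f: "f \<in> lin_hom A U V" and surj: "f ` carrier U = carrier V" and P: "projective R (scalars A V)"
  shows "\<exists>t \<in> lin_hom R (scalars A V) (scalars A U). \<forall>y\<in>carrier V. f (t y) = y"
  using projective_lift[OF P scalars_left_module[OF R U] scalars_left_module[OF R V]
      lin_hom_scalars[OF R f] _ lin_hom_id] surj
  by simp

text \<open>Hence a resolution by \<open>R\<close>-projective modules of an \<open>R\<close>-projective module is split over \<open>R\<close>,
  one cycle module after the other.\<close>

lemma projective_resolution_split:
  fixes P :: "nat \<Rightarrow> ('a, 'p, 'z) module_scheme"
  assumes R: "assoc_algebra R A" and A: "projective R (scalars A (left_regular A))"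
    and res: "projective_resolution A N P d e" and N: "projective R (scalars A N)"
  shows "rel_projective_resolution R A N P d e"
proof -
  have r: "left_module A N" "\<And>k. left_module A (P k)" "e \<in> lin_hom A (P 0) N"
      "\<And>k. d k \<in> lin_hom A (P (Suc k)) (P k)" "e ` carrier (P 0) = carrier N"
      "\<And>k. d k ` carrier (P (Suc k)) = cycles N P d e k" "\<And>k. projective A (P k)"
    using res by (simp_all add: projective_resolution_def resolution_iff_cycles)
  have P: "projective R (scalars A (P k))" for k by (rule projective_scalars[OF R A r(7)])
  let ?Z = "\<lambda>k. (P k)\<lparr>carrier := cycles N P d e k\<rparr>"
  have Z: "left_module A (?Z k)" for k
    by (cases k) (simp_all add: ker_module[OF r(2) r(1) r(3)] ker_module[OF r(2) r(2) r(4)])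
  have dZ: "d k \<in> lin_hom A (P (Suc k)) (?Z k)" for k
    using r(4)[of k] r(6)[of k] by (auto simp: lin_hom_def)
  have kerZ: "mod_ker (P (Suc k)) (?Z k) (d k) = cycles N P d e (Suc k)" for k
    by (simp add: mod_ker_def)
  obtain \<sigma> where \<sigma>: "\<sigma> \<in> lin_hom R (scalars A N) (scalars A (P 0))" "\<And>n. n \<in> carrier N \<Longrightarrow> e (\<sigma> n) = n"
    using split_surjection[OF R r(2) r(1) r(3) r(5) N] by blast
  define good where "good k \<rho> \<longleftrightarrow> projective R (scalars A (?Z k)) \<and>
      \<rho> \<in> lin_hom R (scalars A (P k)) (scalars A (?Z k)) \<and> (\<forall>x \<in> cycles N P d e k. \<rho> x = x)" for k and \<rho> :: "'p \<Rightarrow> 'p"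
  have good: "\<exists>\<rho>. good k \<rho>" for k
  proof (induction k)
    case 0
    show ?case
      using projective_kernel[OF R r(2) r(1) r(3) \<sigma> P] scalars_kernel_retraction[OF R r(2) r(1) r(3) \<sigma>]
      by (auto simp: good_def)
  next
    case (Suc k)
    then obtain t where t: "t \<in> lin_hom R (scalars A (?Z k)) (scalars A (P (Suc k)))"
        "\<And>y. y \<in> carrier (?Z k) \<Longrightarrow> d k (t y) = y"
      using split_surjection[OF R r(2) Z dZ, of k] r(6)[of k] by (auto simp: good_def)
    show ?case
      using projective_kernel[OF R r(2) Z dZ t P] scalars_kernel_retraction[OF R r(2) Z dZ t]
      unfolding kerZ by (auto simp: good_def)
  qed
  have "\<exists>s\<in>lin_hom R (scalars A (P k)) (scalars A (P (Suc k))).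
       \<forall>x\<in>carrier (P (Suc k)). d k (s (d k x)) = d k x" for k
  proof -
    obtain \<rho> where \<rho>: "good k \<rho>" using good by blast
    obtain t where t: "t \<in> lin_hom R (scalars A (?Z k)) (scalars A (P (Suc k)))"
        "\<And>y. y \<in> carrier (?Z k) \<Longrightarrow> d k (t y) = y"
      using split_surjection[OF R r(2) Z dZ, of k] r(6)[of k] \<rho> by (auto simp: good_def)
    have "d k x \<in> cycles N P d e k" if "x \<in> carrier (P (Suc k))" for x using r(6)[of k] that by blast
    then show ?thesis
      by (intro bexI[OF _ lin_hom_comp'[OF _ t(1), of \<rho>]]) (use \<rho> t(2) in \<open>auto simp: good_def\<close>)
  qed
  moreover have "\<exists>\<sigma>\<in>lin_hom R (scalars A N) (scalars A (P 0)). \<forall>x\<in>carrier (P 0). e (\<sigma> (e x)) = e x"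
    by (rule bexI[OF _ \<sigma>(1)]) (use \<sigma>(2) lin_homD(1)[OF r(3)] in auto)
  moreover have "rel_projective R A (P k)" for k
    by (rule rel_projective_of_projective[OF r(7)])
  ultimately show ?thesis
    unfolding rel_projective_resolution_def using res
    by (simp add: projective_resolution_def)
qed

text \<open>The comparison theorem: a map between the resolved modules lifts to a chain map, because each
  lifting problem takes place against the \<open>R\<close>-split surjection onto the cycles.\<close>

theorem comparison_chain_map:
  assumes "split_resolution R A N C d e \<sigma> s" "split_resolution R A N' Q dQ eQ \<sigma>Q sQ"
    and \<beta>: "\<beta> \<in> lin_hom A N' N"
  obtains \<phi> where "\<And>k. \<phi> k \<in> lin_hom A (Q k) (C k)"
    "\<And>q. q \<in> carrier (Q 0) \<Longrightarrow> e (\<phi> 0 q) = \<beta> (eQ q)"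
    "\<And>k q. q \<in> carrier (Q (Suc k)) \<Longrightarrow> d k (\<phi> (Suc k) q) = \<phi> k (dQ k q)"
proof -
  interpret C: split_resolution R A N C d e \<sigma> s by fact
  interpret Q: split_resolution R A N' Q dQ eQ \<sigma>Q sQ by fact
  have step: "\<exists>\<psi>. \<psi> \<in> lin_hom A (Q (Suc k)) (C (Suc k)) \<and>
      (\<forall>q\<in>carrier (Q (Suc k)). d k (\<psi> q) = \<phi> (dQ k q))"
    if \<phi>: "\<phi> \<in> lin_hom A (Q k) (C k)" and cyc: "\<phi> ` cycles N' Q dQ eQ k \<subseteq> cycles N C d e k" for k \<phi>
  proof -
    let ?Z = "(C k)\<lparr>carrier := cycles N C d e k\<rparr>"
    have dZ: "d k \<in> lin_hom A (C (Suc k)) ?Z"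
      using C.d[of k] C.d_cycle by (auto simp: lin_hom_def)
    have surj: "d k ` carrier (C (Suc k)) = carrier ?Z" by (simp add: C.d_image)
    have sZ: "s k \<in> lin_hom R (scalars A ?Z) (scalars A (C (Suc k)))"
      using C.s[of k] C.cycles_carrier by (auto simp: lin_hom_def)
    have "(\<lambda>q. \<phi> (dQ k q)) \<in> lin_hom A (Q (Suc k)) ?Z"
      using lin_hom_comp'[OF Q.d \<phi>] Q.d_cycle cyc by (auto simp: lin_hom_def)
    from rel_projective_lift[OF C.alg Q.rel_proj C.C C.cycle_module dZ surj sZ _ this]
    show ?thesis using C.d_s by auto
  qed
  have "\<exists>\<phi>. \<forall>k. (\<phi> k \<in> lin_hom A (Q k) (C k) \<and> \<phi> k ` cycles N' Q dQ eQ k \<subseteq> cycles N C d e k \<and>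
        (k = 0 \<longrightarrow> (\<forall>q\<in>carrier (Q 0). e (\<phi> k q) = \<beta> (eQ q)))) \<and>
      (\<forall>q\<in>carrier (Q (Suc k)). d k (\<phi> (Suc k) q) = \<phi> k (dQ k q))"
  proof (rule dependent_nat_choice)
    obtain \<phi> where \<phi>: "\<phi> \<in> lin_hom A (Q 0) (C 0)" "\<And>q. q \<in> carrier (Q 0) \<Longrightarrow> e (\<phi> q) = \<beta> (eQ q)"
      using rel_projective_lift[OF C.alg Q.rel_proj C.C C.N C.e C.e_surj C.\<sigma> C.e_\<sigma>
          lin_hom_comp'[OF Q.e \<beta>]] by blast
    have "\<phi> ` cycles N' Q dQ eQ 0 \<subseteq> cycles N C d e 0"
      using \<phi> lin_homD(1)[OF \<phi>(1)] lin_hom_zero[OF Q.N C.N \<beta>] by (auto simp: mod_ker_def)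
    then show "\<exists>\<phi>. \<phi> \<in> lin_hom A (Q 0) (C 0) \<and> \<phi> ` cycles N' Q dQ eQ 0 \<subseteq> cycles N C d e 0 \<and>
        (0 = (0::nat) \<longrightarrow> (\<forall>q\<in>carrier (Q 0). e (\<phi> q) = \<beta> (eQ q)))"
      using \<phi> by blast
  next
    fix \<phi> k assume \<phi>: "\<phi> \<in> lin_hom A (Q k) (C k) \<and> \<phi> ` cycles N' Q dQ eQ k \<subseteq> cycles N C d e k \<and>
        (k = 0 \<longrightarrow> (\<forall>q\<in>carrier (Q 0). e (\<phi> q) = \<beta> (eQ q)))"
    then obtain \<psi> where \<psi>: "\<psi> \<in> lin_hom A (Q (Suc k)) (C (Suc k))"
        "\<And>q. q \<in> carrier (Q (Suc k)) \<Longrightarrow> d k (\<psi> q) = \<phi> (dQ k q)"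
      using step[of \<phi> k] by blast
    have "\<phi> \<zero>\<^bsub>Q k\<^esub> = \<zero>\<^bsub>C k\<^esub>" using lin_hom_zero[OF Q.C C.C] \<phi> by blast
    then have "\<psi> ` cycles N' Q dQ eQ (Suc k) \<subseteq> cycles N C d e (Suc k)"
      using \<psi> lin_homD(1)[OF \<psi>(1)] by (auto simp: mod_ker_def)
    then show "\<exists>\<psi>. (\<psi> \<in> lin_hom A (Q (Suc k)) (C (Suc k)) \<and>
        \<psi> ` cycles N' Q dQ eQ (Suc k) \<subseteq> cycles N C d e (Suc k) \<and>
        (Suc k = 0 \<longrightarrow> (\<forall>q\<in>carrier (Q 0). e (\<psi> q) = \<beta> (eQ q)))) \<and>
        (\<forall>q\<in>carrier (Q (Suc k)). d k (\<psi> q) = \<phi> (dQ k q))"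
      using \<psi> by (intro exI[of _ \<psi>]) simp
  qed
  then obtain \<phi> where \<phi>: "\<forall>k. (\<phi> k \<in> lin_hom A (Q k) (C k) \<and>
        \<phi> k ` cycles N' Q dQ eQ k \<subseteq> cycles N C d e k \<and>
        (k = 0 \<longrightarrow> (\<forall>q\<in>carrier (Q 0). e (\<phi> k q) = \<beta> (eQ q)))) \<and>
      (\<forall>q\<in>carrier (Q (Suc k)). d k (\<phi> (Suc k) q) = \<phi> k (dQ k q))"
    by (elim exE)
  show ?thesis by (rule that[of \<phi>]) (use \<phi> in auto)
qed


section \<open>The submodule \<open>I U\<close> and acyclicity modulo \<open>I\<close>\<close>

text \<open>Every element of \<open>I U\<close> is a finite sum of products \<open>i u\<close>. Adding one product at a time makes
  all properties of \<open>I U\<close> below accessible to induction.\<close>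

inductive_set ideal_smult :: "'a set \<Rightarrow> ('a, 'u, 'z) module_scheme \<Rightarrow> 'u set"
  for I and U where
    zero: "\<zero>\<^bsub>U\<^esub> \<in> ideal_smult I U"
  | add: "\<lbrakk>i \<in> I; u \<in> carrier U; x \<in> ideal_smult I U\<rbrakk> \<Longrightarrow> i \<odot>\<^bsub>U\<^esub> u \<oplus>\<^bsub>U\<^esub> x \<in> ideal_smult I U"

context
  fixes A :: "('a, 'w) ring_scheme" and I :: "'a set"
  assumes I: "ideal I A"
begin

lemma ideal_closed: "i \<in> I \<Longrightarrow> i \<in> carrier A"
  by (rule ideal.Icarr[OF I])

lemma ideal_smult_closed:
  assumes "left_module A U" "x \<in> ideal_smult I U" shows "x \<in> carrier U"
proof -
  interpret U: left_module A U by fact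
  show ?thesis using assms(2) by induction (auto simp: ideal_closed)
qed

lemma ideal_smult_incl:
  assumes "left_module A U" "i \<in> I" "u \<in> carrier U" shows "i \<odot>\<^bsub>U\<^esub> u \<in> ideal_smult I U"
proof -
  interpret U: left_module A U by fact
  show ?thesis using ideal_smult.add[OF assms(2,3) ideal_smult.zero] assms ideal_closed by simp
qed

lemma ideal_smult_add:
  assumes "left_module A U" "x \<in> ideal_smult I U" "y \<in> ideal_smult I U"
  shows "x \<oplus>\<^bsub>U\<^esub> y \<in> ideal_smult I U"
proof -
  interpret U: left_module A U by fact
  note y = ideal_smult_closed[OF assms(1,3)]
  show ?thesis using assms(2)
  proof induction
    case zero then show ?case using assms(3) y by simp
  next
    case (add i u x)
    then show ?case
      using y ideal_closed ideal_smult_closed[OF assms(1)]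
      by (auto simp: U.M.a_assoc intro: ideal_smult.add)
  qed
qed

lemma ideal_smult_smult:
  assumes "left_module A U" "a \<in> carrier A" "x \<in> ideal_smult I U"
  shows "a \<odot>\<^bsub>U\<^esub> x \<in> ideal_smult I U"
proof -
  interpret U: left_module A U by fact
  show ?thesis using assms(3)
  proof induction
    case zero then show ?case using U.smult_zero assms(2) ideal_smult.zero[of U I] by simp
  next
    case (add i u x)
    have "a \<odot>\<^bsub>U\<^esub> (i \<odot>\<^bsub>U\<^esub> u \<oplus>\<^bsub>U\<^esub> x) = (a \<otimes>\<^bsub>A\<^esub> i) \<odot>\<^bsub>U\<^esub> u \<oplus>\<^bsub>U\<^esub> a \<odot>\<^bsub>U\<^esub> x"
      using add assms(2) ideal_closed ideal_smult_closed[OF assms(1)]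
      by (simp add: U.smult_r_distr U.smult_assoc1)
    then show ?case using ideal_smult.add[OF ideal.I_l_closed[OF I] add(2)] add assms(2) by simp
  qed
qed

lemma ideal_smult_minus:
  assumes "left_module A U" "x \<in> ideal_smult I U"
  shows "\<ominus>\<^bsub>U\<^esub> x \<in> ideal_smult I U"
proof -
  interpret U: left_module A U by fact
  show ?thesis
    using ideal_smult_smult[OF assms(1) _ assms(2), of "\<ominus>\<^bsub>A\<^esub> \<one>\<^bsub>A\<^esub>"]
      U.smult_minus_one[OF ideal_smult_closed[OF assms]] by simp
qed

lemma ideal_smult_lin_hom:
  assumes "left_module A U" "left_module A V" "f \<in> lin_hom A U V" "x \<in> ideal_smult I U"
  shows "f x \<in> ideal_smult I V"
proof -
  interpret U: left_module A U by fact
  show ?thesis using assms(4)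
  proof induction
    case zero then show ?case using lin_hom_zero[OF assms(1-3)] ideal_smult.zero[of V I] by simp
  next
    case (add i u x)
    then show ?case
      using lin_homD[OF assms(3)] ideal_smult_closed[OF assms(1)] ideal_closed
      by (auto intro: ideal_smult.add)
  qed
qed

lemma ideal_smult_annihilated:
  assumes "left_module A U" "\<And>i u. \<lbrakk>i \<in> I; u \<in> carrier U\<rbrakk> \<Longrightarrow> i \<odot>\<^bsub>U\<^esub> u = \<zero>\<^bsub>U\<^esub>"
    and "x \<in> ideal_smult I U"
  shows "x = \<zero>\<^bsub>U\<^esub>"
proof -
  interpret U: left_module A U by fact
  show ?thesis using assms(3) by induction (use assms(2) in auto)
qed

lemma ideal_smult_copower:
  assumes "left_module A Q" "g \<in> carrier (copower Q)" "\<And>x. g x \<in> ideal_smult I Q"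
  shows "g \<in> ideal_smult I (copower Q)"
  using assms(1,2)
proof (induction rule: copower_induct)
  case zero show ?case by (rule ideal_smult.zero)
next
  case (single x)
  show ?case
    by (rule ideal_smult_lin_hom[OF assms(1) copower_left_module[OF assms(1)]
          copower_single_lin_hom[OF assms(1)] assms(3)])
next
  case (add h k) then show ?case by (intro ideal_smult_add copower_left_module assms(1))
qed

end

text \<open>The complex of the submodules \<open>I C\<^sub>k\<close> is exact in degree \<open>n\<close>. For a resolution of a module
  killed by \<open>I\<close> this is equivalent to exactness of \<open>A/I \<otimes>\<^sub>A C = C / I C\<close> in degree \<open>n + 1\<close>, by the
  long exact sequence of \<open>I C \<rightarrow> C \<rightarrow> C / I C\<close>; the two directions are in
  \<open>rel_Tor_ideal_acyclic\<close> and \<open>quotient_cycles\<close>.\<close>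

definition ideal_acyclic ::
    "'a set \<Rightarrow> ('n, 'y) ring_scheme \<Rightarrow> (nat \<Rightarrow> ('a, 'c, 'z) module_scheme) \<Rightarrow> (nat \<Rightarrow> 'c \<Rightarrow> 'c) \<Rightarrow>
     ('c \<Rightarrow> 'n) \<Rightarrow> nat \<Rightarrow> bool"
  where "ideal_acyclic I N C d e n \<longleftrightarrow>
    ideal_smult I (C n) \<inter> cycles N C d e n \<subseteq> d n ` ideal_smult I (C (Suc n))"

definition annihilates :: "'a set \<Rightarrow> ('a, 'u, 'z) module_scheme \<Rightarrow> bool" where
  "annihilates I U \<longleftrightarrow> (\<forall>i\<in>I. \<forall>u\<in>carrier U. i \<odot>\<^bsub>U\<^esub> u = \<zero>\<^bsub>U\<^esub>)"

lemma annihilates_ideal_smult: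
  assumes "ideal I A" "left_module A U" "annihilates I U" "x \<in> ideal_smult I U"
  shows "x = \<zero>\<^bsub>U\<^esub>"
  using ideal_smult_annihilated[OF assms(1,2) _ assms(4)] assms(3) by (auto simp: annihilates_def)

subsection \<open>The module \<open>A/I\<close>\<close>

lemma quot_left_simps [simp]:
  "carrier (quot_left A I) = a_rcosets\<^bsub>A\<^esub> I" "\<zero>\<^bsub>quot_left A I\<^esub> = I"
  "x \<oplus>\<^bsub>quot_left A I\<^esub> y = x <+>\<^bsub>A\<^esub> y"
  "a \<odot>\<^bsub>quot_left A I\<^esub> x = rcoset_mult A I (I +>\<^bsub>A\<^esub> a) x"
  by (simp_all add: quot_left_def inflate_def restrict_scalars_def left_regular_def FactRing_def)

text \<open>The action of a coset through one of its representatives. On a module that \<open>I\<close> annihilates the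
  choice does not matter, and \<open>coset_action A I U u\<close> is the map \<open>A/I \<rightarrow> U\<close> with \<open>1 \<mapsto> u\<close>.\<close>

definition coset_action :: "('a, 'w) ring_scheme \<Rightarrow> 'a set \<Rightarrow> ('a, 'u, 'z) module_scheme \<Rightarrow> 'u \<Rightarrow> 'a set \<Rightarrow> 'u"
  where "coset_action A I U u b = (SOME a. a \<in> carrier A \<and> b = I +>\<^bsub>A\<^esub> a) \<odot>\<^bsub>U\<^esub> u"

context
  fixes A :: "('a, 'w) ring_scheme" and I :: "'a set" and U :: "('a, 'u, 'z) module_scheme" and u
  assumes I: "ideal I A" and U: "left_module A U" and ann: "annihilates I U" and u: "u \<in> carrier U"
begin

interpretation I: ideal I A by (rule I)
interpretation U: left_module A U by (rule U)

lemma coset_action_coset: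
  assumes a: "a \<in> carrier A" shows "coset_action A I U u (I +>\<^bsub>A\<^esub> a) = a \<odot>\<^bsub>U\<^esub> u"
proof -
  define b where "b = (SOME b. b \<in> carrier A \<and> I +>\<^bsub>A\<^esub> a = I +>\<^bsub>A\<^esub> b)"
  have b: "b \<in> carrier A" "I +>\<^bsub>A\<^esub> a = I +>\<^bsub>A\<^esub> b"
    using someI[of "\<lambda>b. b \<in> carrier A \<and> I +>\<^bsub>A\<^esub> a = I +>\<^bsub>A\<^esub> b" a] a by (auto simp: b_def)
  have "b \<ominus>\<^bsub>A\<^esub> a \<in> I" using I.quotient_eq_iff_same_a_r_cos[OF I b(1) a] b(2) by simp
  then have "(b \<ominus>\<^bsub>A\<^esub> a) \<odot>\<^bsub>U\<^esub> u = \<zero>\<^bsub>U\<^esub>" using ann u by (simp add: annihilates_def)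
  moreover have "b \<odot>\<^bsub>U\<^esub> u = (b \<ominus>\<^bsub>A\<^esub> a) \<odot>\<^bsub>U\<^esub> u \<oplus>\<^bsub>U\<^esub> a \<odot>\<^bsub>U\<^esub> u"
  proof -
    have "b = (b \<ominus>\<^bsub>A\<^esub> a) \<oplus>\<^bsub>A\<^esub> a" using a b(1) by (simp add: a_minus_def I.a_assoc I.l_neg)
    then show ?thesis using U.smult_l_distr[of "b \<ominus>\<^bsub>A\<^esub> a" a u] a b(1) u by simp
  qed
  ultimately show ?thesis using a u by (simp add: coset_action_def b_def)
qed

lemma coset_action_lin_hom: "coset_action A I U u \<in> lin_hom A (quot_left A I) U"
proof (rule lin_homI)
  fix x assume "x \<in> carrier (quot_left A I)"
  then obtain a where a: "a \<in> carrier A" "x = I +>\<^bsub>A\<^esub> a" by (auto simp: A_RCOSETS_def' )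
  show "coset_action A I U u x \<in> carrier U" using a u by (simp add: coset_action_coset)
  show "coset_action A I U u (b \<odot>\<^bsub>quot_left A I\<^esub> x) = b \<odot>\<^bsub>U\<^esub> coset_action A I U u x"
    if "b \<in> carrier A" for b
    using that a u by (simp add: I.rcoset_mult_add coset_action_coset U.smult_assoc1)
next
  fix x y assume "x \<in> carrier (quot_left A I)" "y \<in> carrier (quot_left A I)"
  then obtain a b where a: "a \<in> carrier A" "x = I +>\<^bsub>A\<^esub> a" and b: "b \<in> carrier A" "y = I +>\<^bsub>A\<^esub> b"
    by (auto simp: A_RCOSETS_def')
  show "coset_action A I U u (x \<oplus>\<^bsub>quot_left A I\<^esub> y) = coset_action A I U u x \<oplus>\<^bsub>U\<^esub> coset_action A I U u y"
    using a b u by (simp add: I.a_rcos_sum coset_action_coset U.smult_l_distr)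
qed

end

lemma coset_one_in_quot_left:
  assumes "ideal I A" shows "I +>\<^bsub>A\<^esub> \<one>\<^bsub>A\<^esub> \<in> carrier (quot_left A I)"
proof -
  interpret I: ideal I A by fact
  show ?thesis by (auto simp: A_RCOSETS_def')
qed

lemma annihilates_quot_left:
  assumes "ideal I A" shows "annihilates I (quot_left A I)"
proof -
  interpret I: ideal I A by fact
  have "rcoset_mult A I (I +>\<^bsub>A\<^esub> i) (I +>\<^bsub>A\<^esub> a) = I" if "i \<in> I" "a \<in> carrier A" for i a
    unfolding I.rcoset_mult_add[OF I.Icarr[OF that(1)] that(2)] I.a_rcos_const[OF I.I_r_closed[OF that]] ..
  then show ?thesis by (auto simp: annihilates_def A_RCOSETS_def')
qed

text \<open>The case of degree \<open>0\<close>: if \<open>A/I\<close> has a resolution that is acyclic modulo \<open>I\<close>, then for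
  \<open>c \<in> C\<^sub>0\<close> and \<open>i \<in> I\<close> the element \<open>i c\<close> is a boundary with a preimage in \<open>I C\<^sub>1\<close>: up to
  \<open>i d(c')\<close> it is the image of \<open>i u\<close> under a chain map from that resolution, where \<open>u\<close> lies over the
  unit of \<open>A/I\<close>.\<close>

lemma ideal_acyclic_zero:
  assumes I: "ideal I A" and C: "split_resolution R A N C d e \<sigma> s"
    and Q: "split_resolution R A (quot_left A I) Q dQ eQ \<sigma>Q sQ"
    and acyc: "ideal_acyclic I (quot_left A I) Q dQ eQ 0" and ann: "annihilates I N"
  shows "ideal_acyclic I N C d e 0"
proof -
  interpret C: split_resolution R A N C d e \<sigma> s by fact
  interpret Q: split_resolution R A "quot_left A I" Q dQ eQ \<sigma>Q sQ by fact
  interpret C0: left_module A "C 0" by (rule C.C)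
  interpret C1: left_module A "C (Suc 0)" by (rule C.C)
  interpret Q0: left_module A "Q 0" by (rule Q.C)
  define u where "u = \<sigma>Q (I +>\<^bsub>A\<^esub> \<one>\<^bsub>A\<^esub>)"
  have u: "u \<in> carrier (Q 0)" "eQ u = I +>\<^bsub>A\<^esub> \<one>\<^bsub>A\<^esub>"
    using coset_one_in_quot_left[OF I] Q.e_\<sigma> lin_homD(1)[OF Q.\<sigma>] by (simp_all add: u_def)
  \<comment> \<open>It suffices to treat the generators \<open>i c\<close> of \<open>I C\<^sub>0\<close>; the chain map depends on \<open>c\<close>.\<close>
  have main: "i \<odot>\<^bsub>C 0\<^esub> c \<in> d 0 ` ideal_smult I (C (Suc 0))" if i: "i \<in> I" and c: "c \<in> carrier (C 0)" for i c
  proof -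
    note iA = ideal_closed[OF I i] and ec = lin_homD(1)[OF C.e c]
    obtain \<phi> where \<phi>: "\<And>k. \<phi> k \<in> lin_hom A (Q k) (C k)"
      "\<And>q. q \<in> carrier (Q 0) \<Longrightarrow> e (\<phi> 0 q) = coset_action A I N (e c) (eQ q)"
      "\<And>k q. q \<in> carrier (Q (Suc k)) \<Longrightarrow> d k (\<phi> (Suc k) q) = \<phi> k (dQ k q)"
      using comparison_chain_map[OF C Q coset_action_lin_hom[OF I C.N ann ec]] by blast
    have "e (\<phi> 0 u) = e c"
      using \<phi>(2)[OF u(1)] u(2) coset_action_coset[OF I C.N ann ec C0.A.one_closed]
        left_module.smult_one[OF C.N ec] by simp
    then have "c \<ominus>\<^bsub>C 0\<^esub> \<phi> 0 u \<in> cycles N C d e 0"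
      using c lin_homD(1)[OF \<phi>(1) u(1)] lin_hom_diff[OF C.C C.N C.e c, of "\<phi> 0 u"]
        abelian_group.r_neg[OF left_moduleD(2)[OF C.N] ec]
      by (simp add: mod_ker_def) (simp add: a_minus_def)
    then obtain c1 where c1: "c1 \<in> carrier (C (Suc 0))" "d 0 c1 = c \<ominus>\<^bsub>C 0\<^esub> \<phi> 0 u"
      unfolding C.d_image[of 0, symmetric] by auto
    have iu: "i \<odot>\<^bsub>Q 0\<^esub> u \<in> ideal_smult I (Q 0)" by (rule ideal_smult_incl[OF I Q.C i u(1)])
    have "eQ (i \<odot>\<^bsub>Q 0\<^esub> u) = \<zero>\<^bsub>quot_left A I\<^esub>"
      by (rule annihilates_ideal_smult[OF I Q.N annihilates_quot_left[OF I]])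
        (rule ideal_smult_lin_hom[OF I Q.C Q.N Q.e iu])
    then obtain v where v: "v \<in> ideal_smult I (Q (Suc 0))" "dQ 0 v = i \<odot>\<^bsub>Q 0\<^esub> u"
      using acyc iu ideal_smult_closed[OF I Q.C iu] unfolding ideal_acyclic_def
      by (auto simp: mod_ker_def)
    note v' = ideal_smult_closed[OF I Q.C v(1)]
    have pv: "\<phi> (Suc 0) v \<in> ideal_smult I (C (Suc 0))"
      by (rule ideal_smult_lin_hom[OF I Q.C C.C \<phi>(1) v(1)])
    have w: "i \<odot>\<^bsub>C (Suc 0)\<^esub> c1 \<oplus>\<^bsub>C (Suc 0)\<^esub> \<phi> (Suc 0) v \<in> ideal_smult I (C (Suc 0))"
      by (rule ideal_smult.add[OF i c1(1) pv])
    have "d 0 (i \<odot>\<^bsub>C (Suc 0)\<^esub> c1 \<oplus>\<^bsub>C (Suc 0)\<^esub> \<phi> (Suc 0) v) =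
        i \<odot>\<^bsub>C 0\<^esub> (c \<ominus>\<^bsub>C 0\<^esub> \<phi> 0 u) \<oplus>\<^bsub>C 0\<^esub> i \<odot>\<^bsub>C 0\<^esub> \<phi> 0 u"
      using c1 iA lin_homD(1)[OF \<phi>(1) v'] \<phi>(3)[OF v'] v(2) u(1)
      by (simp add: lin_homD[OF C.d] lin_homD[OF \<phi>(1)])
    also have "\<dots> = i \<odot>\<^bsub>C 0\<^esub> (c \<ominus>\<^bsub>C 0\<^esub> \<phi> 0 u \<oplus>\<^bsub>C 0\<^esub> \<phi> 0 u)"
      using iA c lin_homD(1)[OF \<phi>(1) u(1)] by (simp add: C0.smult_r_distr)
    also have "c \<ominus>\<^bsub>C 0\<^esub> \<phi> 0 u \<oplus>\<^bsub>C 0\<^esub> \<phi> 0 u = c"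
      using c lin_homD(1)[OF \<phi>(1) u(1)] by (simp add: a_minus_def C0.M.a_assoc C0.M.l_neg)
    finally show ?thesis using w by (rule_tac image_eqI) auto
  qed
  have "z \<in> d 0 ` ideal_smult I (C (Suc 0))" if "z \<in> ideal_smult I (C 0)" for z
    using that
  proof induction
    case zero
    show ?case by (rule image_eqI[OF _ ideal_smult.zero]) (simp add: lin_hom_zero[OF C.C C.C C.d])
  next
    case (add i c x)
    obtain w where w: "w \<in> ideal_smult I (C (Suc 0))" "i \<odot>\<^bsub>C 0\<^esub> c = d 0 w"
      using main[OF add(1,2)] by blast
    obtain w' where w': "w' \<in> ideal_smult I (C (Suc 0))" "x = d 0 w'" using add.IH by blast
    show ?case
      by (rule image_eqI[OF _ ideal_smult_add[OF I C.C w(1) w'(1)]])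
        (simp add: w w' lin_homD(2)[OF C.d] ideal_smult_closed[OF I C.C])
  qed
  then show ?thesis by (auto simp: ideal_acyclic_def)
qed

section \<open>Copowers of resolutions\<close>

lemma copower_R_lin_hom:
  assumes "assoc_algebra R A" "left_module A U" "left_module A V"
    and "f \<in> lin_hom R (scalars A U) (scalars A V)"
  shows "(\<lambda>g x. f (g x)) \<in> lin_hom R (scalars A (copower U)) (scalars A (copower V))"
  unfolding scalars_copower
  by (rule copower_map_lin_hom[OF scalars_left_module[OF assms(1,2)] scalars_left_module[OF assms(1,3)] assms(4)])

lemma copower_split_resolution:
  assumes "split_resolution R A N C d e \<sigma> s"
  shows "split_resolution R A (copower N :: ('a, 'x \<Rightarrow> 'n) module) (\<lambda>k. copower (C k))
    (\<lambda>k g x. d k (g x)) (\<lambda>g x. e (g x)) (\<lambda>g x. \<sigma> (g x)) (\<lambda>k g x. s k (g x))"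
proof -
  interpret split_resolution R A N C d e \<sigma> s by fact
  have cyc: "(\<forall>x. g x \<in> cycles N C d e k) \<and> g \<in> carrier (copower (C k)) \<longleftrightarrow>
      g \<in> cycles (copower N :: ('a, 'x \<Rightarrow> 'n) module) (\<lambda>k. copower (C k))
        (\<lambda>k g x. d k (g x)) (\<lambda>g x. e (g x)) k" for g :: "'x \<Rightarrow> _" and k
    by (cases k) (auto simp: mod_ker_def fun_eq_iff)
  show ?thesis
  proof (rule split_resolution.intro)
    show "(\<lambda>x. d k (g x)) \<in> cycles (copower N :: ('a, 'x \<Rightarrow> 'n) module) (\<lambda>k. copower (C k))
        (\<lambda>k g x. d k (g x)) (\<lambda>g x. e (g x)) k"
      if "g \<in> carrier (copower (C (Suc k)))" for k and g :: "'x \<Rightarrow> _"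
      using that lin_homD(1)[OF copower_map_lin_hom[OF C C d] that] d_cycle
      unfolding cyc[symmetric] by simp
    show "(\<lambda>x. e (\<sigma> (g x))) = g" if "g \<in> carrier (copower N)" for g :: "'x \<Rightarrow> _"
      using that e_\<sigma> by (simp add: fun_eq_iff)
    show "(\<lambda>x. d k (s k (g x))) = g"
      if "g \<in> cycles (copower N :: ('a, 'x \<Rightarrow> 'n) module) (\<lambda>k. copower (C k))
        (\<lambda>k g x. d k (g x)) (\<lambda>g x. e (g x)) k" for k and g :: "'x \<Rightarrow> _"
      using that d_s unfolding cyc[symmetric] by (simp add: fun_eq_iff)
  qed (intro alg copower_left_module N rel_projective_copower rel_proj copower_map_lin_hom C e d
      copower_R_lin_hom \<sigma> s)+
qed

text \<open>Preimages are chosen componentwise. Choosing zero over zero keeps the support finite.\<close>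

lemma copower_ideal_acyclic:
  assumes I: "ideal I A" and C: "split_resolution R A N C d e \<sigma> s" and acyc: "ideal_acyclic I N C d e n"
  shows "ideal_acyclic I (copower N :: ('a, 'x \<Rightarrow> 'n) module) (\<lambda>k. copower (C k))
    (\<lambda>k g x. d k (g x)) (\<lambda>g x. e (g x)) n"
  unfolding ideal_acyclic_def
proof
  interpret split_resolution R A N C d e \<sigma> s by fact
  fix g :: "'x \<Rightarrow> _" assume "g \<in> ideal_smult I (copower (C n)) \<inter> cycles (copower N :: ('a, 'x \<Rightarrow> 'n) module)
     (\<lambda>k. copower (C k)) (\<lambda>k g x. d k (g x)) (\<lambda>g x. e (g x)) n"
  then have g: "g \<in> ideal_smult I (copower (C n))" and "\<And>x. g x \<in> cycles N C d e n"
    by (cases n; auto simp: mod_ker_def fun_eq_iff)+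
  moreover have "g x \<in> ideal_smult I (C n)" for x
    by (rule ideal_smult_lin_hom[OF I copower_left_module[OF C] C copower_eval_lin_hom g])
  ultimately have "g x \<in> d n ` ideal_smult I (C (Suc n))" for x
    using acyc unfolding ideal_acyclic_def by blast
  then have ex: "\<exists>w. w \<in> ideal_smult I (C (Suc n)) \<and> d n w = g x" for x
    by (metis imageE)
  have "\<exists>w. w \<in> ideal_smult I (C (Suc n)) \<and> d n w = g x \<and> (g x = \<zero>\<^bsub>C n\<^esub> \<longrightarrow> w = \<zero>\<^bsub>C (Suc n)\<^esub>)" for x
  proof (cases "g x = \<zero>\<^bsub>C n\<^esub>")
    case True
    then show ?thesis
      by (intro exI[of _ "\<zero>\<^bsub>C (Suc n)\<^esub>"]) (simp add: ideal_smult.zero lin_hom_zero[OF C C d])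
  qed (use ex in blast)
  then obtain w where w: "\<And>x. w x \<in> ideal_smult I (C (Suc n))" "\<And>x. d n (w x) = g x"
      "\<And>x. g x = \<zero>\<^bsub>C n\<^esub> \<Longrightarrow> w x = \<zero>\<^bsub>C (Suc n)\<^esub>"
    by metis
  have "finite {x. g x \<noteq> \<zero>\<^bsub>C n\<^esub>}"
    using ideal_smult_closed[OF I copower_left_module[OF C] g] by simp
  then have "finite {x. w x \<noteq> \<zero>\<^bsub>C (Suc n)\<^esub>}" by (rule rev_finite_subset) (use w(3) in auto)
  then have "w \<in> carrier (copower (C (Suc n)))"
    using w(1) ideal_smult_closed[OF I C] by simp
  then have "w \<in> ideal_smult I (copower (C (Suc n)))"
    by (rule ideal_smult_copower[OF I C _ w(1)])
  then show "g \<in> (\<lambda>g x. d n (g x)) ` ideal_smult I (copower (C (Suc n)))"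
    by (rule rev_image_eqI) (simp add: w(2) fun_eq_iff)
qed


section \<open>Dimension shifting by a mapping cone\<close>

text \<open>A surjection \<open>\<pi>\<close> that splits over \<open>R\<close> and a chain map \<open>\<phi>\<close> over it give a resolution of the
  kernel \<open>K\<close> of \<open>\<pi>\<close>: the mapping cone of \<open>\<phi>\<close>, whose bottom map \<open>C\<^sub>1 \<times> D\<^sub>0 \<rightarrow> C\<^sub>0\<close> is a split
  surjection of \<open>A\<close>-modules and is replaced by its kernel. So \<open>cone k\<close> has components in
  \<open>C\<^sub>k\<^sub>+\<^sub>1\<close> and \<open>D\<^sub>k\<close>.\<close>

locale kernel_cone =
  C: split_resolution R A N C d e \<sigma> s + D: split_resolution R A L D dD eD \<sigma>D sD
  for R :: "('r, 'v) ring_scheme" and A :: "('r, 'a, 'w) module_scheme"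
    and N :: "('a, 'n, 'y) module_scheme" and C :: "nat \<Rightarrow> ('a, 'c, 'z) module_scheme" and d e \<sigma> s
    and L :: "('a, 'l, 'y2) module_scheme" and D :: "nat \<Rightarrow> ('a, 'd, 'z2) module_scheme" and dD eD \<sigma>D sD +
  fixes \<phi> :: "nat \<Rightarrow> 'd \<Rightarrow> 'c" and \<pi> :: "'l \<Rightarrow> 'n" and t :: "'n \<Rightarrow> 'l"
  assumes \<phi>: "\<And>k. \<phi> k \<in> lin_hom A (D k) (C k)" and \<pi>: "\<pi> \<in> lin_hom A L N"
    and e_\<phi>: "\<And>y. y \<in> carrier (D 0) \<Longrightarrow> e (\<phi> 0 y) = \<pi> (eD y)"
    and d_\<phi>: "\<And>k y. y \<in> carrier (D (Suc k)) \<Longrightarrow> d k (\<phi> (Suc k) y) = \<phi> k (dD k y)"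
    and t: "t \<in> lin_hom R (scalars A N) (scalars A L)" and \<pi>_t: "\<And>n. n \<in> carrier N \<Longrightarrow> \<pi> (t n) = n"
begin

definition total :: "nat \<Rightarrow> ('a, 'c \<times> 'd) module" where
  "total k = module_prod (C (Suc k)) (D k)"

definition bd :: "nat \<Rightarrow> 'c \<times> 'd \<Rightarrow> 'c" where
  "bd k z = d k (fst z) \<oplus>\<^bsub>C k\<^esub> \<phi> k (snd z)"

definition cone :: "nat \<Rightarrow> ('a, 'c \<times> 'd) module" where
  "cone k = (case k of 0 \<Rightarrow> ker_module (total 0) (C 0) (bd 0) | Suc j \<Rightarrow> total (Suc j))"

definition dcone :: "nat \<Rightarrow> 'c \<times> 'd \<Rightarrow> 'c \<times> 'd" where
  "dcone k z = (bd (Suc k) z, \<ominus>\<^bsub>D k\<^esub> dD k (snd z))"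

definition econe :: "'c \<times> 'd \<Rightarrow> 'l" where
  "econe z = eD (snd z)"

text \<open>A cycle \<open>(c, q)\<close> of the cone has \<open>dD q = 0\<close>, so \<open>y = sD q\<close> satisfies \<open>dD y = q\<close>; then
  \<open>c + \<phi> y\<close> is a cycle of \<open>C\<close> because \<open>d c + \<phi> q = 0\<close>, and \<open>(s (c + \<phi> y), - y)\<close> is a preimage of
  \<open>(c, q)\<close>.\<close>

definition scone :: "nat \<Rightarrow> 'c \<times> 'd \<Rightarrow> 'c \<times> 'd" where
  "scone k z = (s (Suc k) (fst z \<oplus>\<^bsub>C (Suc k)\<^esub> \<phi> (Suc k) (sD k (snd z))), \<ominus>\<^bsub>D (Suc k)\<^esub> sD k (snd z))"

definition \<sigma>cone :: "'l \<Rightarrow> 'c \<times> 'd" where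
  "\<sigma>cone q = (\<ominus>\<^bsub>C (Suc 0)\<^esub> s 0 (\<phi> 0 (\<sigma>D q)), \<sigma>D q)"

abbreviation "K \<equiv> ker_module L N \<pi>"

lemma cone_simps: "cone 0 = ker_module (total 0) (C 0) (bd 0)" "cone (Suc j) = total (Suc j)"
  by (simp_all add: cone_def)

lemma total_module: "left_module A (total k)"
  unfolding total_def by (intro module_prod_left_module C.C D.C)

lemma carrier_total: "z \<in> carrier (total k) \<longleftrightarrow> fst z \<in> carrier (C (Suc k)) \<and> snd z \<in> carrier (D k)"
  by (cases z) (simp add: total_def)

lemma bd: "bd k \<in> lin_hom A (total k) (C k)"
  unfolding total_def bd_def
  by (rule lin_hom_add[OF C.C lin_hom_comp'[OF lin_hom_fst C.d] lin_hom_comp'[OF lin_hom_snd \<phi>]])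

lemma cone_module: "left_module A (cone k)"
  by (cases k) (simp_all add: cone_simps total_module ker_module[OF total_module C.C bd])

lemma K: "left_module A K"
  by (rule ker_module[OF D.N C.N \<pi>])

lemma RC: "left_module R (scalars A (C k))" by (rule scalars_left_module[OF C.alg C.C])
lemma RD: "left_module R (scalars A (D k))" by (rule scalars_left_module[OF C.alg D.C])
lemma R\<phi>: "\<phi> k \<in> lin_hom R (scalars A (D k)) (scalars A (C k))" by (rule lin_hom_scalars[OF C.alg \<phi>])
lemma Re: "e \<in> lin_hom R (scalars A (C 0)) (scalars A N)" by (rule lin_hom_scalars[OF C.alg C.e])

text \<open>To split \<open>C\<^sub>1 \<times> D\<^sub>0 \<rightarrow> C\<^sub>0\<close> over \<open>R\<close>, lift \<open>e c\<close> through \<open>\<pi>\<close> to \<open>D\<^sub>0\<close>; the image of this lift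
  differs from \<open>c\<close> by a boundary.\<close>

lemma bd_section_R:
  defines "\<psi> \<equiv> \<lambda>c. (s 0 (c \<ominus>\<^bsub>C 0\<^esub> \<phi> 0 (\<sigma>D (t (e c)))), \<sigma>D (t (e c)))"
  shows "\<psi> \<in> lin_hom R (scalars A (C 0)) (scalars A (total 0))"
    and "\<And>c. c \<in> carrier (C 0) \<Longrightarrow> bd 0 (\<psi> c) = c"
proof -
  interpret C0: left_module A "C 0" by (rule C.C)
  have u: "(\<lambda>c. \<sigma>D (t (e c))) \<in> lin_hom R (scalars A (C 0)) (scalars A (D 0))"
    by (rule lin_hom_comp'[OF lin_hom_comp'[OF Re t] D.\<sigma>])
  have v: "(\<lambda>c. c \<ominus>\<^bsub>C 0\<^esub> \<phi> 0 (\<sigma>D (t (e c)))) \<in> lin_hom R (scalars A (C 0)) (scalars A (C 0))"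
    using lin_hom_sub[OF RC lin_hom_id lin_hom_comp'[OF u R\<phi>]] by simp
  show "\<psi> \<in> lin_hom R (scalars A (C 0)) (scalars A (total 0))"
    unfolding \<psi>_def total_def scalars_module_prod
    by (rule lin_hom_Pair[OF lin_hom_comp'[OF v C.s] u])
  fix c assume c: "c \<in> carrier (C 0)"
  note ec = lin_homD(1)[OF C.e c]
  have tec: "t (e c) \<in> carrier L" using lin_homD(1)[OF t, of "e c"] ec by simp
  have uc: "\<sigma>D (t (e c)) \<in> carrier (D 0)" using lin_homD(1)[OF u, of c] c by simp
  note pc = lin_homD(1)[OF \<phi> uc]
  have "e (\<phi> 0 (\<sigma>D (t (e c)))) = e c"
    using uc ec tec by (simp add: e_\<phi> D.e_\<sigma> \<pi>_t)
  then have "c \<ominus>\<^bsub>C 0\<^esub> \<phi> 0 (\<sigma>D (t (e c))) \<in> cycles N C d e 0"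
    using c pc ec abelian_group.r_neg[OF left_moduleD(2)[OF C.N]]
    by (simp add: mod_ker_def lin_hom_diff[OF C.C C.N C.e]) (simp add: a_minus_def)
  then have "d 0 (s 0 (c \<ominus>\<^bsub>C 0\<^esub> \<phi> 0 (\<sigma>D (t (e c))))) = c \<ominus>\<^bsub>C 0\<^esub> \<phi> 0 (\<sigma>D (t (e c)))"
    by (rule C.d_s)
  then show "bd 0 (\<psi> c) = c"
    using c pc by (simp add: \<psi>_def bd_def a_minus_def C0.M.a_assoc C0.M.l_neg)
qed

text \<open>The section over \<open>R\<close> can be replaced by one over \<open>A\<close>, because \<open>C\<^sub>0\<close> is relatively projective.\<close>

lemma bd_section: "\<exists>\<Psi> \<in> lin_hom A (C 0) (total 0). \<forall>c\<in>carrier (C 0). bd 0 (\<Psi> c) = c"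
proof (rule rel_projective_lift[OF C.alg C.rel_proj total_module C.C bd _ bd_section_R lin_hom_id])
  show "bd 0 ` carrier (total 0) = carrier (C 0)"
    using lin_homD(1)[OF bd[of 0]] lin_homD(1)[OF bd_section_R(1)] bd_section_R(2)
    by (force simp: image_def)
qed auto

lemma cone_retraction:
  obtains \<rho> where "\<rho> \<in> lin_hom A (total 0) (cone 0)" "\<And>z. z \<in> carrier (cone 0) \<Longrightarrow> \<rho> z = z"
proof -
  obtain \<Psi> where \<Psi>: "\<Psi> \<in> lin_hom A (C 0) (total 0)" "\<And>c. c \<in> carrier (C 0) \<Longrightarrow> bd 0 (\<Psi> c) = c"
    using bd_section by blast
  show ?thesis
    by (rule that[of "\<lambda>z. z \<ominus>\<^bsub>total 0\<^esub> \<Psi> (bd 0 z)"])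
      (use kernel_retraction[OF total_module C.C bd \<Psi>] in \<open>simp_all add: cone_simps\<close>)
qed

lemma cone_rel_projective: "rel_projective R A (cone k)"
proof (cases k)
  case 0
  obtain \<rho> where \<rho>: "\<rho> \<in> lin_hom A (total 0) (cone 0)" "\<And>z. z \<in> carrier (cone 0) \<Longrightarrow> \<rho> z = z"
    by (rule cone_retraction) blast
  have "rel_projective R A (total 0)"
    unfolding total_def by (intro rel_projective_prod C.alg C.rel_proj D.rel_proj)
  from rel_projective_retract[OF C.alg this cone_module _ \<rho>(1,2)]
  show ?thesis using kernel_inclusion[of A "total 0" "C 0" "bd 0"] 0 by (simp add: cone_simps)
next
  case (Suc j)
  then show ?thesis
    unfolding Suc cone_simps total_def by (intro rel_projective_prod C.alg C.rel_proj D.rel_proj)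
qed

lemma cone_cycle_iff:
  "z \<in> cycles K cone dcone econe k \<longleftrightarrow>
    z \<in> carrier (total k) \<and> bd k z = \<zero>\<^bsub>C k\<^esub> \<and> snd z \<in> cycles L D dD eD k"
proof (cases k)
  case 0
  then show ?thesis by (auto simp: cone_simps mod_ker_def econe_def carrier_total)
next
  case (Suc j)
  interpret Dj: left_module A "D j" by (rule D.C)
  have "\<ominus>\<^bsub>D j\<^esub> y = \<zero>\<^bsub>D j\<^esub> \<longleftrightarrow> y = \<zero>\<^bsub>D j\<^esub>" if "y \<in> carrier (D j)" for y
    using that by (rule Dj.M.add.inv_eq_1_iff)
  moreover have "\<zero>\<^bsub>cone j\<^esub> = (\<zero>\<^bsub>C (Suc j)\<^esub>, \<zero>\<^bsub>D j\<^esub>)"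
    by (cases j) (simp_all add: cone_simps total_def)
  ultimately show ?thesis
    using Suc lin_homD(1)[OF D.d[of j]]
    by (auto simp: cone_simps mod_ker_def dcone_def carrier_total)
qed

lemma cone_d_cycle:
  assumes z: "z \<in> carrier (cone (Suc k))"
  shows "dcone k z \<in> cycles K cone dcone econe k"
  unfolding cone_cycle_iff
proof (intro conjI)
  interpret Ck: left_module A "C k" by (rule C.C)
  have x: "fst z \<in> carrier (C (Suc (Suc k)))" and y: "snd z \<in> carrier (D (Suc k))"
    using z by (simp_all add: cone_simps carrier_total)
  note dx = lin_homD(1)[OF C.d x] and py = lin_homD(1)[OF \<phi> y] and dy = lin_homD(1)[OF D.d y]
  note pdy = lin_homD(1)[OF \<phi> dy]
  interpret Dk: left_module A "D k" by (rule D.C)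
  show "dcone k z \<in> carrier (total k)"
    using lin_homD(1)[OF bd, of z "Suc k"] z dy by (simp add: cone_simps dcone_def carrier_total)
  have "bd k (dcone k z) = d k (d (Suc k) (fst z)) \<oplus>\<^bsub>C k\<^esub> \<phi> k (dD k (snd z)) \<oplus>\<^bsub>C k\<^esub> \<ominus>\<^bsub>C k\<^esub> \<phi> k (dD k (snd z))"
    using dx py dy y by (simp add: bd_def dcone_def lin_homD(2)[OF C.d] d_\<phi> lin_hom_uminus[OF D.C C.C \<phi>])
  then show "bd k (dcone k z) = \<zero>\<^bsub>C k\<^esub>"
    using pdy x by (simp add: C.d_d Ck.M.r_neg)
  interpret Dk1: left_module A "D (Suc k)" by (rule D.C)
  have "dD k (\<ominus>\<^bsub>D (Suc k)\<^esub> snd z) = \<ominus>\<^bsub>D k\<^esub> dD k (snd z)" by (rule lin_hom_uminus[OF D.C D.C D.d y])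
  then show "snd (dcone k z) \<in> cycles L D dD eD k"
    using D.d_cycle[of "\<ominus>\<^bsub>D (Suc k)\<^esub> snd z" k] y by (simp add: dcone_def)
qed

lemma cone_d_s:
  assumes z: "z \<in> cycles K cone dcone econe k"
  shows "dcone k (scone k z) = z"
proof -
  interpret Ck1: left_module A "C (Suc k)" by (rule C.C)
  interpret Dk: left_module A "D k" by (rule D.C)
  interpret Dk1: left_module A "D (Suc k)" by (rule D.C)
  obtain c q where zcq: "z = (c, q)" by (cases z)
  have c: "c \<in> carrier (C (Suc k))" and q: "q \<in> carrier (D k)" and q': "q \<in> cycles L D dD eD k"
    and bz: "d k c \<oplus>\<^bsub>C k\<^esub> \<phi> k q = \<zero>\<^bsub>C k\<^esub>"
    using z unfolding cone_cycle_iff zcq by (simp_all add: carrier_total bd_def)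
  have y: "sD k q \<in> carrier (D (Suc k))" using lin_homD(1)[OF D.s, of q k] q by simp
  note dy = D.d_s[OF q'] and py = lin_homD(1)[OF \<phi> y]
  define w where "w = c \<oplus>\<^bsub>C (Suc k)\<^esub> \<phi> (Suc k) (sD k q)"
  have "d k w = \<zero>\<^bsub>C k\<^esub>"
    using c py y bz by (simp add: w_def lin_homD(2)[OF C.d] d_\<phi> dy)
  then have w: "d (Suc k) (s (Suc k) w) = w"
    by (intro C.d_s) (use c py in \<open>simp add: mod_ker_def w_def\<close>)
  have "w \<oplus>\<^bsub>C (Suc k)\<^esub> \<phi> (Suc k) (\<ominus>\<^bsub>D (Suc k)\<^esub> sD k q) = c"
    using c py y by (simp add: w_def lin_hom_uminus[OF D.C C.C \<phi>] Ck1.M.a_assoc Ck1.M.r_neg)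
  moreover have "\<ominus>\<^bsub>D k\<^esub> dD k (\<ominus>\<^bsub>D (Suc k)\<^esub> sD k q) = q"
    using y dy q by (simp add: lin_hom_uminus[OF D.C D.C D.d])
  ultimately show ?thesis
    using w by (simp add: zcq dcone_def scone_def bd_def flip: w_def)
qed

lemma cone_split_resolution: "split_resolution R A K cone dcone econe \<sigma>cone scone"
proof (rule split_resolution.intro)
  show "econe \<in> lin_hom A (cone 0) K"
  proof -
    have "econe \<in> lin_hom A (total 0) L"
      unfolding total_def econe_def by (rule lin_hom_comp'[OF lin_hom_snd D.e])
    moreover have "econe z \<in> carrier K" if z: "z \<in> carrier (cone 0)" for z
    proof -
      have x: "fst z \<in> carrier (C (Suc 0))" and y: "snd z \<in> carrier (D 0)" and b: "bd 0 z = \<zero>\<^bsub>C 0\<^esub>"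
        using z by (auto simp: cone_simps mod_ker_def carrier_total)
      have "\<pi> (eD (snd z)) = \<zero>\<^bsub>N\<^esub> \<oplus>\<^bsub>N\<^esub> e (\<phi> 0 (snd z))"
        using y lin_homD(1)[OF C.e lin_homD(1)[OF \<phi> y]] abelian_monoid.l_zero[OF left_moduleD(3)[OF C.N]]
        by (simp add: e_\<phi>)
      also have "\<dots> = e (bd 0 z)"
        using lin_homD(2)[OF C.e lin_homD(1)[OF C.d x] lin_homD(1)[OF \<phi> y]] x by (simp add: bd_def C.e_d)
      also have "\<dots> = \<zero>\<^bsub>N\<^esub>" by (simp add: b lin_hom_zero[OF C.C C.N C.e])
      finally show ?thesis using lin_homD(1)[OF D.e y] by (simp add: mod_ker_def econe_def)
    qed
    ultimately show ?thesis by (auto simp: lin_hom_def cone_simps mod_ker_def)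
  qed
  show "dcone k \<in> lin_hom A (cone (Suc k)) (cone k)" for k
  proof -
    have "(\<lambda>z. \<ominus>\<^bsub>D k\<^esub> dD k (snd z)) \<in> lin_hom A (total (Suc k)) (D k)"
      unfolding total_def by (rule lin_hom_neg[OF D.C lin_hom_comp'[OF lin_hom_snd D.d]])
    then have "dcone k \<in> lin_hom A (total (Suc k)) (total k)"
      unfolding dcone_def total_def[of k] by (rule lin_hom_Pair[OF bd])
    moreover have "dcone k z \<in> carrier (cone k)" if "z \<in> carrier (cone (Suc k))" for z
      using cone_d_cycle[OF that] by (cases k) (simp_all add: mod_ker_def)
    ultimately show ?thesis
      by (cases k) (auto simp: lin_hom_def cone_simps)
  qed
  show "\<sigma>cone \<in> lin_hom R (scalars A K) (scalars A (cone 0))"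
  proof -
    have "(\<lambda>q. \<ominus>\<^bsub>C (Suc 0)\<^esub> s 0 (\<phi> 0 (\<sigma>D q))) \<in> lin_hom R (scalars A L) (scalars A (C (Suc 0)))"
      using lin_hom_neg[OF RC lin_hom_comp'[OF lin_hom_comp'[OF D.\<sigma> R\<phi>] C.s]] by simp
    then have "\<sigma>cone \<in> lin_hom R (scalars A L) (scalars A (total 0))"
      unfolding \<sigma>cone_def total_def scalars_module_prod by (rule lin_hom_Pair[OF _ D.\<sigma>])
    moreover have "\<sigma>cone q \<in> carrier (cone 0)" if q: "q \<in> carrier K" for q
    proof -
      interpret C0: left_module A "C 0" by (rule C.C)
      interpret C1: left_module A "C (Suc 0)" by (rule C.C)
      have qL: "q \<in> carrier L" and pq: "\<pi> q = \<zero>\<^bsub>N\<^esub>" using q by (auto simp: mod_ker_def)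
      have sq: "\<sigma>D q \<in> carrier (D 0)" using lin_homD(1)[OF D.\<sigma>, of q] qL by simp
      note psq = lin_homD(1)[OF \<phi> sq]
      have "\<phi> 0 (\<sigma>D q) \<in> cycles N C d e 0"
        using psq sq qL pq by (simp add: mod_ker_def e_\<phi> D.e_\<sigma>)
      from C.d_s[OF this] lin_homD(1)[OF C.s, of "\<phi> 0 (\<sigma>D q)" 0] psq sq
      show ?thesis
        by (simp add: cone_simps mod_ker_def carrier_total \<sigma>cone_def bd_def
            lin_hom_uminus[OF C.C C.C C.d] C0.M.l_neg)
    qed
    ultimately show ?thesis by (auto simp: lin_hom_def cone_simps mod_ker_def)
  qed
  show "scone k \<in> lin_hom R (scalars A (cone k)) (scalars A (cone (Suc k)))" for k
  proof -
    have y: "(\<lambda>z. sD k (snd z)) \<in> lin_hom R (scalars A (total k)) (scalars A (D (Suc k)))"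
      unfolding total_def scalars_module_prod by (rule lin_hom_comp'[OF lin_hom_snd D.s])
    have x: "fst \<in> lin_hom R (scalars A (total k)) (scalars A (C (Suc k)))"
      unfolding total_def scalars_module_prod by (rule lin_hom_fst)
    have "(\<lambda>z. s (Suc k) (fst z \<oplus>\<^bsub>C (Suc k)\<^esub> \<phi> (Suc k) (sD k (snd z))))
        \<in> lin_hom R (scalars A (total k)) (scalars A (C (Suc (Suc k))))"
      using lin_hom_comp'[OF lin_hom_add[OF RC x lin_hom_comp'[OF y R\<phi>]] C.s] by simp
    moreover have "(\<lambda>z. \<ominus>\<^bsub>D (Suc k)\<^esub> sD k (snd z)) \<in> lin_hom R (scalars A (total k)) (scalars A (D (Suc k)))"
      using lin_hom_neg[OF RD y] by simp
    ultimately have "scone k \<in> lin_hom R (scalars A (total k)) (scalars A (total (Suc k)))"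
      unfolding scone_def total_def[of "Suc k"] scalars_module_prod by (rule lin_hom_Pair)
    then show ?thesis
      by (cases k) (auto simp: lin_hom_def cone_simps mod_ker_def)
  qed
  show "econe (\<sigma>cone n) = n" if "n \<in> carrier K" for n
    using that by (auto simp: econe_def \<sigma>cone_def mod_ker_def D.e_\<sigma>)
qed (simp_all add: C.alg K cone_rel_projective cone_d_cycle cone_d_s)

text \<open>For a cycle \<open>z\<close> in \<open>I C\<^sub>n\<^sub>+\<^sub>1\<close> the pair \<open>(z, 0)\<close> is a cycle in \<open>I\<close> times the cone, hence
  \<open>z = d w + \<phi> v\<close> with a cycle \<open>v\<close> in \<open>I D\<^sub>n\<^sub>+\<^sub>1\<close>. Since \<open>D\<close> is acyclic modulo \<open>I\<close>, \<open>v\<close> is a boundary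
  of some \<open>v'\<close> there, and \<open>z = d (w + \<phi> v')\<close>.\<close>

lemma cone_ideal_acyclic:
  assumes I: "ideal I A" and cone: "ideal_acyclic I K cone dcone econe n"
    and D: "ideal_acyclic I L D dD eD (Suc n)"
  shows "ideal_acyclic I N C d e (Suc n)"
  unfolding ideal_acyclic_def
proof
  fix z assume "z \<in> ideal_smult I (C (Suc n)) \<inter> cycles N C d e (Suc n)"
  then have z: "z \<in> ideal_smult I (C (Suc n))" and dz: "d n z = \<zero>\<^bsub>C n\<^esub>" and zC: "z \<in> carrier (C (Suc n))"
    by (auto simp: mod_ker_def)
  interpret Cn: left_module A "C n" by (rule C.C)
  interpret Dn: left_module A "D n" by (rule D.C)
  have "(\<lambda>x. (x, \<zero>\<^bsub>D n\<^esub>)) \<in> lin_hom A (C (Suc n)) (total n)"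
    unfolding total_def by (rule lin_hom_Pair[OF lin_hom_id lin_hom_const_zero[OF D.C]])
  from ideal_smult_lin_hom[OF I C.C total_module this z]
  have zt: "(z, \<zero>\<^bsub>D n\<^esub>) \<in> ideal_smult I (total n)" .
  have z0: "\<zero>\<^bsub>D n\<^esub> \<in> cycles L D dD eD n"
    by (cases n) (simp_all add: mod_ker_def abelian_monoid.zero_closed[OF left_moduleD(3)[OF D.C]]
        lin_hom_zero[OF D.C D.N D.e] lin_hom_zero[OF D.C D.C D.d])
  then have cyc: "(z, \<zero>\<^bsub>D n\<^esub>) \<in> cycles K cone dcone econe n"
    unfolding cone_cycle_iff
    using zC dz by (simp add: carrier_total bd_def lin_hom_zero[OF D.C C.C \<phi>])
  have "(z, \<zero>\<^bsub>D n\<^esub>) \<in> ideal_smult I (cone n)"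
  proof (cases n)
    case 0
    \<comment> \<open>Only because the kernel is a direct summand over \<open>A\<close> does an element of the kernel that lies
      in \<open>I (C\<^sub>1 \<times> D\<^sub>0)\<close> lie in \<open>I\<close> times the kernel.\<close>
    obtain \<rho> where \<rho>: "\<rho> \<in> lin_hom A (total 0) (cone 0)" "\<And>z. z \<in> carrier (cone 0) \<Longrightarrow> \<rho> z = z"
      by (rule cone_retraction) blast
    have "\<rho> (z, \<zero>\<^bsub>D n\<^esub>) = (z, \<zero>\<^bsub>D n\<^esub>)"
      using cyc 0 by (intro \<rho>(2)) (simp add: mod_ker_def)
    then show ?thesis using ideal_smult_lin_hom[OF I total_module cone_module \<rho>(1)] zt 0 by metis
  next
    case (Suc j) then show ?thesis using zt by (simp add: cone_simps)
  qed
  then have "(z, \<zero>\<^bsub>D n\<^esub>) \<in> dcone n ` ideal_smult I (cone (Suc n))"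
    using cone cyc unfolding ideal_acyclic_def by blast
  then obtain y where y: "y \<in> ideal_smult I (total (Suc n))" "(z, \<zero>\<^bsub>D n\<^esub>) = dcone n y"
    by (auto simp: cone_simps)
  obtain w v where wv: "y = (w, v)" by (cases y)
  have "fst y \<in> ideal_smult I (C (Suc (Suc n)))" "snd y \<in> ideal_smult I (D (Suc n))"
    using ideal_smult_lin_hom[OF I total_module C.C _ y(1)] ideal_smult_lin_hom[OF I total_module D.C _ y(1)]
      lin_hom_fst lin_hom_snd unfolding total_def by blast+
  then have w: "w \<in> ideal_smult I (C (Suc (Suc n)))" and v: "v \<in> ideal_smult I (D (Suc n))"
    by (simp_all add: wv)
  note wC = ideal_smult_closed[OF I C.C w] and vD = ideal_smult_closed[OF I D.C v]
  have zeq: "z = d (Suc n) w \<oplus>\<^bsub>C (Suc n)\<^esub> \<phi> (Suc n) v" and "\<ominus>\<^bsub>D n\<^esub> dD n v = \<zero>\<^bsub>D n\<^esub>"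
    using y(2) by (simp_all add: wv dcone_def bd_def)
  then have "dD n v = \<zero>\<^bsub>D n\<^esub>"
    using Dn.M.add.inv_eq_1_iff[OF lin_homD(1)[OF D.d vD]] by simp
  then have "v \<in> dD (Suc n) ` ideal_smult I (D (Suc (Suc n)))"
    using D v vD unfolding ideal_acyclic_def by (auto simp: mod_ker_def)
  then obtain v' where v': "v' \<in> ideal_smult I (D (Suc (Suc n)))" "v = dD (Suc n) v'" by blast
  note v'D = ideal_smult_closed[OF I D.C v'(1)]
  have "w \<oplus>\<^bsub>C (Suc (Suc n))\<^esub> \<phi> (Suc (Suc n)) v' \<in> ideal_smult I (C (Suc (Suc n)))"
    by (rule ideal_smult_add[OF I C.C w ideal_smult_lin_hom[OF I D.C C.C \<phi> v'(1)]])
  moreover have "d (Suc n) (w \<oplus>\<^bsub>C (Suc (Suc n))\<^esub> \<phi> (Suc (Suc n)) v') = z"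
    using wC v'D lin_homD(1)[OF \<phi> v'D] by (simp add: lin_homD(2)[OF C.d] d_\<phi> zeq v'(2))
  ultimately show "z \<in> d (Suc n) ` ideal_smult I (C (Suc (Suc n)))" by blast
qed

end


section \<open>Acyclicity for all modules over \<open>A/I\<close>\<close>

lemma annihilates_copower:
  "annihilates I U \<Longrightarrow> annihilates I (copower U :: ('a, 'x \<Rightarrow> 'u) module)"
  by (auto simp: annihilates_def)

lemma annihilates_ker_module: "annihilates I U \<Longrightarrow> annihilates I (ker_module U V f)"
  by (auto simp: annihilates_def mod_ker_def)

text \<open>Every \<open>A/I\<close>-module \<open>N\<close> is a quotient of a copower of \<open>A/I\<close>, and the resolution of \<open>A/I\<close>
  maps to a resolution of \<open>N\<close> accordingly. The surjection splits over \<open>R\<close> if \<open>N\<close> is projective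
  over \<open>R\<close>.\<close>

lemma copower_kernel_cone:
  fixes N :: "('a, 'n, 'y) module_scheme" and Q :: "nat \<Rightarrow> ('a, 'q, 'u) module_scheme"
  assumes I: "ideal I A" and C: "split_resolution R A N C d e \<sigma> s"
    and Q: "split_resolution R A (quot_left A I) Q dQ eQ \<sigma>Q sQ"
    and ann: "annihilates I N" and N: "projective R (scalars A N)"
  obtains \<phi> \<pi> t where
    "kernel_cone R A N C d e \<sigma> s (copower (quot_left A I) :: ('a, 'n \<Rightarrow> 'a set) module)
      (\<lambda>k. copower (Q k)) (\<lambda>k g x. dQ k (g x)) (\<lambda>g x. eQ (g x)) (\<lambda>g x. \<sigma>Q (g x)) (\<lambda>k g x. sQ k (g x)) \<phi> \<pi> t"
proof -
  interpret C: split_resolution R A N C d e \<sigma> s by fact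
  interpret Q: split_resolution R A "quot_left A I" Q dQ eQ \<sigma>Q sQ by fact
  interpret N: left_module A N by (rule C.N)
  let ?L = "copower (quot_left A I) :: ('a, 'n \<Rightarrow> 'a set) module"
  have L: "left_module A ?L" by (rule copower_left_module[OF Q.N])
  define \<beta> where "\<beta> x = coset_action A I N (in_carrier N x)" for x
  have \<beta>: "\<beta> x \<in> lin_hom A (quot_left A I) N" for x
    unfolding \<beta>_def by (rule coset_action_lin_hom[OF I C.N ann in_carrier_closed[OF C.N]])
  define \<pi> :: "('n \<Rightarrow> 'a set) \<Rightarrow> 'n" where "\<pi> = copower_lift N \<beta>"
  have \<pi>: "\<pi> \<in> lin_hom A ?L N" unfolding \<pi>_def by (rule copower_lift_lin_hom[OF Q.N C.N \<beta>])
  have one: "I +>\<^bsub>A\<^esub> \<one>\<^bsub>A\<^esub> \<in> carrier (quot_left A I)" by (rule coset_one_in_quot_left[OF I])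
  have "x \<in> \<pi> ` carrier ?L" if x: "x \<in> carrier N" for x
  proof (rule image_eqI)
    show "copower_single (quot_left A I) x (I +>\<^bsub>A\<^esub> \<one>\<^bsub>A\<^esub>) \<in> carrier ?L"
      by (rule copower_single_closed[OF Q.N one])
    show "x = \<pi> (copower_single (quot_left A I) x (I +>\<^bsub>A\<^esub> \<one>\<^bsub>A\<^esub>))"
      unfolding \<pi>_def copower_lift_single[OF Q.N C.N \<beta> one]
      using coset_action_coset[OF I C.N ann x N.A.one_closed] x by (simp add: \<beta>_def in_carrier_def)
  qed
  then have "\<pi> ` carrier ?L = carrier N" using lin_homD(1)[OF \<pi>] by blast
  from split_surjection[OF C.alg L C.N \<pi> this N]
  obtain t where t: "t \<in> lin_hom R (scalars A N) (scalars A ?L)" "\<And>y. y \<in> carrier N \<Longrightarrow> \<pi> (t y) = y"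
    by blast
  have "\<forall>x. \<exists>\<psi>. (\<forall>k. \<psi> k \<in> lin_hom A (Q k) (C k)) \<and>
    (\<forall>q\<in>carrier (Q 0). e (\<psi> 0 q) = \<beta> x (eQ q)) \<and>
    (\<forall>k. \<forall>q\<in>carrier (Q (Suc k)). d k (\<psi> (Suc k) q) = \<psi> k (dQ k q))"
  proof
    fix x
    obtain \<psi> where "\<And>k. \<psi> k \<in> lin_hom A (Q k) (C k)"
        "\<And>q. q \<in> carrier (Q 0) \<Longrightarrow> e (\<psi> 0 q) = \<beta> x (eQ q)"
        "\<And>k q. q \<in> carrier (Q (Suc k)) \<Longrightarrow> d k (\<psi> (Suc k) q) = \<psi> k (dQ k q)"
      using comparison_chain_map[OF C Q \<beta>] by metis
    then show "\<exists>\<psi>. (\<forall>k. \<psi> k \<in> lin_hom A (Q k) (C k)) \<and>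
      (\<forall>q\<in>carrier (Q 0). e (\<psi> 0 q) = \<beta> x (eQ q)) \<and>
      (\<forall>k. \<forall>q\<in>carrier (Q (Suc k)). d k (\<psi> (Suc k) q) = \<psi> k (dQ k q))"
      by (intro exI[of _ \<psi>]) simp
  qed
  then obtain \<Psi> where \<Psi>: "\<forall>x. (\<forall>k. \<Psi> x k \<in> lin_hom A (Q k) (C k)) \<and>
      (\<forall>q\<in>carrier (Q 0). e (\<Psi> x 0 q) = \<beta> x (eQ q)) \<and>
      (\<forall>k. \<forall>q\<in>carrier (Q (Suc k)). d k (\<Psi> x (Suc k) q) = \<Psi> x k (dQ k q))"
    using choice[of "\<lambda>x \<psi>. (\<forall>k. \<psi> k \<in> lin_hom A (Q k) (C k)) \<and>
      (\<forall>q\<in>carrier (Q 0). e (\<psi> 0 q) = \<beta> x (eQ q)) \<and>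
      (\<forall>k. \<forall>q\<in>carrier (Q (Suc k)). d k (\<psi> (Suc k) q) = \<psi> k (dQ k q))"] by blast
  have \<Psi>1: "\<Psi> x k \<in> lin_hom A (Q k) (C k)" for x k using \<Psi> by simp
  define \<phi> where "\<phi> k = copower_lift (C k) (\<lambda>x. \<Psi> x k)" for k
  have \<phi>: "\<phi> k \<in> lin_hom A (copower (Q k)) (C k)" for k
    unfolding \<phi>_def by (rule copower_lift_lin_hom[OF Q.C C.C \<Psi>1])
  have \<phi>_single: "\<phi> k (copower_single (Q k) x q) = \<Psi> x k q" if "q \<in> carrier (Q k)" for k x q
    unfolding \<phi>_def by (rule copower_lift_single[OF Q.C C.C \<Psi>1 that])
  have "kernel_cone R A N C d e \<sigma> s ?L
      (\<lambda>k. copower (Q k)) (\<lambda>k g x. dQ k (g x)) (\<lambda>g x. eQ (g x)) (\<lambda>g x. \<sigma>Q (g x)) (\<lambda>k g x. sQ k (g x)) \<phi> \<pi> t"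
  proof (rule kernel_cone.intro[OF C copower_split_resolution[OF Q]], rule kernel_cone_axioms.intro)
    show "e (\<phi> 0 y) = \<pi> (\<lambda>x. eQ (y x))" if y: "y \<in> carrier (copower (Q 0))" for y
    proof (rule copower_hom_ext[OF Q.C C.N lin_hom_comp'[OF \<phi> C.e] _ _ y])
      show "(\<lambda>y. \<pi> (\<lambda>x. eQ (y x))) \<in> lin_hom A (copower (Q 0)) N"
        by (rule lin_hom_comp'[OF copower_map_lin_hom[OF Q.C Q.N Q.e] \<pi>])
      show "e (\<phi> 0 (copower_single (Q 0) x q)) = \<pi> (\<lambda>y. eQ (copower_single (Q 0) x q y))"
        if q: "q \<in> carrier (Q 0)" for x q
        unfolding \<phi>_single[OF q] copower_map_single[OF Q.C Q.N Q.e] \<pi>_def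
          copower_lift_single[OF Q.N C.N \<beta> lin_homD(1)[OF Q.e q]]
        using \<Psi> q by simp
    qed
    show "d k (\<phi> (Suc k) y) = \<phi> k (\<lambda>x. dQ k (y x))" if y: "y \<in> carrier (copower (Q (Suc k)))" for k y
    proof (rule copower_hom_ext[OF Q.C C.C lin_hom_comp'[OF \<phi> C.d] _ _ y])
      show "(\<lambda>y. \<phi> k (\<lambda>x. dQ k (y x))) \<in> lin_hom A (copower (Q (Suc k))) (C k)"
        by (rule lin_hom_comp'[OF copower_map_lin_hom[OF Q.C Q.C Q.d] \<phi>])
      show "d k (\<phi> (Suc k) (copower_single (Q (Suc k)) x q)) = \<phi> k (\<lambda>y. dQ k (copower_single (Q (Suc k)) x q y))"
        if q: "q \<in> carrier (Q (Suc k))" for x q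
        unfolding \<phi>_single[OF q] copower_map_single[OF Q.C Q.C Q.d] \<phi>_single[OF lin_homD(1)[OF Q.d q]]
        using \<Psi> q by simp
    qed
  qed (use \<phi> \<pi> t in auto)
  then show ?thesis by (rule that)
qed

text \<open>Everything that the induction on the degree uses about a resolution is invariant under renaming
  its elements. Dimension shifting enlarges the types of the elements, while an induction takes
  place in fixed types; renaming leads back to them.\<close>

lemma split_resolution_transport:
  fixes N :: "('a, 'n, 'y) module_scheme" and C :: "nat \<Rightarrow> ('a, 'c, 'z) module_scheme"
    and r :: "nat \<Rightarrow> 'c \<Rightarrow> 't" and rN :: "'n \<Rightarrow> 'u"
  assumes I: "ideal I A" and res: "split_resolution R A N C d e \<sigma> s"
    and r: "\<And>k. inj_on (r k) (carrier (C k))" and rN: "inj_on rN (carrier N)"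
  obtains N' :: "('a, 'u) module" and C' :: "nat \<Rightarrow> ('a, 't) module" and d' e' \<sigma>' s'
  where "split_resolution R A N' C' d' e' \<sigma>' s'"
    "annihilates I N \<Longrightarrow> annihilates I N'"
    "projective R (scalars A N) \<Longrightarrow> projective R (scalars A N')"
    "\<And>n. ideal_acyclic I N' C' d' e' n \<Longrightarrow> ideal_acyclic I N C d e n"
proof -
  interpret split_resolution R A N C d e \<sigma> s by fact
  obtain N' :: "('a, 'u) module" where N': "left_module A N'" "carrier N' = rN ` carrier N"
      "rN \<in> lin_hom A N N'" "inv_into (carrier N) rN \<in> lin_hom A N' N"
    using left_module_transport[OF N rN] by blast
  have "\<forall>k. \<exists>V :: ('a, 't) module. left_module A V \<and> carrier V = r k ` carrier (C k) \<and>
      r k \<in> lin_hom A (C k) V \<and> inv_into (carrier (C k)) (r k) \<in> lin_hom A V (C k)"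
    using left_module_transport[OF C r] by metis
  from choice[OF this] obtain C' :: "nat \<Rightarrow> ('a, 't) module" where
    C': "\<forall>k. left_module A (C' k) \<and> carrier (C' k) = r k ` carrier (C k) \<and>
      r k \<in> lin_hom A (C k) (C' k) \<and> inv_into (carrier (C k)) (r k) \<in> lin_hom A (C' k) (C k)" ..
  define j where "j k = inv_into (carrier (C k)) (r k)" for k
  define jN where "jN = inv_into (carrier N) rN"
  have C'm: "left_module A (C' k)" and rl: "r k \<in> lin_hom A (C k) (C' k)" and jl: "j k \<in> lin_hom A (C' k) (C k)" for k
    using C' by (auto simp: j_def)
  have jNl: "jN \<in> lin_hom A N' N" using N'(4) by (simp add: jN_def)
  have jr [simp]: "j k (r k x) = x" if "x \<in> carrier (C k)" for k x
    using r that by (simp add: j_def)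
  have rj [simp]: "r k (j k y) = y" if "y \<in> carrier (C' k)" for k y
    using that C' by (simp add: j_def f_inv_into_f)
  have jrN [simp]: "jN (rN x) = x" if "x \<in> carrier N" for x
    using rN that by (simp add: jN_def)
  have rjN [simp]: "rN (jN y) = y" if "y \<in> carrier N'" for y
    using that N'(2) by (simp add: jN_def f_inv_into_f)
  note cl [simp] = lin_homD(1)[OF rl] lin_homD(1)[OF jl] lin_homD(1)[OF N'(3)] lin_homD(1)[OF jNl]
    lin_homD(1)[OF e] lin_homD(1)[OF d]
  have \<sigma>cl [simp]: "x \<in> carrier N \<Longrightarrow> \<sigma> x \<in> carrier (C 0)" for x using lin_homD(1)[OF \<sigma>, of x] by simp
  have scl [simp]: "x \<in> carrier (C k) \<Longrightarrow> s k x \<in> carrier (C (Suc k))" for x k using lin_homD(1)[OF s, of x k] by simp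
  have r0: "r k x = \<zero>\<^bsub>C' k\<^esub> \<longleftrightarrow> x = \<zero>\<^bsub>C k\<^esub>" if "x \<in> carrier (C k)" for k x
    using jr[OF that] lin_hom_zero[OF C C'm rl] lin_hom_zero[OF C'm C jl] by metis
  have rN0: "rN x = \<zero>\<^bsub>N'\<^esub> \<longleftrightarrow> x = \<zero>\<^bsub>N\<^esub>" if "x \<in> carrier N" for x
    using jrN[OF that] lin_hom_zero[OF N N'(1) N'(3)] lin_hom_zero[OF N'(1) N jNl] by metis
  define d' where "d' k y = r k (d k (j (Suc k) y))" for k y
  define e' where "e' y = rN (e (j 0 y))" for y
  define \<sigma>' where "\<sigma>' n = r 0 (\<sigma> (jN n))" for n
  define s' where "s' k y = r (Suc k) (s k (j k y))" for k y
  have cyc: "y \<in> cycles N' C' d' e' k \<longleftrightarrow> y \<in> carrier (C' k) \<and> j k y \<in> cycles N C d e k" for y k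
    by (cases k) (simp_all add: mod_ker_def d'_def e'_def r0 rN0 cong: conj_cong)
  note Rl = lin_hom_scalars[OF alg]
  have res': "split_resolution R A N' C' d' e' \<sigma>' s'"
  proof (rule split_resolution.intro)
    show "rel_projective R A (C' k)" for k
      by (rule rel_projective_retract[OF alg rel_proj C'm jl rl]) simp
    show "e' \<in> lin_hom A (C' 0) N'"
      unfolding e'_def by (rule lin_hom_comp'[OF lin_hom_comp'[OF jl e] N'(3)])
    show "d' k \<in> lin_hom A (C' (Suc k)) (C' k)" for k
      unfolding d'_def by (rule lin_hom_comp'[OF lin_hom_comp'[OF jl d] rl])
    show "\<sigma>' \<in> lin_hom R (scalars A N') (scalars A (C' 0))"
      unfolding \<sigma>'_def by (rule lin_hom_comp'[OF lin_hom_comp'[OF Rl[OF jNl] \<sigma>] Rl[OF rl]])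
    show "s' k \<in> lin_hom R (scalars A (C' k)) (scalars A (C' (Suc k)))" for k
      unfolding s'_def by (rule lin_hom_comp'[OF lin_hom_comp'[OF Rl[OF jl] s] Rl[OF rl]])
    show "d' k x \<in> cycles N' C' d' e' k" if "x \<in> carrier (C' (Suc k))" for k x
      unfolding cyc using that d_cycle[of "j (Suc k) x" k] by (simp add: d'_def)
    show "e' (\<sigma>' n) = n" if "n \<in> carrier N'" for n
      using that by (simp add: e'_def \<sigma>'_def e_\<sigma>)
    show "d' k (s' k z) = z" if "z \<in> cycles N' C' d' e' k" for k z
      using that unfolding cyc by (simp add: d'_def s'_def d_s)
  qed (fact alg N'(1))+
  moreover have "annihilates I N'" if "annihilates I N"
    unfolding annihilates_def
  proof (intro ballI)
    fix i u assume i: "i \<in> I" and u: "u \<in> carrier N'"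
    have "jN (i \<odot>\<^bsub>N'\<^esub> u) = \<zero>\<^bsub>N\<^esub>"
      using that i u by (simp add: lin_homD(3)[OF jNl] ideal_closed[OF I] annihilates_def)
    then show "i \<odot>\<^bsub>N'\<^esub> u = \<zero>\<^bsub>N'\<^esub>"
      using rjN[OF left_module.smult_closed[OF N'(1) ideal_closed[OF I i] u]] lin_hom_zero[OF N N'(1) N'(3)]
      by simp
  qed
  moreover have "projective R (scalars A N')" if "projective R (scalars A N)"
    by (rule projective_retract[OF that scalars_left_module[OF alg N'(1)] Rl[OF jNl] Rl[OF N'(3)]]) simp
  moreover have "ideal_acyclic I N C d e n" if acyc: "ideal_acyclic I N' C' d' e' n" for n
    unfolding ideal_acyclic_def
  proof
    fix z assume z: "z \<in> ideal_smult I (C n) \<inter> cycles N C d e n"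
    then have zC: "z \<in> carrier (C n)" by (auto intro: cycles_carrier)
    have "r n z \<in> ideal_smult I (C' n)" using ideal_smult_lin_hom[OF I C C'm rl] z by blast
    moreover have "r n z \<in> cycles N' C' d' e' n" unfolding cyc using z zC by simp
    ultimately obtain w where w: "w \<in> ideal_smult I (C' (Suc n))" "r n z = d' n w"
      using acyc unfolding ideal_acyclic_def by blast
    have "z = j n (r n z)" using zC by simp
    also have "\<dots> = d n (j (Suc n) w)"
      using w(2) ideal_smult_closed[OF I C'm w(1)] by (simp add: d'_def)
    finally show "z \<in> d n ` ideal_smult I (C (Suc n))"
      using ideal_smult_lin_hom[OF I C'm C jl w(1)] by blast
  qed
  ultimately show ?thesis using that by blast
qed

text \<open>A list of the graph over the support determines a finitely supported function.\<close>

definition support_list :: "'v \<Rightarrow> ('x \<Rightarrow> 'v) \<Rightarrow> ('x \<times> 'v) list" where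
  "support_list z g = (SOME l. set l = {(x, g x) |x. g x \<noteq> z})"

lemma inj_on_support_list: "inj_on (support_list z) {g. finite {x. g x \<noteq> z}}"
proof (rule inj_onI)
  have set: "set (support_list z g) = {(x, g x) |x. g x \<noteq> z}" if "finite {x. g x \<noteq> z}" for g :: "'a \<Rightarrow> _"
  proof -
    have "finite {(x, g x) |x. g x \<noteq> z}" using that by simp
    then show ?thesis unfolding support_list_def by (rule someI_ex[OF finite_list])
  qed
  fix g h :: "'a \<Rightarrow> _" assume gh: "g \<in> {g. finite {x. g x \<noteq> z}}" "h \<in> {g. finite {x. g x \<noteq> z}}"
    "support_list z g = support_list z h"
  have eq: "{(x, g x) |x. g x \<noteq> z} = {(x, h x) |x. h x \<noteq> z}"
    using set[of g] set[of h] gh by (simp only: mem_Collect_eq)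
  show "g = h"
  proof
    fix x show "g x = h x" using eq by (cases "g x = z"; cases "h x = z") auto
  qed
qed

text \<open>Induction on the degree, by dimension shifting. The injections \<open>jc\<close> and \<open>jn\<close> say that the types
  \<open>'c\<close> and \<open>'n\<close> are large enough to hold the elements of the mapping cone and of the kernel.\<close>

lemma ideal_acyclic_coded:
  fixes jc :: "'c \<times> ('n \<times> 'q) list \<Rightarrow> 'c" and jn :: "('n \<times> 'a set) list \<Rightarrow> 'n"
    and Q :: "nat \<Rightarrow> ('a, 'q, 'u) module_scheme"
    and N :: "('a, 'n) module" and C :: "nat \<Rightarrow> ('a, 'c) module"
  assumes jc: "inj jc" and jn: "inj jn" and I: "ideal I A"
    and Q: "split_resolution R A (quot_left A I) Q dQ eQ \<sigma>Q sQ"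
    and acyc: "\<And>n. ideal_acyclic I (quot_left A I) Q dQ eQ n"
    and B: "projective R (scalars A (quot_left A I))"
    and C: "split_resolution R A N C d e \<sigma> s" and ann: "annihilates I N"
    and N: "projective R (scalars A N)"
  shows "ideal_acyclic I N C d e n"
  using C ann N
proof (induction n arbitrary: N C d e \<sigma> s)
  case 0
  then show ?case using ideal_acyclic_zero[OF I _ Q acyc] by blast
next
  case (Suc n)
  let ?L = "copower (quot_left A I) :: ('a, 'n \<Rightarrow> 'a set) module"
  obtain \<phi> \<pi> t where "kernel_cone R A N C d e \<sigma> s ?L (\<lambda>k. copower (Q k)) (\<lambda>k g x. dQ k (g x))
      (\<lambda>g x. eQ (g x)) (\<lambda>g x. \<sigma>Q (g x)) (\<lambda>k g x. sQ k (g x)) \<phi> \<pi> t"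
    using copower_kernel_cone[OF I Suc.prems(1) Q Suc.prems(2,3)] by metis
  then interpret kernel_cone R A N C d e \<sigma> s ?L "\<lambda>k. copower (Q k)" "\<lambda>k g x. dQ k (g x)"
      "\<lambda>g x. eQ (g x)" "\<lambda>g x. \<sigma>Q (g x)" "\<lambda>k g x. sQ k (g x)" \<phi> \<pi> t .
  define r where "r k z = jc (fst z, support_list \<zero>\<^bsub>Q k\<^esub> (snd z))" for k z
  have r: "inj_on (r k) (carrier (cone k))" for k
  proof (rule inj_onI)
    fix y z assume yz: "y \<in> carrier (cone k)" "z \<in> carrier (cone k)" and eq: "r k y = r k z"
    have fin: "snd x \<in> {g. finite {x. g x \<noteq> \<zero>\<^bsub>Q k\<^esub>}}" if "x \<in> carrier (cone k)" for x
    proof -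
      have "x \<in> carrier (total k)" using that by (cases k) (auto simp: cone_simps mod_ker_def)
      then show ?thesis by (simp add: carrier_total)
    qed
    have "fst y = fst z" "support_list \<zero>\<^bsub>Q k\<^esub> (snd y) = support_list \<zero>\<^bsub>Q k\<^esub> (snd z)"
      using injD[OF jc eq[unfolded r_def]] by auto
    then show "y = z" using inj_onD[OF inj_on_support_list _ fin[OF yz(1)] fin[OF yz(2)]] by (simp add: prod_eq_iff)
  qed
  have rN: "inj_on (jn \<circ> support_list I) (carrier K)"
  proof (rule comp_inj_on[OF inj_on_subset[OF inj_on_support_list] inj_on_subset[OF jn]])
    show "carrier K \<subseteq> {g. finite {x. g x \<noteq> I}}" by (auto simp: mod_ker_def)
  qed simp
  obtain N' :: "('a, 'n) module" and C' :: "nat \<Rightarrow> ('a, 'c) module" and d' e' \<sigma>' s'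
    where T: "split_resolution R A N' C' d' e' \<sigma>' s'" "annihilates I K \<Longrightarrow> annihilates I N'"
    "projective R (scalars A K) \<Longrightarrow> projective R (scalars A N')"
    "\<And>n. ideal_acyclic I N' C' d' e' n \<Longrightarrow> ideal_acyclic I K cone dcone econe n"
    by (rule split_resolution_transport[OF I cone_split_resolution r rN]) (rule that)
  have "projective R (scalars A ?L)" unfolding scalars_copower by (rule projective_copower[OF B])
  then have "projective R (scalars A K)"
    by (rule projective_kernel[OF C.alg D.N C.N \<pi> t, rotated]) (rule \<pi>_t)
  moreover have "annihilates I K"
    by (rule annihilates_ker_module[OF annihilates_copower[OF annihilates_quot_left[OF I]]])
  ultimately have "ideal_acyclic I K cone dcone econe n" using Suc.IH T by blast
  then show ?case by (rule cone_ideal_acyclic[OF I _ copower_ideal_acyclic[OF I Q acyc]])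
qed

text \<open>The closure of given types under the constructions of one step of the induction.\<close>

datatype ('m, 'b) kernel_code = Kernel_Base 'm | Kernel_Code "(('m, 'b) kernel_code \<times> 'b) list"

datatype ('c, 'n, 'q) cone_code = Cone_Base 'c | Cone_Code "('c, 'n, 'q) cone_code" "('n \<times> 'q) list"

text \<open>In terms of torsion groups: if \<open>Tor\<^sub>k(A/I, A/I) = 0\<close> for all \<open>k \<ge> 1\<close>, then
  \<open>Tor\<^sub>k(A/I, N) = 0\<close> for all \<open>k \<ge> 1\<close> and all \<open>A/I\<close>-modules \<open>N\<close> that are projective over \<open>R\<close>.\<close>

theorem ideal_acyclic_all:
  fixes N :: "('a, 'm, 'y) module_scheme" and C :: "nat \<Rightarrow> ('a, 'c, 'z) module_scheme"
    and Q :: "nat \<Rightarrow> ('a, 'q, 'u) module_scheme"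
  assumes I: "ideal I A"
    and Q: "split_resolution R A (quot_left A I) Q dQ eQ \<sigma>Q sQ"
    and acyc: "\<And>n. ideal_acyclic I (quot_left A I) Q dQ eQ n"
    and B: "projective R (scalars A (quot_left A I))"
    and C: "split_resolution R A N C d e \<sigma> s" and ann: "annihilates I N"
    and N: "projective R (scalars A N)"
  shows "ideal_acyclic I N C d e n"
proof -
  have cB: "inj_on (Cone_Base :: _ \<Rightarrow> ('c, ('m, 'a set) kernel_code, 'q) cone_code) (carrier (C k))" for k
    by (rule inj_onI) simp
  have kB: "inj_on (Kernel_Base :: _ \<Rightarrow> ('m, 'a set) kernel_code) (carrier N)"
    by (rule inj_onI) simp
  obtain N' :: "('a, ('m, 'a set) kernel_code) module"
      and C' :: "nat \<Rightarrow> ('a, ('c, ('m, 'a set) kernel_code, 'q) cone_code) module" and d' e' \<sigma>' s'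
    where T: "split_resolution R A N' C' d' e' \<sigma>' s'" "annihilates I N \<Longrightarrow> annihilates I N'"
    "projective R (scalars A N) \<Longrightarrow> projective R (scalars A N')"
    "\<And>n. ideal_acyclic I N' C' d' e' n \<Longrightarrow> ideal_acyclic I N C d e n"
    by (rule split_resolution_transport[OF I C cB kB]) (rule that)
  have "inj (\<lambda>(c, l). Cone_Code c l :: ('c, ('m, 'a set) kernel_code, 'q) cone_code)"
    "inj (Kernel_Code :: _ \<Rightarrow> ('m, 'a set) kernel_code)"
    by (auto simp: inj_def)
  from T(4)[OF ideal_acyclic_coded[OF this I Q acyc B T(1) T(2)[OF ann] T(3)[OF N]]]
  show ?thesis .
qed


section \<open>Tensor products\<close>

text \<open>The value of an integral combination of pairs under \<open>\<beta>\<close>; the map \<open>tensor_lift G \<beta>\<close> takes the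
  common value on a coset.\<close>

definition frag_eval :: "('g, 'z) ring_scheme \<Rightarrow> ('n \<Rightarrow> 'm \<Rightarrow> 'g) \<Rightarrow> (('n \<times> 'm) \<Rightarrow>\<^sub>0 int) \<Rightarrow> 'g" where
  "frag_eval G \<beta> c = (\<Oplus>\<^bsub>G\<^esub> p \<in> Poly_Mapping.keys c. [Poly_Mapping.lookup c p] \<cdot>\<^bsub>G\<^esub> \<beta> (fst p) (snd p))"

lemma frag_eval_add:
  assumes "abelian_group G" "\<And>n x. \<lbrakk>n \<in> S; x \<in> T\<rbrakk> \<Longrightarrow> \<beta> n x \<in> carrier G"
    and c: "Poly_Mapping.keys c \<subseteq> S \<times> T" "Poly_Mapping.keys c' \<subseteq> S \<times> T"
  shows "frag_eval G \<beta> (c + c') = frag_eval G \<beta> c \<oplus>\<^bsub>G\<^esub> frag_eval G \<beta> c'"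
proof -
  interpret G: abelian_group G by fact
  let ?K = "Poly_Mapping.keys c \<union> Poly_Mapping.keys c'"
  have \<beta>: "\<beta> (fst p) (snd p) \<in> carrier G" if "p \<in> ?K" for p using assms(2) c that by auto
  have ext: "frag_eval G \<beta> a = (\<Oplus>\<^bsub>G\<^esub> p \<in> ?K. [Poly_Mapping.lookup a p] \<cdot>\<^bsub>G\<^esub> \<beta> (fst p) (snd p))"
    if "Poly_Mapping.keys a \<subseteq> ?K" for a
    unfolding frag_eval_def
  proof (rule G.add.finprod_mono_neutral_cong_left)
    show "[Poly_Mapping.lookup a p] \<cdot>\<^bsub>G\<^esub> \<beta> (fst p) (snd p) = \<zero>\<^bsub>G\<^esub>"
      if "p \<in> ?K - Poly_Mapping.keys a" for p
      using that by (simp add: in_keys_iff add_pow_def)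
    show "(\<lambda>p. [Poly_Mapping.lookup a p] \<cdot>\<^bsub>G\<^esub> \<beta> (fst p) (snd p)) \<in> ?K \<rightarrow> carrier G"
      by (rule Pi_I) (rule G.add.int_pow_closed[OF \<beta>])
  qed (use that in auto)
  have "frag_eval G \<beta> (c + c') = (\<Oplus>\<^bsub>G\<^esub> p \<in> ?K. [Poly_Mapping.lookup c p] \<cdot>\<^bsub>G\<^esub> \<beta> (fst p) (snd p)
      \<oplus>\<^bsub>G\<^esub> [Poly_Mapping.lookup c' p] \<cdot>\<^bsub>G\<^esub> \<beta> (fst p) (snd p))"
    unfolding ext[OF keys_add]
    by (rule G.finsum_cong') (use \<beta> in \<open>auto simp: lookup_add G.add.int_pow_mult\<close>)
  also have "\<dots> = frag_eval G \<beta> c \<oplus>\<^bsub>G\<^esub> frag_eval G \<beta> c'"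
    unfolding ext[OF Un_upper1] ext[OF Un_upper2] by (rule G.finsum_addf) (use \<beta> in auto)
  finally show ?thesis .
qed

lemma frag_eval_closed:
  assumes "abelian_group G" "\<And>n x. \<lbrakk>n \<in> S; x \<in> T\<rbrakk> \<Longrightarrow> \<beta> n x \<in> carrier G"
    and "Poly_Mapping.keys c \<subseteq> S \<times> T"
  shows "frag_eval G \<beta> c \<in> carrier G"
proof -
  interpret G: abelian_group G by fact
  show ?thesis unfolding frag_eval_def by (rule G.finsum_closed) (use assms(2,3) in auto)
qed

lemma frag_eval_frag_of:
  assumes "abelian_group G" "\<beta> n x \<in> carrier G" shows "frag_eval G \<beta> (frag_of (n, x)) = \<beta> n x"
proof -
  interpret G: abelian_group G by fact
  have "add_pow G (1::int) (\<beta> n x) = \<beta> n x"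
    using assms(2) by (rule G.add.int_pow_1)
  then show ?thesis using assms(2) by (simp add: frag_eval_def)
qed

lemma frag_eval_zero: "abelian_group G \<Longrightarrow> frag_eval G \<beta> 0 = \<zero>\<^bsub>G\<^esub>"
  by (simp add: frag_eval_def abelian_monoid.finsum_empty abelian_group.axioms(1))

lemma frag_eval_uminus:
  assumes G: "abelian_group G" and \<beta>: "\<And>n x. \<lbrakk>n \<in> S; x \<in> T\<rbrakk> \<Longrightarrow> \<beta> n x \<in> carrier G"
    and c: "Poly_Mapping.keys c \<subseteq> S \<times> T"
  shows "frag_eval G \<beta> (- c) = \<ominus>\<^bsub>G\<^esub> frag_eval G \<beta> c"
proof -
  interpret G: abelian_group G by fact
  have "frag_eval G \<beta> (- c) \<oplus>\<^bsub>G\<^esub> frag_eval G \<beta> c = \<zero>\<^bsub>G\<^esub>"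
    using frag_eval_add[where \<beta> = \<beta> and S = S and T = T, OF G \<beta>, where c = "- c" and c' = c, symmetric] c
    by (simp add: frag_eval_zero[OF G])
  then show ?thesis
    using frag_eval_closed[where \<beta> = \<beta> and S = S and T = T, OF G \<beta>] c by (intro G.minus_equality[symmetric]) auto
qed

lemma frag_eval_diff:
  assumes G: "abelian_group G" and \<beta>: "\<And>n x. \<lbrakk>n \<in> S; x \<in> T\<rbrakk> \<Longrightarrow> \<beta> n x \<in> carrier G"
    and c: "Poly_Mapping.keys c \<subseteq> S \<times> T" "Poly_Mapping.keys c' \<subseteq> S \<times> T"
  shows "frag_eval G \<beta> (c - c') = frag_eval G \<beta> c \<ominus>\<^bsub>G\<^esub> frag_eval G \<beta> c'"
  using frag_eval_add[OF G \<beta>, where c = c and c' = "- c'"] c frag_eval_uminus[OF G \<beta> c(2)] by (simp add: a_minus_def)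

text \<open>A map that satisfies the defining relations of the tensor product modulo a subgroup \<open>J\<close> sends
  all null combinations into \<open>J\<close>. With \<open>J = 0\<close> this makes \<open>tensor_lift\<close> well defined, and with
  \<open>J = I U\<close> it computes the kernel of \<open>U \<rightarrow> A/I \<otimes>\<^sub>A U\<close>.\<close>

lemma frag_eval_tensor_null:
  fixes A :: "('a, 'w) ring_scheme" and N :: "('a, 'n, 'y) module_scheme" and U :: "('a, 'm, 'z) module_scheme"
  assumes G: "abelian_group G" and J: "additive_subgroup J G"
    and cl: "\<And>n n'. \<lbrakk>n \<in> carrier N; n' \<in> carrier N\<rbrakk> \<Longrightarrow> n \<oplus>\<^bsub>N\<^esub> n' \<in> carrier N"
      "\<And>x x'. \<lbrakk>x \<in> carrier U; x' \<in> carrier U\<rbrakk> \<Longrightarrow> x \<oplus>\<^bsub>U\<^esub> x' \<in> carrier U"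
      "\<And>a n. \<lbrakk>a \<in> carrier A; n \<in> carrier N\<rbrakk> \<Longrightarrow> a \<odot>\<^bsub>N\<^esub> n \<in> carrier N"
      "\<And>a x. \<lbrakk>a \<in> carrier A; x \<in> carrier U\<rbrakk> \<Longrightarrow> a \<odot>\<^bsub>U\<^esub> x \<in> carrier U"
    and \<beta>: "\<And>n x. \<lbrakk>n \<in> carrier N; x \<in> carrier U\<rbrakk> \<Longrightarrow> \<beta> n x \<in> carrier G"
    and add1: "\<And>n n' x. \<lbrakk>n \<in> carrier N; n' \<in> carrier N; x \<in> carrier U\<rbrakk> \<Longrightarrow>
      \<beta> (n \<oplus>\<^bsub>N\<^esub> n') x \<ominus>\<^bsub>G\<^esub> \<beta> n x \<ominus>\<^bsub>G\<^esub> \<beta> n' x \<in> J"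
    and add2: "\<And>n x x'. \<lbrakk>n \<in> carrier N; x \<in> carrier U; x' \<in> carrier U\<rbrakk> \<Longrightarrow>
      \<beta> n (x \<oplus>\<^bsub>U\<^esub> x') \<ominus>\<^bsub>G\<^esub> \<beta> n x \<ominus>\<^bsub>G\<^esub> \<beta> n x' \<in> J"
    and bal: "\<And>a n x. \<lbrakk>a \<in> carrier A; n \<in> carrier N; x \<in> carrier U\<rbrakk> \<Longrightarrow>
      \<beta> (a \<odot>\<^bsub>N\<^esub> n) x \<ominus>\<^bsub>G\<^esub> \<beta> n (a \<odot>\<^bsub>U\<^esub> x) \<in> J"
    and c: "c \<in> tensor_null A N U"
  shows "Poly_Mapping.keys c \<subseteq> carrier N \<times> carrier U \<and> frag_eval G \<beta> c \<in> J"
proof -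
  interpret G: abelian_group G by fact
  interpret J: additive_subgroup J G by fact
  let ?S = "carrier N \<times> carrier U"
  note ev = frag_eval_diff[OF G \<beta>] frag_eval_frag_of[OF G] frag_eval_add[OF G \<beta>]
    frag_eval_uminus[OF G \<beta>] frag_eval_zero[OF G]
  have kd: "Poly_Mapping.keys (a - b) \<subseteq> ?S" if "Poly_Mapping.keys a \<subseteq> ?S" "Poly_Mapping.keys b \<subseteq> ?S" for a b :: "('n \<times> 'm) \<Rightarrow>\<^sub>0 int"
    using that keys_diff[of a b] by blast
  have rel: "Poly_Mapping.keys r \<subseteq> ?S \<and> frag_eval G \<beta> r \<in> J" if "r \<in> tensor_relations A N U" for r
    using that unfolding tensor_relations_def
    by (elim UnE CollectE exE conjE; simp only:)
      (intro conjI kd; simp add: ev kd cl \<beta> add1 add2 bal)+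
  from c show ?thesis
    unfolding tensor_null_def
  proof (induction rule: generate.induct)
    case one then show ?case by (simp add: ev J.zero_closed)
  next
    case (incl h) then show ?case by (rule rel)
  next
    case (inv h)
    then show ?case using rel[OF inv] J.a_inv_closed by (simp add: ev)
  next
    case (eng h h')
    then show ?case using J.a_closed keys_add[of h h'] by (simp add: ev subset_trans[OF keys_add])
  qed
qed


text \<open>The defining relations only mention sums and multiples, so closure under these suffices to treat
  the tensor product as an abelian group.\<close>

locale tensor_pair =
  fixes A :: "('a, 'w) ring_scheme" and N :: "('a, 'n, 'y) module_scheme" and U :: "('a, 'm, 'z) module_scheme"
  assumes closed:
    "\<And>n n'. \<lbrakk>n \<in> carrier N; n' \<in> carrier N\<rbrakk> \<Longrightarrow> n \<oplus>\<^bsub>N\<^esub> n' \<in> carrier N"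
    "\<And>x x'. \<lbrakk>x \<in> carrier U; x' \<in> carrier U\<rbrakk> \<Longrightarrow> x \<oplus>\<^bsub>U\<^esub> x' \<in> carrier U"
    "\<And>a n. \<lbrakk>a \<in> carrier A; n \<in> carrier N\<rbrakk> \<Longrightarrow> a \<odot>\<^bsub>N\<^esub> n \<in> carrier N"
    "\<And>a x. \<lbrakk>a \<in> carrier A; x \<in> carrier U\<rbrakk> \<Longrightarrow> a \<odot>\<^bsub>U\<^esub> x \<in> carrier U"
begin

abbreviation "F \<equiv> free_Abelian_group (carrier N \<times> carrier U)"
abbreviation "H \<equiv> tensor_null A N U"

lemma relations_closed: "tensor_relations A N U \<subseteq> carrier F"
proof -
  have kd: "Poly_Mapping.keys (a - b) \<subseteq> carrier N \<times> carrier U"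
    if "Poly_Mapping.keys a \<subseteq> carrier N \<times> carrier U" "Poly_Mapping.keys b \<subseteq> carrier N \<times> carrier U"
    for a b :: "('n \<times> 'm) \<Rightarrow>\<^sub>0 int"
    using that keys_diff[of a b] by blast
  show ?thesis
    unfolding tensor_relations_def
    by (intro Un_least subsetI; elim CollectE exE conjE; simp only: carrier_free_Abelian_group_iff)
      (intro kd; simp add: closed)+
qed

lemma null_subgroup: "subgroup H F"
  unfolding tensor_null_def
  by (rule group.generate_is_subgroup[OF group_free_Abelian_group relations_closed])

lemma null_normal: "H \<lhd> F"
  by (rule comm_group.subgroup_imp_normal[OF abelian_free_Abelian_group null_subgroup])

lemma tensor_simps:
  "carrier (tensor A N U) = (\<lambda>c. H #>\<^bsub>F\<^esub> c) ` carrier F"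
  "\<zero>\<^bsub>tensor A N U\<^esub> = H"
  "s \<oplus>\<^bsub>tensor A N U\<^esub> t = s <#>\<^bsub>F\<^esub> t"
  by (simp_all add: tensor_def Let_def carrier_FactGroup)

lemma tensor_abelian_group: "abelian_group (tensor A N U)"
proof -
  interpret Q: comm_group "F Mod H"
    by (rule comm_group.abelian_FactGroup[OF abelian_free_Abelian_group null_subgroup])
  have eq: "carrier (tensor A N U) = carrier (F Mod H)" "\<zero>\<^bsub>tensor A N U\<^esub> = \<one>\<^bsub>F Mod H\<^esub>"
    "\<And>s t. s \<oplus>\<^bsub>tensor A N U\<^esub> t = s \<otimes>\<^bsub>F Mod H\<^esub> t"
    by (simp_all add: tensor_def Let_def)
  show ?thesis
  proof (rule abelian_groupI; unfold eq)
    show "\<exists>y\<in>carrier (F Mod H). y \<otimes>\<^bsub>F Mod H\<^esub> x = \<one>\<^bsub>F Mod H\<^esub>" if "x \<in> carrier (F Mod H)" for x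
      using that Q.l_inv by blast
    show "x \<otimes>\<^bsub>F Mod H\<^esub> y = y \<otimes>\<^bsub>F Mod H\<^esub> x" if "x \<in> carrier (F Mod H)" "y \<in> carrier (F Mod H)" for x y
      using that by (rule Q.m_comm)
  qed (simp_all only: Q.m_closed Q.one_closed Q.m_assoc Q.l_one)
qed

lemma coset_add:
  assumes "c \<in> carrier F" "c' \<in> carrier F"
  shows "(H #>\<^bsub>F\<^esub> c) \<oplus>\<^bsub>tensor A N U\<^esub> (H #>\<^bsub>F\<^esub> c') = H #>\<^bsub>F\<^esub> (c + c')"
  unfolding tensor_simps using normal.rcos_sum[OF null_normal assms] by simp

lemma coset_eq_zero: 
  assumes "c \<in> carrier F" shows "H #>\<^bsub>F\<^esub> c = \<zero>\<^bsub>tensor A N U\<^esub> \<longleftrightarrow> c \<in> H"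
  unfolding tensor_simps
  using group.coset_join1[OF group_free_Abelian_group _ assms null_subgroup]
    group.coset_join2[OF group_free_Abelian_group assms null_subgroup] by blast

lemma pure_closed: "\<lbrakk>n \<in> carrier N; x \<in> carrier U\<rbrakk> \<Longrightarrow> pure_tensor A N U n x \<in> carrier (tensor A N U)"
  unfolding tensor_simps pure_tensor_def by (rule imageI) simp

lemma coset_cong:
  assumes "c \<in> carrier F" "c' \<in> carrier F" "c - c' \<in> H"
  shows "H #>\<^bsub>F\<^esub> c = H #>\<^bsub>F\<^esub> c'"
proof (rule group.repr_independence[OF group_free_Abelian_group _ assms(2) null_subgroup, symmetric])
  show "c \<in> H #>\<^bsub>F\<^esub> c'" using assms(3) by (auto simp: r_coset_def intro!: bexI[of _ "c - c'"])
qed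

lemma keys_frag_of_add:
  assumes "p \<in> S" "q \<in> S" shows "Poly_Mapping.keys (frag_of p + frag_of q) \<subseteq> S"
  using assms keys_add[of "frag_of p" "frag_of q"] by auto

lemma pure_add_left:
  assumes "n \<in> carrier N" "n' \<in> carrier N" "x \<in> carrier U"
  shows "pure_tensor A N U (n \<oplus>\<^bsub>N\<^esub> n') x = pure_tensor A N U n x \<oplus>\<^bsub>tensor A N U\<^esub> pure_tensor A N U n' x"
proof -
  have "frag_of (n \<oplus>\<^bsub>N\<^esub> n', x) - (frag_of (n, x) + frag_of (n', x)) \<in> H"
    unfolding tensor_null_def using assms
    by (intro generate.incl) (auto simp: tensor_relations_def diff_diff_add[symmetric])
  then show ?thesis
    unfolding pure_tensor_def using assms
    by (subst coset_add, simp_all) (rule coset_cong, simp_all add: closed keys_frag_of_add)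
qed

lemma pure_add_right:
  assumes "n \<in> carrier N" "x \<in> carrier U" "x' \<in> carrier U"
  shows "pure_tensor A N U n (x \<oplus>\<^bsub>U\<^esub> x') = pure_tensor A N U n x \<oplus>\<^bsub>tensor A N U\<^esub> pure_tensor A N U n x'"
proof -
  have "frag_of (n, x \<oplus>\<^bsub>U\<^esub> x') - (frag_of (n, x) + frag_of (n, x')) \<in> H"
    unfolding tensor_null_def using assms
    by (intro generate.incl) (auto simp: tensor_relations_def diff_diff_add[symmetric])
  then show ?thesis
    unfolding pure_tensor_def using assms
    by (subst coset_add, simp_all) (rule coset_cong, simp_all add: closed keys_frag_of_add)
qed

lemma pure_balanced:
  assumes "a \<in> carrier A" "n \<in> carrier N" "x \<in> carrier U"
  shows "pure_tensor A N U (a \<odot>\<^bsub>N\<^esub> n) x = pure_tensor A N U n (a \<odot>\<^bsub>U\<^esub> x)"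
proof -
  have "frag_of (a \<odot>\<^bsub>N\<^esub> n, x) - frag_of (n, a \<odot>\<^bsub>U\<^esub> x) \<in> H"
    unfolding tensor_null_def using assms by (intro generate.incl) (auto simp: tensor_relations_def)
  then show ?thesis
    unfolding pure_tensor_def using assms by (intro coset_cong) (simp_all add: closed)
qed

lemma tensor_induct [consumes 1, case_names zero pure diff]:
  assumes t: "t \<in> carrier (tensor A N U)"
    and zero: "P \<zero>\<^bsub>tensor A N U\<^esub>"
    and pure: "\<And>n x. \<lbrakk>n \<in> carrier N; x \<in> carrier U\<rbrakk> \<Longrightarrow> P (pure_tensor A N U n x)"
    and diff: "\<And>s t. \<lbrakk>s \<in> carrier (tensor A N U); t \<in> carrier (tensor A N U); P s; P t\<rbrakk>
      \<Longrightarrow> P (s \<ominus>\<^bsub>tensor A N U\<^esub> t)"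
  shows "P t"
proof -
  interpret T: abelian_group "tensor A N U" by (rule tensor_abelian_group)
  obtain c where c: "Poly_Mapping.keys c \<subseteq> carrier N \<times> carrier U" "t = H #>\<^bsub>F\<^esub> c"
    using t by (auto simp: tensor_simps)
  have "P (H #>\<^bsub>F\<^esub> c)"
  proof (rule free_Abelian_group_induct[OF c(1)])
    have "H #>\<^bsub>F\<^esub> 0 = \<zero>\<^bsub>tensor A N U\<^esub>"
      using coset_eq_zero[of 0] subgroup.one_closed[OF null_subgroup] by simp
    then show "P (H #>\<^bsub>F\<^esub> 0)" using zero by simp
    show "P (H #>\<^bsub>F\<^esub> (x - y))"
      if xy: "Poly_Mapping.keys x \<subseteq> carrier N \<times> carrier U" "Poly_Mapping.keys y \<subseteq> carrier N \<times> carrier U"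
        "P (H #>\<^bsub>F\<^esub> x)" "P (H #>\<^bsub>F\<^esub> y)" for x y
    proof -
      have k: "Poly_Mapping.keys (x - y) \<subseteq> carrier N \<times> carrier U" using xy(1,2) keys_diff[of x y] by blast
      have cl: "H #>\<^bsub>F\<^esub> z \<in> carrier (tensor A N U)" if "Poly_Mapping.keys z \<subseteq> carrier N \<times> carrier U" for z
        unfolding tensor_simps by (rule imageI) (simp add: that)
      have "(H #>\<^bsub>F\<^esub> (x - y)) \<oplus>\<^bsub>tensor A N U\<^esub> (H #>\<^bsub>F\<^esub> y) = H #>\<^bsub>F\<^esub> x"
        using coset_add[of "x - y" y] k xy(2) by simp
      then have "H #>\<^bsub>F\<^esub> (x - y) = (H #>\<^bsub>F\<^esub> x) \<ominus>\<^bsub>tensor A N U\<^esub> (H #>\<^bsub>F\<^esub> y)"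
        using cl[OF k] cl[OF xy(1)] cl[OF xy(2)]
        by (metis T.a_inv_closed T.a_assoc T.r_neg T.r_zero a_minus_def)
      then show ?thesis using diff[OF cl[OF xy(1)] cl[OF xy(2)] xy(3,4)] by simp
    qed
    show "P (H #>\<^bsub>F\<^esub> frag_of p)" if "p \<in> carrier N \<times> carrier U" for p
      using pure[of "fst p" "snd p"] that by (auto simp: pure_tensor_def)
  qed
  then show ?thesis using c(2) by simp
qed

lemma tensor_lift_pure:
  assumes G: "abelian_group G"
    and \<beta>: "\<And>n x. \<lbrakk>n \<in> carrier N; x \<in> carrier U\<rbrakk> \<Longrightarrow> \<beta> n x \<in> carrier G"
    and add1: "\<And>n n' x. \<lbrakk>n \<in> carrier N; n' \<in> carrier N; x \<in> carrier U\<rbrakk> \<Longrightarrow> \<beta> (n \<oplus>\<^bsub>N\<^esub> n') x = \<beta> n x \<oplus>\<^bsub>G\<^esub> \<beta> n' x"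
    and add2: "\<And>n x x'. \<lbrakk>n \<in> carrier N; x \<in> carrier U; x' \<in> carrier U\<rbrakk> \<Longrightarrow> \<beta> n (x \<oplus>\<^bsub>U\<^esub> x') = \<beta> n x \<oplus>\<^bsub>G\<^esub> \<beta> n x'"
    and bal: "\<And>a n x. \<lbrakk>a \<in> carrier A; n \<in> carrier N; x \<in> carrier U\<rbrakk> \<Longrightarrow> \<beta> (a \<odot>\<^bsub>N\<^esub> n) x = \<beta> n (a \<odot>\<^bsub>U\<^esub> x)"
    and n: "n \<in> carrier N" and x: "x \<in> carrier U"
  shows "tensor_lift G \<beta> (pure_tensor A N U n x) = \<beta> n x"
proof -
  interpret G: abelian_group G by fact
  have J: "additive_subgroup {\<zero>\<^bsub>G\<^esub>} G"
    unfolding additive_subgroup_def by (rule group.triv_subgroup[OF G.a_group, simplified])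
  have null: "Poly_Mapping.keys h \<subseteq> carrier N \<times> carrier U \<and> frag_eval G \<beta> h = \<zero>\<^bsub>G\<^esub>" if "h \<in> H" for h
  proof -
    have z: "a \<oplus>\<^bsub>G\<^esub> b \<ominus>\<^bsub>G\<^esub> a \<ominus>\<^bsub>G\<^esub> b = \<zero>\<^bsub>G\<^esub>" if "a \<in> carrier G" "b \<in> carrier G" for a b
      using that by (simp add: a_minus_def G.a_assoc G.a_comm[of "\<ominus>\<^bsub>G\<^esub> a"] G.r_neg)
        (metis G.a_inv_closed G.r_neg G.r_neg2 G.a_comm G.minus_minus)
    have z2: "a \<ominus>\<^bsub>G\<^esub> a = \<zero>\<^bsub>G\<^esub>" if "a \<in> carrier G" for a
      using that by (simp add: a_minus_def G.r_neg)
    have "Poly_Mapping.keys h \<subseteq> carrier N \<times> carrier U \<and> frag_eval G \<beta> h \<in> {\<zero>\<^bsub>G\<^esub>}"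
      by (rule frag_eval_tensor_null[where A = A, OF G J closed \<beta> _ _ _ that])
        (simp_all add: add1 add2 bal \<beta> z z2 closed)
    then show ?thesis by simp
  qed
  have "frag_eval G \<beta> ` (H #>\<^bsub>F\<^esub> frag_of (n, x)) = {\<beta> n x}"
  proof -
    have "frag_eval G \<beta> (h + frag_of (n, x)) = \<beta> n x" if "h \<in> H" for h
      using null[OF that] n x \<beta>[OF n x]
      by (subst frag_eval_add[where S = "carrier N" and T = "carrier U", OF G \<beta>])
        (auto simp: frag_eval_frag_of[OF G])
    then have "frag_eval G \<beta> c = \<beta> n x" if "c \<in> H #>\<^bsub>F\<^esub> frag_of (n, x)" for c
      using that by (auto simp: r_coset_def)
    moreover have "frag_of (n, x) \<in> H #>\<^bsub>F\<^esub> frag_of (n, x)"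
      by (rule group.rcos_self[OF group_free_Abelian_group _ null_subgroup]) (use n x in simp)
    ultimately show ?thesis by (auto intro: rev_image_eqI)
  qed
  then show ?thesis
    unfolding tensor_lift_def pure_tensor_def frag_eval_def[abs_def] by simp
qed

end


section \<open>The functor \<open>A/I \<otimes>\<^sub>A -\<close> as reduction modulo \<open>I\<close>\<close>

lemma (in abelian_group) diff_add_cancel:
  "\<lbrakk>x \<in> carrier G; y \<in> carrier G\<rbrakk> \<Longrightarrow> x \<ominus> y \<oplus> y = x"
  by (simp add: a_minus_def a_assoc l_neg)

lemma (in abelian_group) eq_diffI:
  "\<lbrakk>x \<in> carrier G; y \<in> carrier G; x \<oplus> y = z\<rbrakk> \<Longrightarrow> x = z \<ominus> y"
  by (auto simp: a_minus_def a_assoc r_neg)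

lemma (in abelian_group) diff_eq_zero_iff:
  assumes "x \<in> carrier G" "y \<in> carrier G" shows "x \<ominus> y = \<zero> \<longleftrightarrow> x = y"
  using diff_add_cancel[OF assms] assms by (auto simp: a_minus_def r_neg)

lemma quot_right_simps [simp]:
  "carrier (quot_right A I) = a_rcosets\<^bsub>A\<^esub> I" "\<zero>\<^bsub>quot_right A I\<^esub> = I"
  "x \<oplus>\<^bsub>quot_right A I\<^esub> y = x <+>\<^bsub>A\<^esub> y"
  "a \<odot>\<^bsub>quot_right A I\<^esub> x = rcoset_mult A I x (I +>\<^bsub>A\<^esub> a)"
  by (simp_all add: quot_right_def inflate_def restrict_scalars_def right_regular_def FactRing_def)

lemma inflate_simps [simp]:
  "carrier (inflate A I M) = carrier M" "\<zero>\<^bsub>inflate A I M\<^esub> = \<zero>\<^bsub>M\<^esub>"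
  "add (inflate A I M) = add M" "a \<odot>\<^bsub>inflate A I M\<^esub> x = (I +>\<^bsub>A\<^esub> a) \<odot>\<^bsub>M\<^esub> x"
  by (simp_all add: inflate_def restrict_scalars_def)

lemma carrier_Quot: "carrier (A Quot I) = (\<lambda>a. I +>\<^bsub>A\<^esub> a) ` carrier A"
  by (auto simp: FactRing_def A_RCOSETS_def')

lemma coset_in_Quot: "a \<in> carrier A \<Longrightarrow> I +>\<^bsub>A\<^esub> a \<in> carrier (A Quot I)"
  by (simp add: carrier_Quot)

lemma Quot_coset_simps:
  assumes "ideal I A" "a \<in> carrier A" "b \<in> carrier A"
  shows "(I +>\<^bsub>A\<^esub> a) \<oplus>\<^bsub>A Quot I\<^esub> (I +>\<^bsub>A\<^esub> b) = I +>\<^bsub>A\<^esub> (a \<oplus>\<^bsub>A\<^esub> b)"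
    "(I +>\<^bsub>A\<^esub> a) \<otimes>\<^bsub>A Quot I\<^esub> (I +>\<^bsub>A\<^esub> b) = I +>\<^bsub>A\<^esub> (a \<otimes>\<^bsub>A\<^esub> b)"
    "\<one>\<^bsub>A Quot I\<^esub> = I +>\<^bsub>A\<^esub> \<one>\<^bsub>A\<^esub>" "\<zero>\<^bsub>A Quot I\<^esub> = I"
proof -
  interpret I: ideal I A by fact
  show "(I +>\<^bsub>A\<^esub> a) \<oplus>\<^bsub>A Quot I\<^esub> (I +>\<^bsub>A\<^esub> b) = I +>\<^bsub>A\<^esub> (a \<oplus>\<^bsub>A\<^esub> b)"
    using assms by (simp add: FactRing_def I.a_rcos_sum)
  show "(I +>\<^bsub>A\<^esub> a) \<otimes>\<^bsub>A Quot I\<^esub> (I +>\<^bsub>A\<^esub> b) = I +>\<^bsub>A\<^esub> (a \<otimes>\<^bsub>A\<^esub> b)"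
    using assms by (simp add: FactRing_def I.rcoset_mult_add)
qed (simp_all add: FactRing_def)

lemma inflate_left_module:
  assumes I: "ideal I A" and M: "left_module (A Quot I) M"
  shows "left_module A (inflate A I M)"
proof -
  interpret I: ideal I A by fact
  interpret M: left_module "A Quot I" M by fact
  note q = Quot_coset_simps[OF I] coset_in_Quot
  show ?thesis
  proof (rule left_moduleI; (simp only: inflate_simps)?)
    show "\<exists>y\<in>carrier M. y \<oplus>\<^bsub>M\<^esub> x = \<zero>\<^bsub>M\<^esub>" if "x \<in> carrier M" for x
      using that M.M.l_neg by blast
    show "(I +>\<^bsub>A\<^esub> \<one>\<^bsub>A\<^esub>) \<odot>\<^bsub>M\<^esub> x = x" if "x \<in> carrier M" for x
      using M.smult_one[OF that] q(3)[OF I.one_closed I.one_closed] by simp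
    show "(I +>\<^bsub>A\<^esub> (a \<oplus>\<^bsub>A\<^esub> b)) \<odot>\<^bsub>M\<^esub> x = (I +>\<^bsub>A\<^esub> a) \<odot>\<^bsub>M\<^esub> x \<oplus>\<^bsub>M\<^esub> (I +>\<^bsub>A\<^esub> b) \<odot>\<^bsub>M\<^esub> x"
      if "a \<in> carrier A" "b \<in> carrier A" "x \<in> carrier M" for a b x
      using that M.smult_l_distr[of "I +>\<^bsub>A\<^esub> a" "I +>\<^bsub>A\<^esub> b" x] by (simp add: q)
    show "(I +>\<^bsub>A\<^esub> (a \<otimes>\<^bsub>A\<^esub> b)) \<odot>\<^bsub>M\<^esub> x = (I +>\<^bsub>A\<^esub> a) \<odot>\<^bsub>M\<^esub> ((I +>\<^bsub>A\<^esub> b) \<odot>\<^bsub>M\<^esub> x)"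
      if "a \<in> carrier A" "b \<in> carrier A" "x \<in> carrier M" for a b x
      using that M.smult_assoc1[of "I +>\<^bsub>A\<^esub> a" "I +>\<^bsub>A\<^esub> b" x] by (simp add: q)
  qed (simp_all add: q I.ring_axioms M.M.a_ac M.smult_r_distr)
qed

lemma annihilates_inflate:
  assumes I: "ideal I A" and M: "left_module (A Quot I) M"
  shows "annihilates I (inflate A I M)"
proof -
  interpret I: ideal I A by fact
  have "I \<odot>\<^bsub>M\<^esub> x = \<zero>\<^bsub>M\<^esub>" if "x \<in> carrier M" for x
    using left_module.smult_l_zero[OF M that] by (simp add: FactRing_def)
  then show ?thesis by (simp add: annihilates_def I.a_rcos_const)
qed

lemma inflate_lin_hom:
  "f \<in> lin_hom (A Quot I) U V \<Longrightarrow> f \<in> lin_hom A (inflate A I U) (inflate A I V)"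
  by (auto simp: lin_hom_def carrier_Quot)

lemma (in left_module) smult_l_diff:
  assumes "a \<in> carrier A" "b \<in> carrier A" "x \<in> carrier M"
  shows "(a \<ominus> b) \<odot>\<^bsub>M\<^esub> x = a \<odot>\<^bsub>M\<^esub> x \<ominus>\<^bsub>M\<^esub> b \<odot>\<^bsub>M\<^esub> x"
  using lin_hom_diff[OF left_regular_left_module[OF A.ring_axioms] left_module_axioms
      smult_lin_hom[OF left_module_axioms assms(3)], of a b] assms
  by (simp add: a_minus_def a_inv_def m_inv_def)

lemma tensor_pair_quot_right:
  assumes I: "ideal I A" and U: "left_module A U" shows "tensor_pair A (quot_right A I) U"
proof -
  interpret I: ideal I A by fact
  interpret U: left_module A U by fact
  have "rcoset_mult A I (I +>\<^bsub>A\<^esub> a) (I +>\<^bsub>A\<^esub> b) \<in> a_rcosets\<^bsub>A\<^esub> I" if "a \<in> carrier A" "b \<in> carrier A" for a b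
    using that by (auto simp: I.rcoset_mult_add A_RCOSETS_def')
  moreover have "(I +>\<^bsub>A\<^esub> a) <+>\<^bsub>A\<^esub> (I +>\<^bsub>A\<^esub> b) \<in> a_rcosets\<^bsub>A\<^esub> I" if "a \<in> carrier A" "b \<in> carrier A" for a b
    using that by (auto simp: I.a_rcos_sum A_RCOSETS_def')
  ultimately show ?thesis by unfold_locales (auto simp: A_RCOSETS_def')
qed

text \<open>The map \<open>u \<mapsto> 1 \<otimes> u\<close>. It identifies \<open>A/I \<otimes>\<^sub>A U\<close> with \<open>U / I U\<close>.\<close>

definition quot_proj ::
    "('a, 'w) ring_scheme \<Rightarrow> 'a set \<Rightarrow> ('a, 'u, 'z) module_scheme \<Rightarrow> 'u \<Rightarrow> (('a set \<times> 'u) \<Rightarrow>\<^sub>0 int) set"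
  where "quot_proj A I U u = pure_tensor A (quot_right A I) U (I +>\<^bsub>A\<^esub> \<one>\<^bsub>A\<^esub>) u"

lemma quot_tensor_simps:
  "carrier (quot_tensor A I U) = carrier (tensor A (quot_right A I) U)"
  "\<zero>\<^bsub>quot_tensor A I U\<^esub> = \<zero>\<^bsub>tensor A (quot_right A I) U\<^esub>"
  "add (quot_tensor A I U) = add (tensor A (quot_right A I) U)"
  "b \<odot>\<^bsub>quot_tensor A I U\<^esub> t = tensor_lift (tensor A (quot_right A I) U)
     (\<lambda>n x. pure_tensor A (quot_right A I) U (b \<otimes>\<^bsub>A Quot I\<^esub> n) x) t"
  by (simp_all add: quot_tensor_def Let_def)

context
  fixes A :: "('a, 'w) ring_scheme" and I :: "'a set" and U :: "('a, 'u, 'z) module_scheme"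
  assumes I: "ideal I A" and U: "left_module A U"
begin

interpretation I: ideal I A by (rule I)
interpretation U: left_module A U by (rule U)
interpretation T: tensor_pair A "quot_right A I" U by (rule tensor_pair_quot_right[OF I U])
interpretation TG: abelian_group "tensor A (quot_right A I) U" by (rule T.tensor_abelian_group)

lemma coset_in_quot_right: "a \<in> carrier A \<Longrightarrow> I +>\<^bsub>A\<^esub> a \<in> carrier (quot_right A I)"
  by (auto simp: A_RCOSETS_def')

lemma pure_eq_quot_proj:
  assumes a: "a \<in> carrier A" and u: "u \<in> carrier U"
  shows "pure_tensor A (quot_right A I) U (I +>\<^bsub>A\<^esub> a) u = quot_proj A I U (a \<odot>\<^bsub>U\<^esub> u)"
  using T.pure_balanced[OF a coset_in_quot_right[OF I.one_closed] u] a
  by (simp add: quot_proj_def I.rcoset_mult_add)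

lemma quot_proj_closed: "u \<in> carrier U \<Longrightarrow> quot_proj A I U u \<in> carrier (quot_tensor A I U)"
  unfolding quot_proj_def quot_tensor_simps by (rule T.pure_closed[OF coset_in_quot_right[OF I.one_closed]])

lemma quot_proj_add:
  "\<lbrakk>u \<in> carrier U; v \<in> carrier U\<rbrakk> \<Longrightarrow>
    quot_proj A I U (u \<oplus>\<^bsub>U\<^esub> v) = quot_proj A I U u \<oplus>\<^bsub>quot_tensor A I U\<^esub> quot_proj A I U v"
  unfolding quot_proj_def quot_tensor_simps by (rule T.pure_add_right[OF coset_in_quot_right[OF I.one_closed]])

lemma quot_proj_zero: "quot_proj A I U \<zero>\<^bsub>U\<^esub> = \<zero>\<^bsub>quot_tensor A I U\<^esub>"
  using quot_proj_add[of "\<zero>\<^bsub>U\<^esub>" "\<zero>\<^bsub>U\<^esub>"] quot_proj_closed[of "\<zero>\<^bsub>U\<^esub>"]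
  by (simp add: quot_tensor_simps)

lemma quot_proj_diff:
  assumes "u \<in> carrier U" "v \<in> carrier U"
  shows "quot_proj A I U (u \<ominus>\<^bsub>U\<^esub> v) = quot_proj A I U u \<ominus>\<^bsub>tensor A (quot_right A I) U\<^esub> quot_proj A I U v"
proof -
  have c: "quot_proj A I U x \<in> carrier (tensor A (quot_right A I) U)" if "x \<in> carrier U" for x
    using quot_proj_closed[OF that] by (simp add: quot_tensor_simps)
  show ?thesis
    by (rule TG.eq_diffI[OF c c])
      (use assms quot_proj_add[of "u \<ominus>\<^bsub>U\<^esub> v" v] U.M.diff_add_cancel in \<open>simp_all add: quot_tensor_simps\<close>)
qed

lemma quot_proj_surj: "carrier (quot_tensor A I U) = quot_proj A I U ` carrier U"
proof
  show "quot_proj A I U ` carrier U \<subseteq> carrier (quot_tensor A I U)" using quot_proj_closed by blast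
  show "carrier (quot_tensor A I U) \<subseteq> quot_proj A I U ` carrier U"
  proof
    fix t assume "t \<in> carrier (quot_tensor A I U)"
    then have "t \<in> carrier (tensor A (quot_right A I) U)" by (simp add: quot_tensor_simps)
    then show "t \<in> quot_proj A I U ` carrier U"
    proof (induction rule: T.tensor_induct)
      case zero
      then show ?case using quot_proj_zero by (intro image_eqI[of _ _ "\<zero>\<^bsub>U\<^esub>"]) (simp_all add: quot_tensor_simps)
    next
      case (pure n x)
      then obtain a where "a \<in> carrier A" "n = I +>\<^bsub>A\<^esub> a" by (auto simp: A_RCOSETS_def')
      then show ?case using pure pure_eq_quot_proj by (intro image_eqI[of _ _ "a \<odot>\<^bsub>U\<^esub> x"]) simp_all
    next
      case (diff s t)
      then obtain u v where "u \<in> carrier U" "s = quot_proj A I U u" "v \<in> carrier U" "t = quot_proj A I U v"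
        by blast
      then show ?case by (intro image_eqI[of _ _ "u \<ominus>\<^bsub>U\<^esub> v"]) (simp_all add: quot_proj_diff)
    qed
  qed
qed

lemma quot_proj_ideal_smult:
  assumes "u \<in> ideal_smult I U" shows "quot_proj A I U u = \<zero>\<^bsub>quot_tensor A I U\<^esub>"
  using assms
proof induction
  case zero show ?case by (rule quot_proj_zero)
next
  case (add i u x)
  note iA = ideal_closed[OF I add(1)]
  have "quot_proj A I U (i \<odot>\<^bsub>U\<^esub> u) = pure_tensor A (quot_right A I) U (I +>\<^bsub>A\<^esub> \<zero>\<^bsub>A\<^esub>) u"
    using pure_eq_quot_proj[OF iA add(2)] I.a_rcos_const[OF add(1)]
      I.a_rcos_const[OF additive_subgroup.zero_closed[OF I.additive_subgroup_axioms]] by simp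
  also have "\<dots> = \<zero>\<^bsub>quot_tensor A I U\<^esub>"
    using pure_eq_quot_proj[OF I.zero_closed add(2)] add(2) quot_proj_zero by (simp add: U.smult_l_zero)
  finally show ?case
    using add iA ideal_smult_closed[OF I U add(3)] quot_proj_add[of "i \<odot>\<^bsub>U\<^esub> u" x] TG.zero_closed
    by (simp add: quot_tensor_simps)
qed

text \<open>An inverse of \<open>U / I U \<rightarrow> A/I \<otimes>\<^sub>A U\<close> should send \<open>n \<otimes> x\<close> to \<open>a x\<close> for a representative \<open>a\<close> of the
  coset \<open>n\<close>. With values in \<open>U\<close> and arbitrary representatives \<open>\<rho> n\<close> the tensor relations hold modulo
  \<open>I U\<close>, so that \<open>1 \<otimes> u = 0\<close> forces \<open>\<rho> 1 u \<in> I U\<close>, and \<open>\<rho> 1\<close> is \<open>1\<close> modulo \<open>I\<close>.\<close>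

lemma quot_proj_eq_zero_iff:
  assumes u: "u \<in> carrier U"
  shows "quot_proj A I U u = \<zero>\<^bsub>quot_tensor A I U\<^esub> \<longleftrightarrow> u \<in> ideal_smult I U"
proof
  assume z: "quot_proj A I U u = \<zero>\<^bsub>quot_tensor A I U\<^esub>"
  define \<rho> where "\<rho> n = (SOME a. a \<in> carrier A \<and> n = I +>\<^bsub>A\<^esub> a)" for n
  have \<rho>: "\<rho> n \<in> carrier A" "I +>\<^bsub>A\<^esub> \<rho> n = n" if "n \<in> carrier (quot_right A I)" for n
  proof -
    have "\<exists>a. a \<in> carrier A \<and> n = I +>\<^bsub>A\<^esub> a" using that by (auto simp: A_RCOSETS_def')
    from someI_ex[OF this] show "\<rho> n \<in> carrier A" "I +>\<^bsub>A\<^esub> \<rho> n = n" by (simp_all add: \<rho>_def)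
  qed
  have diffI: "a \<odot>\<^bsub>U\<^esub> x \<ominus>\<^bsub>U\<^esub> b \<odot>\<^bsub>U\<^esub> x \<in> ideal_smult I U"
    if "a \<in> carrier A" "b \<in> carrier A" "I +>\<^bsub>A\<^esub> a = I +>\<^bsub>A\<^esub> b" "x \<in> carrier U" for a b x
    using that I.quotient_eq_iff_same_a_r_cos[OF I that(1,2)] ideal_smult_incl[OF I U _ that(4)]
    by (simp flip: U.smult_l_diff)
  have "frag_of (I +>\<^bsub>A\<^esub> \<one>\<^bsub>A\<^esub>, u) \<in> tensor_null A (quot_right A I) U"
    using z T.coset_eq_zero[of "frag_of (I +>\<^bsub>A\<^esub> \<one>\<^bsub>A\<^esub>, u)"] coset_in_quot_right[OF I.one_closed] u
    by (simp add: quot_proj_def pure_tensor_def quot_tensor_simps)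
  moreover have J: "additive_subgroup (ideal_smult I U) U"
    unfolding additive_subgroup_def
    by (rule subgroup.intro)
      (use ideal_smult_closed[OF I U] ideal_smult_add[OF I U] ideal_smult.zero ideal_smult_minus[OF I U]
        in \<open>auto simp flip: a_inv_def\<close>)
  ultimately have "frag_eval U (\<lambda>n x. \<rho> n \<odot>\<^bsub>U\<^esub> x) (frag_of (I +>\<^bsub>A\<^esub> \<one>\<^bsub>A\<^esub>, u)) \<in> ideal_smult I U"
  proof (rule_tac conjunct2[OF frag_eval_tensor_null[where A = A and N = "quot_right A I" and U = U,
          OF U.M.abelian_group_axioms _ T.closed]])
    fix n n' x assume n: "n \<in> carrier (quot_right A I)" "n' \<in> carrier (quot_right A I)" and x: "x \<in> carrier U"
    note nn = T.closed(1)[OF n]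
    have "I +>\<^bsub>A\<^esub> (\<rho> n \<oplus>\<^bsub>A\<^esub> \<rho> n') = n \<oplus>\<^bsub>quot_right A I\<^esub> n'"
      using I.a_rcos_sum[OF \<rho>(1)[OF n(1)] \<rho>(1)[OF n(2)]] \<rho>(2) n by simp
    then have "\<rho> (n \<oplus>\<^bsub>quot_right A I\<^esub> n') \<odot>\<^bsub>U\<^esub> x \<ominus>\<^bsub>U\<^esub> (\<rho> n \<oplus>\<^bsub>A\<^esub> \<rho> n') \<odot>\<^bsub>U\<^esub> x \<in> ideal_smult I U"
      using \<rho>(1) \<rho>(2)[OF nn] n nn x by (intro diffI) simp_all
    then show "\<rho> (n \<oplus>\<^bsub>quot_right A I\<^esub> n') \<odot>\<^bsub>U\<^esub> x \<ominus>\<^bsub>U\<^esub> \<rho> n \<odot>\<^bsub>U\<^esub> x \<ominus>\<^bsub>U\<^esub> \<rho> n' \<odot>\<^bsub>U\<^esub> x \<in> ideal_smult I U"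
      using \<rho>(1)[OF n(1)] \<rho>(1)[OF n(2)] \<rho>(1)[OF nn] x
      by (simp add: U.smult_l_distr a_minus_def U.M.minus_add U.M.a_assoc)
  next
    fix n x x' assume n: "n \<in> carrier (quot_right A I)" and x: "x \<in> carrier U" "x' \<in> carrier U"
    have "\<rho> n \<odot>\<^bsub>U\<^esub> (x \<oplus>\<^bsub>U\<^esub> x') \<ominus>\<^bsub>U\<^esub> \<rho> n \<odot>\<^bsub>U\<^esub> x \<ominus>\<^bsub>U\<^esub> \<rho> n \<odot>\<^bsub>U\<^esub> x' = \<zero>\<^bsub>U\<^esub>"
      using \<rho>(1)[OF n] x
      by (simp add: U.smult_r_distr a_minus_def U.M.a_comm[of "\<rho> n \<odot>\<^bsub>U\<^esub> x"] U.M.a_assoc U.M.r_neg)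
    then show "\<rho> n \<odot>\<^bsub>U\<^esub> (x \<oplus>\<^bsub>U\<^esub> x') \<ominus>\<^bsub>U\<^esub> \<rho> n \<odot>\<^bsub>U\<^esub> x \<ominus>\<^bsub>U\<^esub> \<rho> n \<odot>\<^bsub>U\<^esub> x' \<in> ideal_smult I U"
      using ideal_smult.zero by simp
  next
    fix a n x assume a: "a \<in> carrier A" and n: "n \<in> carrier (quot_right A I)" and x: "x \<in> carrier U"
    note na = T.closed(3)[OF a n]
    have "I +>\<^bsub>A\<^esub> (\<rho> n \<otimes>\<^bsub>A\<^esub> a) = a \<odot>\<^bsub>quot_right A I\<^esub> n"
      using I.rcoset_mult_add[OF \<rho>(1)[OF n] a] \<rho>(2)[OF n] by simp
    then have "\<rho> (a \<odot>\<^bsub>quot_right A I\<^esub> n) \<odot>\<^bsub>U\<^esub> x \<ominus>\<^bsub>U\<^esub> (\<rho> n \<otimes>\<^bsub>A\<^esub> a) \<odot>\<^bsub>U\<^esub> x \<in> ideal_smult I U"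
      using \<rho>(1) \<rho>(2)[OF na] n na x a by (intro diffI) simp_all
    then show "\<rho> (a \<odot>\<^bsub>quot_right A I\<^esub> n) \<odot>\<^bsub>U\<^esub> x \<ominus>\<^bsub>U\<^esub> \<rho> n \<odot>\<^bsub>U\<^esub> (a \<odot>\<^bsub>U\<^esub> x) \<in> ideal_smult I U"
      using \<rho>(1)[OF n] a x by (simp add: U.smult_assoc1)
  qed (use \<rho> in auto)
  then have "\<rho> (I +>\<^bsub>A\<^esub> \<one>\<^bsub>A\<^esub>) \<odot>\<^bsub>U\<^esub> u \<in> ideal_smult I U"
    using \<rho>(1)[OF coset_in_quot_right[OF I.one_closed]] u
    by (simp add: frag_eval_frag_of[OF U.M.abelian_group_axioms])
  moreover have "\<one>\<^bsub>A\<^esub> \<odot>\<^bsub>U\<^esub> u \<ominus>\<^bsub>U\<^esub> \<rho> (I +>\<^bsub>A\<^esub> \<one>\<^bsub>A\<^esub>) \<odot>\<^bsub>U\<^esub> u \<in> ideal_smult I U"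
    using \<rho>[OF coset_in_quot_right[OF I.one_closed]] u by (intro diffI) simp_all
  moreover have "u = (\<one>\<^bsub>A\<^esub> \<odot>\<^bsub>U\<^esub> u \<ominus>\<^bsub>U\<^esub> \<rho> (I +>\<^bsub>A\<^esub> \<one>\<^bsub>A\<^esub>) \<odot>\<^bsub>U\<^esub> u) \<oplus>\<^bsub>U\<^esub> \<rho> (I +>\<^bsub>A\<^esub> \<one>\<^bsub>A\<^esub>) \<odot>\<^bsub>U\<^esub> u"
    using \<rho>(1)[OF coset_in_quot_right[OF I.one_closed]] u by (simp add: a_minus_def U.M.a_assoc U.M.l_neg)
  ultimately show "u \<in> ideal_smult I U" using ideal_smult_add[OF I U] by metis
qed (rule quot_proj_ideal_smult)

lemma quot_proj_eq_iff:
  assumes u: "u \<in> carrier U" and v: "v \<in> carrier U"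
  shows "quot_proj A I U u = quot_proj A I U v \<longleftrightarrow> u \<ominus>\<^bsub>U\<^esub> v \<in> ideal_smult I U"
proof -
  have c: "quot_proj A I U x \<in> carrier (tensor A (quot_right A I) U)" if "x \<in> carrier U" for x
    using quot_proj_closed[OF that] by (simp add: quot_tensor_simps)
  have "u \<ominus>\<^bsub>U\<^esub> v \<in> ideal_smult I U \<longleftrightarrow> quot_proj A I U (u \<ominus>\<^bsub>U\<^esub> v) = \<zero>\<^bsub>quot_tensor A I U\<^esub>"
    using quot_proj_eq_zero_iff[of "u \<ominus>\<^bsub>U\<^esub> v"] u v by simp
  also have "\<dots> \<longleftrightarrow> quot_proj A I U u = quot_proj A I U v"
    using TG.diff_eq_zero_iff[OF c[OF u] c[OF v]] by (simp add: quot_proj_diff[OF u v] quot_tensor_simps)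
  finally show ?thesis by simp
qed

lemma quot_proj_smult:
  assumes a: "a \<in> carrier A" and u: "u \<in> carrier U"
  shows "(I +>\<^bsub>A\<^esub> a) \<odot>\<^bsub>quot_tensor A I U\<^esub> quot_proj A I U u = quot_proj A I U (a \<odot>\<^bsub>U\<^esub> u)"
proof -
  let ?B = "A Quot I"
  interpret B: ring ?B by (rule I.quotient_is_ring)
  have car: "carrier (quot_right A I) = carrier ?B" by (simp add: FactRing_def)
  have add: "n \<oplus>\<^bsub>quot_right A I\<^esub> n' = n \<oplus>\<^bsub>?B\<^esub> n'" for n n' by (simp add: FactRing_def)
  have sm: "b \<odot>\<^bsub>quot_right A I\<^esub> n = n \<otimes>\<^bsub>?B\<^esub> (I +>\<^bsub>A\<^esub> b)" for b n by (simp add: FactRing_def)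
  note aB = coset_in_Quot[OF a] and oneB = coset_in_Quot[OF I.one_closed]
  have "tensor_lift (tensor A (quot_right A I) U)
      (\<lambda>n x. pure_tensor A (quot_right A I) U ((I +>\<^bsub>A\<^esub> a) \<otimes>\<^bsub>?B\<^esub> n) x)
      (pure_tensor A (quot_right A I) U (I +>\<^bsub>A\<^esub> \<one>\<^bsub>A\<^esub>) u) =
    pure_tensor A (quot_right A I) U ((I +>\<^bsub>A\<^esub> a) \<otimes>\<^bsub>?B\<^esub> (I +>\<^bsub>A\<^esub> \<one>\<^bsub>A\<^esub>)) u"
  proof (rule T.tensor_lift_pure[OF TG.abelian_group_axioms])
    fix n n' x assume n: "n \<in> carrier (quot_right A I)" "n' \<in> carrier (quot_right A I)" and x: "x \<in> carrier U"
    note n' = n[unfolded car]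
    have p: "(I +>\<^bsub>A\<^esub> a) \<otimes>\<^bsub>?B\<^esub> m \<in> carrier (quot_right A I)" if "m \<in> carrier ?B" for m
      unfolding car using aB that by simp
    show "pure_tensor A (quot_right A I) U ((I +>\<^bsub>A\<^esub> a) \<otimes>\<^bsub>?B\<^esub> (n \<oplus>\<^bsub>quot_right A I\<^esub> n')) x =
        pure_tensor A (quot_right A I) U ((I +>\<^bsub>A\<^esub> a) \<otimes>\<^bsub>?B\<^esub> n) x
        \<oplus>\<^bsub>tensor A (quot_right A I) U\<^esub> pure_tensor A (quot_right A I) U ((I +>\<^bsub>A\<^esub> a) \<otimes>\<^bsub>?B\<^esub> n') x"
      unfolding T.pure_add_left[OF p[OF n'(1)] p[OF n'(2)] x, symmetric] add
      using aB n' by (simp add: B.r_distr)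
  next
    fix n x x' assume n: "n \<in> carrier (quot_right A I)" and x: "x \<in> carrier U" "x' \<in> carrier U"
    have "(I +>\<^bsub>A\<^esub> a) \<otimes>\<^bsub>?B\<^esub> n \<in> carrier (quot_right A I)" using aB n unfolding car by simp
    then show "pure_tensor A (quot_right A I) U ((I +>\<^bsub>A\<^esub> a) \<otimes>\<^bsub>?B\<^esub> n) (x \<oplus>\<^bsub>U\<^esub> x') =
        pure_tensor A (quot_right A I) U ((I +>\<^bsub>A\<^esub> a) \<otimes>\<^bsub>?B\<^esub> n) x
        \<oplus>\<^bsub>tensor A (quot_right A I) U\<^esub> pure_tensor A (quot_right A I) U ((I +>\<^bsub>A\<^esub> a) \<otimes>\<^bsub>?B\<^esub> n) x'"
      by (rule T.pure_add_right[OF _ x])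
  next
    fix b n x assume b: "b \<in> carrier A" and n: "n \<in> carrier (quot_right A I)" and x: "x \<in> carrier U"
    have "(I +>\<^bsub>A\<^esub> a) \<otimes>\<^bsub>?B\<^esub> n \<in> carrier (quot_right A I)" using aB n unfolding car by simp
    from T.pure_balanced[OF b this x]
    show "pure_tensor A (quot_right A I) U ((I +>\<^bsub>A\<^esub> a) \<otimes>\<^bsub>?B\<^esub> (b \<odot>\<^bsub>quot_right A I\<^esub> n)) x =
        pure_tensor A (quot_right A I) U ((I +>\<^bsub>A\<^esub> a) \<otimes>\<^bsub>?B\<^esub> n) (b \<odot>\<^bsub>U\<^esub> x)"
      unfolding sm using aB n[unfolded car] coset_in_Quot[OF b] by (simp add: B.m_assoc)
  next
    fix n x assume n: "n \<in> carrier (quot_right A I)" and x: "x \<in> carrier U"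
    show "pure_tensor A (quot_right A I) U ((I +>\<^bsub>A\<^esub> a) \<otimes>\<^bsub>?B\<^esub> n) x \<in> carrier (tensor A (quot_right A I) U)"
      by (rule T.pure_closed[OF _ x]) (use aB n in \<open>unfold car, simp\<close>)
  qed (use coset_in_quot_right[OF I.one_closed] u in auto)
  also have "\<dots> = quot_proj A I U (a \<odot>\<^bsub>U\<^esub> u)"
    using Quot_coset_simps(2)[OF I a I.one_closed] pure_eq_quot_proj[OF a u] a by simp
  finally show ?thesis by (simp add: quot_tensor_simps quot_proj_def)
qed

lemma quot_tensor_left_module: "left_module (A Quot I) (quot_tensor A I U)"
proof (rule left_moduleI)
  show "ring (A Quot I)" by (rule I.quotient_is_ring)
  note s = quot_proj_smult and c = quot_proj_closed and q = Quot_coset_simps[OF I]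
  show "\<zero>\<^bsub>quot_tensor A I U\<^esub> \<in> carrier (quot_tensor A I U)" by (simp add: quot_tensor_simps)
  fix x assume x: "x \<in> carrier (quot_tensor A I U)"
  then obtain u where u: "u \<in> carrier U" "x = quot_proj A I U u" by (auto simp: quot_proj_surj)
  show "\<exists>y\<in>carrier (quot_tensor A I U). y \<oplus>\<^bsub>quot_tensor A I U\<^esub> x = \<zero>\<^bsub>quot_tensor A I U\<^esub>"
    using x TG.l_neg by (auto simp: quot_tensor_simps)
  show "\<zero>\<^bsub>quot_tensor A I U\<^esub> \<oplus>\<^bsub>quot_tensor A I U\<^esub> x = x" using x by (simp add: quot_tensor_simps)
  show "\<one>\<^bsub>A Quot I\<^esub> \<odot>\<^bsub>quot_tensor A I U\<^esub> x = x"
    using u s[OF I.one_closed u(1)] by (simp add: q(3)[OF I.one_closed I.one_closed])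
  {
    fix y assume y: "y \<in> carrier (quot_tensor A I U)"
    then obtain v where v: "v \<in> carrier U" "y = quot_proj A I U v" by (auto simp: quot_proj_surj)
    show "x \<oplus>\<^bsub>quot_tensor A I U\<^esub> y \<in> carrier (quot_tensor A I U)" using x y by (simp add: quot_tensor_simps)
    show "x \<oplus>\<^bsub>quot_tensor A I U\<^esub> y = y \<oplus>\<^bsub>quot_tensor A I U\<^esub> x"
      using x y by (simp add: quot_tensor_simps TG.a_comm)
    show "x \<oplus>\<^bsub>quot_tensor A I U\<^esub> y \<oplus>\<^bsub>quot_tensor A I U\<^esub> z = x \<oplus>\<^bsub>quot_tensor A I U\<^esub> (y \<oplus>\<^bsub>quot_tensor A I U\<^esub> z)"
      if "z \<in> carrier (quot_tensor A I U)" for z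
      using x y that by (simp add: quot_tensor_simps TG.a_assoc)
    fix b assume "b \<in> carrier (A Quot I)"
    then obtain a where a: "a \<in> carrier A" "b = I +>\<^bsub>A\<^esub> a" by (auto simp: carrier_Quot)
    show "b \<odot>\<^bsub>quot_tensor A I U\<^esub> (x \<oplus>\<^bsub>quot_tensor A I U\<^esub> y) =
        b \<odot>\<^bsub>quot_tensor A I U\<^esub> x \<oplus>\<^bsub>quot_tensor A I U\<^esub> b \<odot>\<^bsub>quot_tensor A I U\<^esub> y"
      using u v a by (simp add: s U.smult_r_distr flip: quot_proj_add)
  }
  fix b assume "b \<in> carrier (A Quot I)"
  then obtain a where a: "a \<in> carrier A" "b = I +>\<^bsub>A\<^esub> a" by (auto simp: carrier_Quot)
  show "b \<odot>\<^bsub>quot_tensor A I U\<^esub> x \<in> carrier (quot_tensor A I U)" using u a by (simp add: s c)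
  fix b' assume "b' \<in> carrier (A Quot I)"
  then obtain a' where a': "a' \<in> carrier A" "b' = I +>\<^bsub>A\<^esub> a'" by (auto simp: carrier_Quot)
  show "(b \<oplus>\<^bsub>A Quot I\<^esub> b') \<odot>\<^bsub>quot_tensor A I U\<^esub> x =
      b \<odot>\<^bsub>quot_tensor A I U\<^esub> x \<oplus>\<^bsub>quot_tensor A I U\<^esub> b' \<odot>\<^bsub>quot_tensor A I U\<^esub> x"
    using u a a' by (simp add: s q U.smult_l_distr flip: quot_proj_add)
  show "(b \<otimes>\<^bsub>A Quot I\<^esub> b') \<odot>\<^bsub>quot_tensor A I U\<^esub> x = b \<odot>\<^bsub>quot_tensor A I U\<^esub> (b' \<odot>\<^bsub>quot_tensor A I U\<^esub> x)"
    using u a a' by (simp add: s q U.smult_assoc1)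
qed

text \<open>Linear maps out of \<open>A/I \<otimes>\<^sub>A U\<close> are determined on the elements \<open>1 \<otimes> u\<close>.\<close>

lemma quot_tensor_lin_homI:
  assumes "\<And>u. u \<in> carrier U \<Longrightarrow> h (quot_proj A I U u) = k u" "k \<in> lin_hom A U (inflate A I V)"
  shows "h \<in> lin_hom (A Quot I) (quot_tensor A I U) V"
proof (rule lin_homI)
  note kD = lin_homD[OF assms(2)]
  fix x assume "x \<in> carrier (quot_tensor A I U)"
  then obtain u where u: "u \<in> carrier U" "x = quot_proj A I U u" by (auto simp: quot_proj_surj)
  show "h x \<in> carrier V" using u assms(1) kD(1)[of u] by simp
  show "h (b \<odot>\<^bsub>quot_tensor A I U\<^esub> x) = b \<odot>\<^bsub>V\<^esub> h x" if "b \<in> carrier (A Quot I)" for b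
    using that u assms(1) kD(3)[of _ u] by (auto simp: carrier_Quot quot_proj_smult)
  fix y assume "y \<in> carrier (quot_tensor A I U)"
  then obtain v where v: "v \<in> carrier U" "y = quot_proj A I U v" by (auto simp: quot_proj_surj)
  show "h (x \<oplus>\<^bsub>quot_tensor A I U\<^esub> y) = h x \<oplus>\<^bsub>V\<^esub> h y"
    using u v assms(1) kD(2)[of u v] by (simp flip: quot_proj_add)
qed

lemma quot_proj_lin_hom: "quot_proj A I U \<in> lin_hom A U (inflate A I (quot_tensor A I U))"
  by (rule lin_homI) (simp_all add: quot_proj_closed quot_proj_add quot_proj_smult)

lemma quot_tensor_factor:
  assumes V: "left_module (A Quot I) V" and k: "k \<in> lin_hom A U (inflate A I V)"
  obtains h where "h \<in> lin_hom (A Quot I) (quot_tensor A I U) V"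
    "\<And>u. u \<in> carrier U \<Longrightarrow> h (quot_proj A I U u) = k u"
proof -
  note V' = inflate_left_module[OF I V]
  interpret V': left_module A "inflate A I V" by (rule V')
  define h where "h t = k (SOME u. u \<in> carrier U \<and> t = quot_proj A I U u)" for t
  have h: "h (quot_proj A I U u) = k u" if u: "u \<in> carrier U" for u
  proof -
    define v where "v = (SOME v. v \<in> carrier U \<and> quot_proj A I U u = quot_proj A I U v)"
    have v: "v \<in> carrier U" "quot_proj A I U u = quot_proj A I U v"
      using someI[of "\<lambda>v. v \<in> carrier U \<and> quot_proj A I U u = quot_proj A I U v" u] u by (auto simp: v_def)
    have "k (v \<ominus>\<^bsub>U\<^esub> u) = \<zero>\<^bsub>inflate A I V\<^esub>"
      by (rule annihilates_ideal_smult[OF I V' annihilates_inflate[OF I V] ideal_smult_lin_hom[OF I U V' k]])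
        (use quot_proj_eq_iff[OF v(1) u] v(2) in simp)
    then have "k v = k u"
      using V'.M.diff_eq_zero_iff[OF lin_homD(1)[OF k v(1)] lin_homD(1)[OF k u]]
      by (simp only: lin_hom_diff[OF U V' k v(1) u])
    then show ?thesis by (simp add: h_def v_def)
  qed
  show ?thesis by (rule that[OF quot_tensor_lin_homI[OF h k] h])
qed

end


lemma quot_tensor_map_proj:
  assumes I: "ideal I A" and U: "left_module A U" and V: "left_module A V"
    and f: "f \<in> lin_hom A U V" and u: "u \<in> carrier U"
  shows "quot_tensor_map A I V f (quot_proj A I U u) = quot_proj A I V (f u)"
proof -
  interpret I: ideal I A by fact
  interpret T: tensor_pair A "quot_right A I" U by (rule tensor_pair_quot_right[OF I U])
  interpret S: tensor_pair A "quot_right A I" V by (rule tensor_pair_quot_right[OF I V])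
  note fD = lin_homD[OF f]
  show ?thesis
    unfolding quot_tensor_map_def tensor_map_def quot_proj_def
    by (rule T.tensor_lift_pure[OF S.tensor_abelian_group])
      (use fD u in \<open>simp_all only: S.pure_closed S.pure_add_left S.pure_add_right S.pure_balanced
        coset_in_quot_right[OF I V I.one_closed]\<close>)
qed

lemma quot_tensor_ident_proj:
  assumes I: "ideal I A" and M: "left_module (A Quot I) M" and m: "m \<in> carrier M"
  shows "quot_tensor_ident M (quot_proj A I (inflate A I M) m) = m"
proof -
  interpret I: ideal I A by fact
  interpret M: left_module "A Quot I" M by fact
  interpret T: tensor_pair A "quot_right A I" "inflate A I M"
    by (rule tensor_pair_quot_right[OF I inflate_left_module[OF I M]])
  have car: "carrier (quot_right A I) = carrier (A Quot I)" by (simp add: FactRing_def)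
  have "tensor_lift M (\<lambda>b x. b \<odot>\<^bsub>M\<^esub> x) (pure_tensor A (quot_right A I) (inflate A I M) (I +>\<^bsub>A\<^esub> \<one>\<^bsub>A\<^esub>) m) =
      (I +>\<^bsub>A\<^esub> \<one>\<^bsub>A\<^esub>) \<odot>\<^bsub>M\<^esub> m"
  proof (rule T.tensor_lift_pure[OF M.M.abelian_group_axioms]; (unfold car inflate_simps)?)
    fix n n' x assume n: "n \<in> carrier (A Quot I)" "n' \<in> carrier (A Quot I)" and x: "x \<in> carrier M"
    show "(n \<oplus>\<^bsub>quot_right A I\<^esub> n') \<odot>\<^bsub>M\<^esub> x = n \<odot>\<^bsub>M\<^esub> x \<oplus>\<^bsub>M\<^esub> n' \<odot>\<^bsub>M\<^esub> x"
      using M.smult_l_distr[OF n x] by (simp add: FactRing_def)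
  next
    fix a n x assume a: "a \<in> carrier A" and n: "n \<in> carrier (A Quot I)" and x: "x \<in> carrier M"
    show "(a \<odot>\<^bsub>quot_right A I\<^esub> n) \<odot>\<^bsub>M\<^esub> x = n \<odot>\<^bsub>M\<^esub> ((I +>\<^bsub>A\<^esub> a) \<odot>\<^bsub>M\<^esub> x)"
      using M.smult_assoc1[OF n coset_in_Quot[OF a] x] by (simp add: FactRing_def)
  qed (use m coset_in_Quot[OF I.one_closed] in \<open>simp_all add: M.smult_r_distr\<close>)
  also have "\<dots> = m"
    using M.smult_one[OF m] Quot_coset_simps(3)[OF I I.one_closed I.one_closed] by simp
  finally show ?thesis by (simp add: quot_tensor_ident_def quot_proj_def)
qed

lemma quot_tensor_ident_iso:
  assumes I: "ideal I A" and M: "left_module (A Quot I) M"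
  shows "quot_tensor_ident M \<in> lin_hom (A Quot I) (quot_tensor A I (inflate A I M)) M"
    and "bij_betw (quot_tensor_ident M) (carrier (quot_tensor A I (inflate A I M))) (carrier M)"
proof -
  note M' = inflate_left_module[OF I M] and id = quot_tensor_ident_proj[OF I M]
  show "quot_tensor_ident M \<in> lin_hom (A Quot I) (quot_tensor A I (inflate A I M)) M"
    by (rule quot_tensor_lin_homI[OF I M' _ lin_hom_id]) (simp add: id)
  show "bij_betw (quot_tensor_ident M) (carrier (quot_tensor A I (inflate A I M))) (carrier M)"
    unfolding quot_proj_surj[OF I M']
    by (rule bij_betw_byWitness[where f' = "quot_proj A I (inflate A I M)"]) (auto simp: id)
qed

text \<open>An \<open>A/I\<close>-linear lifting problem for \<open>A/I \<otimes>\<^sub>A P\<close> is an \<open>A\<close>-linear one for \<open>P\<close>.\<close>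

lemma projective_quot_tensor:
  fixes P :: "('a, 'p, 'z) module_scheme"
  assumes I: "ideal I A" and P: "projective A P"
  shows "projective (A Quot I) (quot_tensor A I P)"
  unfolding projective_def
proof (intro conjI allI impI ballI)
  have PA: "left_module A P" using P by (simp add: projective_def)
  show "left_module (A Quot I) (quot_tensor A I P)" by (rule quot_tensor_left_module[OF I PA])
  fix U V :: "('a set, ('a set \<times> (('a set \<times> 'p) \<Rightarrow>\<^sub>0 int) set) list) module" and f g
  assume h: "left_module (A Quot I) U" "left_module (A Quot I) V" "f \<in> lin_hom (A Quot I) U V"
    "f ` carrier U = carrier V" "g \<in> lin_hom (A Quot I) (quot_tensor A I P) V"
  have "\<exists>k \<in> lin_hom A P (inflate A I U). \<forall>p\<in>carrier P. f (k p) = g (quot_proj A I P p)"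
    by (rule projective_lift[OF P inflate_left_module[OF I h(1)] inflate_left_module[OF I h(2)]
          inflate_lin_hom[OF h(3)] _ lin_hom_comp'[OF quot_proj_lin_hom[OF I PA] inflate_lin_hom[OF h(5)]]])
      (simp add: h(4))
  then obtain k where k: "k \<in> lin_hom A P (inflate A I U)" "\<And>p. p \<in> carrier P \<Longrightarrow> f (k p) = g (quot_proj A I P p)"
    by blast
  obtain l where "l \<in> lin_hom (A Quot I) (quot_tensor A I P) U" "\<And>p. p \<in> carrier P \<Longrightarrow> l (quot_proj A I P p) = k p"
    by (rule quot_tensor_factor[OF I PA h(1) k(1)]) blast
  then show "\<exists>l\<in>lin_hom (A Quot I) (quot_tensor A I P) U. \<forall>t\<in>carrier (quot_tensor A I P). f (l t) = g t"
    using k(2) by (intro bexI[of _ l]) (auto simp: quot_proj_surj[OF I PA])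
qed

section \<open>Relative torsion and acyclicity modulo \<open>I\<close>\<close>

lemma trivial_homology_exact:
  assumes "trivial_group (homology C d (Suc j))" and C: "abelian_group (C (Suc j))"
    and zero: "\<zero>\<^bsub>C (Suc j)\<^esub> \<in> d (Suc j) ` carrier (C (Suc (Suc j)))"
  shows "mod_ker (C (Suc j)) (C j) (d j) \<subseteq> d (Suc j) ` carrier (C (Suc (Suc j)))"
proof
  interpret C: abelian_group "C (Suc j)" by fact
  let ?D = "d (Suc j) ` carrier (C (Suc (Suc j)))"
  let ?G = "(add_monoid (C (Suc j)))\<lparr>carrier := mod_ker (C (Suc j)) (C j) (d j)\<rparr>"
  fix x assume x: "x \<in> mod_ker (C (Suc j)) (C j) (d j)"
  have "carrier (?G Mod ?D) = {?D}"
    using assms(1) by (simp add: trivial_group_def homology_def)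
  then have "?D #>\<^bsub>?G\<^esub> x = ?D" using x by (auto simp: carrier_FactGroup)
  moreover have "x \<in> ?D #>\<^bsub>?G\<^esub> x"
    unfolding r_coset_def by (rule UN_I[OF zero]) (use x in \<open>simp add: mod_ker_def\<close>)
  ultimately show "x \<in> ?D" by simp
qed

text \<open>A cycle in \<open>I C\<^sub>n\<close> is a boundary \<open>d x\<close>, and \<open>x\<close> is a cycle modulo \<open>I\<close>. As the homology modulo
  \<open>I\<close> vanishes, subtracting a boundary from \<open>x\<close> leads into \<open>I C\<^sub>n\<^sub>+\<^sub>1\<close>.\<close>

lemma rel_Tor_ideal_acyclic:
  assumes I: "ideal I A" and res: "split_resolution R A N C d e \<sigma> s"
    and Tor: "trivial_group (rel_Tor A (quot_right A I) C d (Suc n))"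
  shows "ideal_acyclic I N C d e n"
  unfolding ideal_acyclic_def
proof
  interpret split_resolution R A N C d e \<sigma> s by fact
  let ?T = "\<lambda>k. tensor A (quot_right A I) (C k)" and ?d = "\<lambda>k. tensor_map A (quot_right A I) (C k) (d k)"
  have Tc: "carrier (?T k) = quot_proj A I (C k) ` carrier (C k)" for k
    using quot_proj_surj[OF I C, of k] by (simp add: quot_tensor_simps)
  have Tz: "quot_proj A I (C k) x = \<zero>\<^bsub>?T k\<^esub> \<longleftrightarrow> x \<in> ideal_smult I (C k)" if "x \<in> carrier (C k)" for k x
    using quot_proj_eq_zero_iff[OF I C that] by (simp add: quot_tensor_simps)
  have Td: "?d k (quot_proj A I (C (Suc k)) x) = quot_proj A I (C k) (d k x)" if "x \<in> carrier (C (Suc k))" for k x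
    using quot_tensor_map_proj[OF I C C d that] by (simp add: quot_tensor_map_def)
  fix z assume "z \<in> ideal_smult I (C n) \<inter> cycles N C d e n"
  then have z: "z \<in> ideal_smult I (C n)" and zc: "z \<in> cycles N C d e n" by auto
  obtain x where x: "x \<in> carrier (C (Suc n))" "z = d n x" using zc d_image[of n] by auto
  have "quot_proj A I (C (Suc n)) x \<in> mod_ker (?T (Suc n)) (?T n) (?d n)"
    using x z Tz[OF lin_homD(1)[OF d x(1)]] by (simp add: mod_ker_def Tc Td)
  also have "\<dots> \<subseteq> ?d (Suc n) ` carrier (?T (Suc (Suc n)))"
  proof (rule trivial_homology_exact[OF Tor[unfolded rel_Tor_def]])
    show "abelian_group (?T (Suc n))"
      by (rule tensor_pair.tensor_abelian_group[OF tensor_pair_quot_right[OF I C]])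
    have z0: "\<zero>\<^bsub>C (Suc (Suc n))\<^esub> \<in> carrier (C (Suc (Suc n)))"
      by (rule abelian_monoid.zero_closed[OF left_moduleD(3)[OF C]])
    have "\<zero>\<^bsub>?T (Suc n)\<^esub> = ?d (Suc n) (quot_proj A I (C (Suc (Suc n))) \<zero>\<^bsub>C (Suc (Suc n))\<^esub>)"
      unfolding Td[OF z0] lin_hom_zero[OF C C d] using quot_proj_zero[OF I C] by (simp add: quot_tensor_simps)
    then show "\<zero>\<^bsub>?T (Suc n)\<^esub> \<in> ?d (Suc n) ` carrier (?T (Suc (Suc n)))"
      by (rule image_eqI) (use z0 Tc in blast)
  qed
  finally obtain y where y: "y \<in> carrier (C (Suc (Suc n)))"
      "quot_proj A I (C (Suc n)) x = quot_proj A I (C (Suc n)) (d (Suc n) y)"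
    by (auto simp: Tc Td)
  note dy = lin_homD(1)[OF d y(1)]
  have "x \<ominus>\<^bsub>C (Suc n)\<^esub> d (Suc n) y \<in> ideal_smult I (C (Suc n))"
    using quot_proj_eq_iff[OF I C x(1) dy] y(2) by simp
  moreover have "d n (x \<ominus>\<^bsub>C (Suc n)\<^esub> d (Suc n) y) = z"
  proof -
    interpret Cn: left_module A "C n" by (rule C)
    have "d n (x \<ominus>\<^bsub>C (Suc n)\<^esub> d (Suc n) y) = d n x \<ominus>\<^bsub>C n\<^esub> \<zero>\<^bsub>C n\<^esub>"
      using lin_hom_diff[OF C C d x(1) dy] d_d[OF y(1)] by simp
    then show ?thesis using x lin_homD(1)[OF d x(1)] by (simp add: a_minus_def)
  qed
  ultimately show "z \<in> d n ` ideal_smult I (C (Suc n))" by blast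
qed

text \<open>Conversely, reducing a resolution of an \<open>A/I\<close>-module modulo \<open>I\<close> preserves exactness if it is
  acyclic modulo \<open>I\<close>: a cycle modulo \<open>I\<close> can be corrected by an element of \<open>I P\<close> to a cycle.\<close>

lemma quotient_cycles:
  assumes I: "ideal I A" and M: "left_module (A Quot I) M"
    and res: "resolution A (inflate A I M) P d e"
    and acyc: "\<And>n. ideal_acyclic I (inflate A I M) P d e n"
  shows "cycles M (\<lambda>k. quot_tensor A I (P k)) (\<lambda>k. quot_tensor_map A I (P k) (d k))
    (quot_tensor_ident M \<circ> quot_tensor_map A I (inflate A I M) e) k =
    quot_proj A I (P k) ` cycles (inflate A I M) P d e k" (is "?Z = _")
proof -
  have r: "left_module A (inflate A I M)" "\<And>k. left_module A (P k)" "e \<in> lin_hom A (P 0) (inflate A I M)"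
      "\<And>k. d k \<in> lin_hom A (P (Suc k)) (P k)" "\<And>k. d k ` carrier (P (Suc k)) = cycles (inflate A I M) P d e k"
    using res by (simp_all add: resolution_iff_cycles)
  have e: "quot_tensor_ident M (quot_tensor_map A I (inflate A I M) e (quot_proj A I (P 0) p)) = e p"
    if "p \<in> carrier (P 0)" for p
    using quot_tensor_map_proj[OF I r(2) r(1) r(3) that] quot_tensor_ident_proj[OF I M] lin_homD(1)[OF r(3) that]
    by simp
  have d: "quot_tensor_map A I (P k) (d k) (quot_proj A I (P (Suc k)) p) = quot_proj A I (P k) (d k p)"
    if "p \<in> carrier (P (Suc k))" for k p
    by (rule quot_tensor_map_proj[OF I r(2) r(2) r(4) that])
  show ?thesis
  proof (cases k)
    case 0
    then show ?thesis by (auto simp: mod_ker_def quot_proj_surj[OF I r(2)] e)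
  next
    case (Suc j)
    interpret Pj: left_module A "P j" by (rule r(2))
    interpret PSj: left_module A "P (Suc j)" by (rule r(2))
    show ?thesis
    proof
      show "quot_proj A I (P k) ` cycles (inflate A I M) P d e k \<subseteq> ?Z"
        using Suc by (auto simp: mod_ker_def quot_proj_surj[OF I r(2)] d quot_proj_zero[OF I r(2)])
      show "?Z \<subseteq> quot_proj A I (P k) ` cycles (inflate A I M) P d e k"
      proof
        fix t assume "t \<in> ?Z"
        then obtain p where p: "p \<in> carrier (P (Suc j))" "t = quot_proj A I (P (Suc j)) p"
            "quot_proj A I (P j) (d j p) = \<zero>\<^bsub>quot_tensor A I (P j)\<^esub>"
          using Suc by (auto simp: mod_ker_def quot_proj_surj[OF I r(2)] d)
        note dp = lin_homD(1)[OF r(4) p(1)]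
        have "d j p \<in> cycles (inflate A I M) P d e j" using r(5)[of j] p(1) by blast
        moreover have "d j p \<in> ideal_smult I (P j)" using quot_proj_eq_zero_iff[OF I r(2) dp] p(3) by simp
        ultimately obtain w where w: "w \<in> ideal_smult I (P (Suc j))" "d j p = d j w"
          using acyc[of j] unfolding ideal_acyclic_def by blast
        note wP = ideal_smult_closed[OF I r(2) w(1)]
        have "d j (p \<ominus>\<^bsub>P (Suc j)\<^esub> w) = \<zero>\<^bsub>P j\<^esub>"
          using lin_hom_diff[OF r(2) r(2) r(4) p(1) wP] w(2) Pj.M.diff_eq_zero_iff lin_homD(1)[OF r(4) wP] by simp
        moreover have "t = quot_proj A I (P (Suc j)) (p \<ominus>\<^bsub>P (Suc j)\<^esub> w)"
        proof -
          have "p \<ominus>\<^bsub>P (Suc j)\<^esub> (p \<ominus>\<^bsub>P (Suc j)\<^esub> w) = w"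
            using PSj.M.eq_diffI[of w "p \<ominus>\<^bsub>P (Suc j)\<^esub> w" p] PSj.M.diff_add_cancel[OF p(1) wP] p(1) wP
            by (simp add: PSj.M.a_comm)
          then show ?thesis using quot_proj_eq_iff[OF I r(2) p(1), of "p \<ominus>\<^bsub>P (Suc j)\<^esub> w"] p(1,2) w(1) wP by simp
        qed
        ultimately show "t \<in> quot_proj A I (P k) ` cycles (inflate A I M) P d e k"
          using Suc p(1) wP by (intro image_eqI) (auto simp: mod_ker_def)
      qed
    qed
  qed
qed

lemma quotient_resolution:
  assumes I: "ideal I A" and M: "left_module (A Quot I) M"
    and res: "resolution A (inflate A I M) P d e"
    and acyc: "\<And>n. ideal_acyclic I (inflate A I M) P d e n"
  shows "resolution (A Quot I) M (\<lambda>k. quot_tensor A I (P k)) (\<lambda>k. quot_tensor_map A I (P k) (d k))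
    (quot_tensor_ident M \<circ> quot_tensor_map A I (inflate A I M) e)"
  unfolding resolution_iff_cycles quotient_cycles[OF I M res acyc]
proof (intro conjI allI)
  have r: "left_module A (inflate A I M)" "\<And>k. left_module A (P k)" "e \<in> lin_hom A (P 0) (inflate A I M)"
      "\<And>k. d k \<in> lin_hom A (P (Suc k)) (P k)" "e ` carrier (P 0) = carrier (inflate A I M)"
      "\<And>k. d k ` carrier (P (Suc k)) = cycles (inflate A I M) P d e k"
    using res by (simp_all add: resolution_iff_cycles)
  have e: "(quot_tensor_ident M \<circ> quot_tensor_map A I (inflate A I M) e) (quot_proj A I (P 0) p) = e p"
    if "p \<in> carrier (P 0)" for p
    using quot_tensor_map_proj[OF I r(2) r(1) r(3) that] quot_tensor_ident_proj[OF I M] lin_homD(1)[OF r(3) that]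
    by simp
  have d: "quot_tensor_map A I (P k) (d k) (quot_proj A I (P (Suc k)) p) = quot_proj A I (P k) (d k p)"
    if "p \<in> carrier (P (Suc k))" for k p
    by (rule quot_tensor_map_proj[OF I r(2) r(2) r(4) that])
  show "left_module (A Quot I) M" by (rule M)
  show "left_module (A Quot I) (quot_tensor A I (P k))" for k by (rule quot_tensor_left_module[OF I r(2)])
  show "quot_tensor_ident M \<circ> quot_tensor_map A I (inflate A I M) e \<in> lin_hom (A Quot I) (quot_tensor A I (P 0)) M"
    by (rule quot_tensor_lin_homI[OF I r(2) e r(3)])
  show "quot_tensor_map A I (P k) (d k) \<in> lin_hom (A Quot I) (quot_tensor A I (P (Suc k))) (quot_tensor A I (P k))" for k
    by (rule quot_tensor_lin_homI[OF I r(2) d lin_hom_comp'[OF r(4) quot_proj_lin_hom[OF I r(2)]]])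
  show "(quot_tensor_ident M \<circ> quot_tensor_map A I (inflate A I M) e) ` carrier (quot_tensor A I (P 0)) = carrier M"
    using r(5) by (simp add: quot_proj_surj[OF I r(2)] image_image e[unfolded comp_def] cong: image_cong_simp)
  show "quot_tensor_map A I (P k) (d k) ` carrier (quot_tensor A I (P (Suc k))) =
      quot_proj A I (P k) ` cycles (inflate A I M) P d e k" for k
    by (simp add: quot_proj_surj[OF I r(2)] image_image d r(6)[symmetric] cong: image_cong_simp)
qed

section \<open>Minimality\<close>

lemma submodule_left_moduleI:
  assumes U: "left_module A U" and "H \<subseteq> carrier U" "\<zero>\<^bsub>U\<^esub> \<in> H"
    and "\<And>x y. \<lbrakk>x \<in> H; y \<in> H\<rbrakk> \<Longrightarrow> x \<oplus>\<^bsub>U\<^esub> y \<in> H"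
    and sm: "\<And>a x. \<lbrakk>a \<in> carrier A; x \<in> H\<rbrakk> \<Longrightarrow> a \<odot>\<^bsub>U\<^esub> x \<in> H"
  shows "submodule H A U"
proof -
  interpret U: left_module A U by fact
  have "\<ominus>\<^bsub>U\<^esub> x \<in> H" if "x \<in> H" for x
    using sm[OF U.A.a_inv_closed[OF U.A.one_closed] that] U.smult_minus_one[of x] that assms(2) by auto
  then have "subgroup H (add_monoid U)"
    by (intro subgroup.intro) (use assms in \<open>auto simp flip: a_inv_def\<close>)
  then show ?thesis using sm by (simp add: submodule_def submodule_axioms_def)
qed

lemma submoduleD:
  assumes "submodule H A U"
  shows "H \<subseteq> carrier U" "\<zero>\<^bsub>U\<^esub> \<in> H" "\<And>x y. \<lbrakk>x \<in> H; y \<in> H\<rbrakk> \<Longrightarrow> x \<oplus>\<^bsub>U\<^esub> y \<in> H"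
    "\<And>a x. \<lbrakk>a \<in> carrier A; x \<in> H\<rbrakk> \<Longrightarrow> a \<odot>\<^bsub>U\<^esub> x \<in> H"
proof -
  have s: "subgroup H (add_monoid U)" and "submodule_axioms H A U"
    using assms by (simp_all add: submodule_def)
  then show "\<And>a x. \<lbrakk>a \<in> carrier A; x \<in> H\<rbrakk> \<Longrightarrow> a \<odot>\<^bsub>U\<^esub> x \<in> H" by (simp add: submodule_axioms_def)
  show "H \<subseteq> carrier U" "\<zero>\<^bsub>U\<^esub> \<in> H" "\<And>x y. \<lbrakk>x \<in> H; y \<in> H\<rbrakk> \<Longrightarrow> x \<oplus>\<^bsub>U\<^esub> y \<in> H"
    using subgroup.subset[OF s] subgroup.one_closed[OF s] subgroup.m_closed[OF s] by simp_all
qed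

text \<open>A submodule of \<open>U / I U\<close> that together with the image of \<open>H\<close> spans everything has a preimage
  that contains \<open>I U\<close> and together with \<open>H\<close> spans \<open>U\<close>.\<close>

lemma superfluous_quot_tensor:
  assumes I: "ideal I A" and U: "left_module A U" and sup: "superfluous A H U"
  shows "superfluous (A Quot I) (quot_proj A I U ` H) (quot_tensor A I U)"
  unfolding superfluous_def
proof (intro conjI allI impI)
  interpret U: left_module A U by fact
  interpret T: left_module "A Quot I" "quot_tensor A I U" by (rule quot_tensor_left_module[OF I U])
  note q = quot_proj_lin_hom[OF I U] and qs = quot_proj_smult[OF I U] and qa = quot_proj_add[OF I U]
  have H: "submodule H A U" using sup by (simp add: superfluous_def)
  note HD = submoduleD[OF H]
  have HU: "x \<in> H \<Longrightarrow> x \<in> carrier U" for x using HD(1) by blast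
  show "submodule (quot_proj A I U ` H) (A Quot I) (quot_tensor A I U)"
  proof (rule submodule_left_moduleI[OF quot_tensor_left_module[OF I U]])
    show "quot_proj A I U ` H \<subseteq> carrier (quot_tensor A I U)" using HU quot_proj_closed[OF I U] by blast
    show "\<zero>\<^bsub>quot_tensor A I U\<^esub> \<in> quot_proj A I U ` H"
      by (rule image_eqI, rule quot_proj_zero[OF I U, symmetric], rule HD(2))
    show "x \<oplus>\<^bsub>quot_tensor A I U\<^esub> y \<in> quot_proj A I U ` H"
      if "x \<in> quot_proj A I U ` H" "y \<in> quot_proj A I U ` H" for x y
      using that HD(3) HU by (auto simp flip: qa)
    show "b \<odot>\<^bsub>quot_tensor A I U\<^esub> x \<in> quot_proj A I U ` H"
      if "b \<in> carrier (A Quot I)" "x \<in> quot_proj A I U ` H" for b x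
      using that HD(4) HU by (auto simp: carrier_Quot qs)
  qed
  fix S assume S: "submodule S (A Quot I) (quot_tensor A I U) \<and>
    quot_proj A I U ` H <+>\<^bsub>quot_tensor A I U\<^esub> S = carrier (quot_tensor A I U)"
  note SD = submoduleD[OF conjunct1[OF S]]
  define S' where "S' = {u \<in> carrier U. quot_proj A I U u \<in> S}"
  have S': "submodule S' A U"
    by (rule submodule_left_moduleI[OF U])
      (use SD(2,3) SD(4)[OF coset_in_Quot] in \<open>auto simp: S'_def quot_proj_zero[OF I U] qa simp flip: qs\<close>)
  have "carrier U \<subseteq> H <+>\<^bsub>U\<^esub> S'"
  proof
    fix u assume u: "u \<in> carrier U"
    have "quot_proj A I U u \<in> quot_proj A I U ` H <+>\<^bsub>quot_tensor A I U\<^esub> S"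
      using S quot_proj_closed[OF I U u] by blast
    then obtain h t where h: "h \<in> H" and t: "t \<in> S"
        and eq: "quot_proj A I U u = quot_proj A I U h \<oplus>\<^bsub>quot_tensor A I U\<^esub> t"
      by (auto simp: set_add_def')
    obtain v where v: "v \<in> carrier U" "t = quot_proj A I U v"
      using t SD(1) quot_proj_surj[OF I U] by auto
    have "quot_proj A I U (u \<ominus>\<^bsub>U\<^esub> h) = t"
    proof -
      note c = quot_proj_closed[OF I U]
      have uh: "u \<ominus>\<^bsub>U\<^esub> h \<in> carrier U" using u HU[OF h] by simp
      have "quot_proj A I U (u \<ominus>\<^bsub>U\<^esub> h) = quot_proj A I U u \<ominus>\<^bsub>quot_tensor A I U\<^esub> quot_proj A I U h"
        by (rule T.M.eq_diffI[OF c[OF uh] c[OF HU[OF h]]])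
          (simp only: qa[OF uh HU[OF h], symmetric] U.M.diff_add_cancel[OF u HU[OF h]])
      moreover have "t = quot_proj A I U u \<ominus>\<^bsub>quot_tensor A I U\<^esub> quot_proj A I U h"
        by (rule T.M.eq_diffI[OF _ c[OF HU[OF h]]])
          (use eq v c HU[OF h] in \<open>simp_all add: T.M.a_comm\<close>)
      ultimately show ?thesis by simp
    qed
    then have "u \<ominus>\<^bsub>U\<^esub> h \<in> S'" using t u HU[OF h] by (simp add: S'_def)
    moreover have "u = h \<oplus>\<^bsub>U\<^esub> (u \<ominus>\<^bsub>U\<^esub> h)"
      using U.M.diff_add_cancel[OF u HU[OF h]] u HU[OF h] by (simp add: U.M.a_comm)
    ultimately show "u \<in> H <+>\<^bsub>U\<^esub> S'" using h by (auto simp: set_add_def')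
  qed
  moreover have "H <+>\<^bsub>U\<^esub> S' \<subseteq> carrier U" using HU by (auto simp: set_add_def' S'_def)
  ultimately have "S' = carrier U" using sup S' by (auto simp: superfluous_def)
  then show "S = carrier (quot_tensor A I U)"
    using SD(1) by (auto simp: quot_proj_surj[OF I U] S'_def)
qed

lemma minimal_iff_cycles:
  "minimal_projective_resolution A N P d e \<longleftrightarrow> projective_resolution A N P d e \<and>
    (\<forall>k. superfluous A (cycles N P d e k) (P k))"
proof -
  have nat: "(\<forall>k. p k) \<longleftrightarrow> p 0 \<and> (\<forall>k. p (Suc k))" for p :: "nat \<Rightarrow> bool"
    using nat_induct[of p] by blast
  show ?thesis
    unfolding minimal_projective_resolution_def nat[of "\<lambda>k. superfluous A (cycles N P d e k) (P k)"] by simp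
qed

section \<open>Reduction of projective resolutions modulo \<open>I\<close>\<close>

text \<open>The left and right multiplications by scalars from \<open>R\<close> agree, so one-sidedness is immaterial
  for projectivity over \<open>R\<close>.\<close>

lemma scalars_regular_projective:
  assumes R: "assoc_algebra R A" and P: "right_projective R (scalars A (right_regular A))"
  shows "projective R (scalars A (left_regular A))"
proof -
  interpret R: assoc_algebra R A by fact
  show ?thesis
    by (rule projective_cong[OF projective_opp_ring[OF R.R.cring_axioms P[unfolded right_projective_def]]
          scalars_left_module[OF R left_regular_left_module[OF R.ring_axioms]]])
      (simp_all add: left_regular_def right_regular_def R.scalar_one_mult(1)
        del: left_regular_simps right_regular_simps)
qed

lemma scalars_quot_projective:
  assumes R: "assoc_algebra R A" and I: "ideal I A" and B: "left_module A (quot_left A I)"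
    and P: "right_projective R (scalars A (quot_right A I))"
  shows "projective R (scalars A (quot_left A I))"
proof -
  interpret R: assoc_algebra R A by fact
  interpret I: ideal I A by fact
  show ?thesis
  proof (rule projective_cong[OF projective_opp_ring[OF R.R.cring_axioms P[unfolded right_projective_def]]
        scalars_left_module[OF R B]])
    show "add (scalars A (quot_left A I)) = add (scalars A (quot_right A I))"
      by (simp add: fun_eq_iff)
    fix r x assume r: "r \<in> carrier R" and "x \<in> carrier (scalars A (quot_right A I))"
    then obtain a where "a \<in> carrier A" "x = I +>\<^bsub>A\<^esub> a" by (auto simp: A_RCOSETS_def')
    then show "r \<odot>\<^bsub>scalars A (quot_left A I)\<^esub> x = r \<odot>\<^bsub>scalars A (quot_right A I)\<^esub> x"
      using r by (simp add: I.rcoset_mult_add R.scalar_one_mult(1))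
  qed simp
qed

theorem theorem4p3:
  fixes R :: "('r, 'v) ring_scheme"
    and A :: "('r, 'a, 'w) module_scheme"
    and I :: "'a set"
    and Q :: "nat \<Rightarrow> ('a, 'q, 'u) module_scheme"
    and dQ :: "nat \<Rightarrow> 'q \<Rightarrow> 'q"
    and eQ :: "'q \<Rightarrow> 'a set"
    and M :: "('a set, 'm, 'y) module_scheme"
    and P :: "nat \<Rightarrow> ('a, 'p, 'z) module_scheme"
    and d :: "nat \<Rightarrow> 'p \<Rightarrow> 'p"
    and e :: "'p \<Rightarrow> 'm"
  assumes "assoc_algebra R A"
    and "free_module R A"
    and "ideal I A"
    and "right_projective R (scalars A (right_regular A))"
    and "right_projective R (scalars A (quot_right A I))"
    and "rel_projective_resolution R A (quot_left A I) Q dQ eQ"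
    and "\<forall>k\<ge>1. trivial_group (rel_Tor A (quot_right A I) Q dQ k)"
    and "left_module (A Quot I) M"
    and "free_module R (scalars A (inflate A I M))"
    and "projective_resolution A (inflate A I M) P d e"
  shows "quot_tensor_ident M \<in> lin_hom (A Quot I) (quot_tensor A I (inflate A I M)) M \<and>
         bij_betw (quot_tensor_ident M) (carrier (quot_tensor A I (inflate A I M))) (carrier M) \<and>
         projective_resolution (A Quot I) M
           (\<lambda>k. quot_tensor A I (P k)) (\<lambda>k. quot_tensor_map A I (P k) (d k))
           (quot_tensor_ident M \<circ> quot_tensor_map A I (inflate A I M) e) \<and>
         (minimal_projective_resolution A (inflate A I M) P d e \<longrightarrow>
          minimal_projective_resolution (A Quot I) M
            (\<lambda>k. quot_tensor A I (P k)) (\<lambda>k. quot_tensor_map A I (P k) (d k))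
            (quot_tensor_ident M \<circ> quot_tensor_map A I (inflate A I M) e))"
proof -
  note R = assms(1) and I = assms(3) and M = assms(8)
  have res: "resolution A (inflate A I M) P d e" and proj: "\<And>k. projective A (P k)"
    using assms(10) by (simp_all add: projective_resolution_def)
  have PA: "left_module A (P k)" for k using proj[of k] by (simp add: projective_def)
  obtain \<sigma>Q sQ where Q: "split_resolution R A (quot_left A I) Q dQ eQ \<sigma>Q sQ"
    by (rule rel_projective_resolution_split[OF R assms(6)])
  have acycQ: "ideal_acyclic I (quot_left A I) Q dQ eQ n" for n
    by (rule rel_Tor_ideal_acyclic[OF I Q]) (use assms(7) in simp)
  have B: "projective R (scalars A (quot_left A I))"
    by (rule scalars_quot_projective[OF R I split_resolution.N[OF Q] assms(5)])
  have MR: "projective R (scalars A (inflate A I M))" by (rule free_module_projective[OF assms(9)])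
  have "rel_projective_resolution R A (inflate A I M) P d e"
    by (rule projective_resolution_split[OF R scalars_regular_projective[OF R assms(4)] assms(10) MR])
  then obtain \<sigma> s where P: "split_resolution R A (inflate A I M) P d e \<sigma> s"
    by (rule rel_projective_resolution_split[OF R])
  have acyc: "ideal_acyclic I (inflate A I M) P d e n" for n
    by (rule ideal_acyclic_all[OF I Q acycQ B P annihilates_inflate[OF I M] MR])
  have pr: "projective_resolution (A Quot I) M
      (\<lambda>k. quot_tensor A I (P k)) (\<lambda>k. quot_tensor_map A I (P k) (d k))
      (quot_tensor_ident M \<circ> quot_tensor_map A I (inflate A I M) e)"
    unfolding projective_resolution_def
    using quotient_resolution[OF I M res acyc] projective_quot_tensor[OF I proj] by blast
  moreover have "minimal_projective_resolution (A Quot I) M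
      (\<lambda>k. quot_tensor A I (P k)) (\<lambda>k. quot_tensor_map A I (P k) (d k))
      (quot_tensor_ident M \<circ> quot_tensor_map A I (inflate A I M) e)"
    if "minimal_projective_resolution A (inflate A I M) P d e"
    unfolding minimal_iff_cycles quotient_cycles[OF I M res acyc]
    using pr superfluous_quot_tensor[OF I PA] that by (simp add: minimal_iff_cycles)
  ultimately show ?thesis using quot_tensor_ident_iso[OF I M] by blast
qed


end
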